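(* Let $\Omega\subset\mathbb{R}^2$ be an open, bounded, simply connected domain with Lipschitz boundary, let $\nu>0$, $\alpha>0$, $\beta>0$, $\delta\ge 1$, $\gamma\in(0,1)$, and let $f\in H^{-1}(\Omega)$. Let $\lambda_1>0$ be the first eigenvalue of the Dirichlet Laplacian $-\Delta$ on $\Omega$. If $$\nu>\max\left\{\frac{4^{\delta}\alpha^2}{\beta},\ \frac{\beta}{\lambda_1}\left[4^{\delta}(1+\gamma)^2(1+\delta)^2-2\gamma\right]\right\},$$ then the weak problem: find $u\in H_0^1(\Omega)$ such that $$\nu(\nabla u,\nabla v)+\alpha\int_\Omega u^{\delta}\sum_{i=1}^2\frac{\partial u}{\partial x_i}\,v\,dx-\beta\int_\Omega u(1-u^{\delta})(u^{\delta}-\gamma)\,v\,dx=\langle f,v\rangle\quad\text{for all } v\in H_0^1(\Omega),$$ has a unique solution (any two solutions coincide).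
   Context: $(\cdot,\cdot)$ is the $L^2(\Omega)$ inner product, $H^{-1}(\Omega)$ is the dual of $H_0^1(\Omega)$, and $\langle\cdot,\cdot\rangle$ is the corresponding duality pairing. Power convention: if $\delta$ is an integer, $s^\delta$ is the usual power; if $\delta$ is not an integer, $s^{\delta}$ means $|s|^{\delta}$ for $s\in\mathbb{R}$. *)

theory Defs
  imports "HOL-Analysis.Analysis"
begin

text \<open>
  Elements of the spaces below are functions on the whole plane; only their restriction to
  \<^term>\<open>\<Omega>\<close> matters, and equality of elements means equality almost everywhere on it.
\<close>

subsection \<open>Lipschitz boundary\<close>

text \<open>Up to an isometry \<^term>\<open>Q\<close> (rotations and reflections included), the set is locally the part
  of a ball lying strictly above the graph of a Lipschitz function.\<close>

definition lipschitz_boundary :: "(real^2) set \<Rightarrow> bool" where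
  "lipschitz_boundary \<Omega> \<longleftrightarrow>
     (\<forall>p\<in>frontier \<Omega>. \<exists>r>0. \<exists>Q g L. orthogonal_transformation (Q :: real^2 \<Rightarrow> real^2) \<and>
        L-lipschitz_on UNIV (g :: real \<Rightarrow> real) \<and>
        \<Omega> \<inter> ball p r = {x \<in> ball p r. g (Q x $ 1) < Q x $ 2})"

subsection \<open>Test functions\<close>

definition partial_deriv :: "2 \<Rightarrow> (real^2 \<Rightarrow> real) \<Rightarrow> real^2 \<Rightarrow> real" where
  "partial_deriv i \<phi> x = frechet_derivative \<phi> (at x) (axis i 1)"

primrec C_k :: "nat \<Rightarrow> (real^2 \<Rightarrow> real) \<Rightarrow> bool" where
  "C_k 0 \<phi> \<longleftrightarrow> continuous_on UNIV \<phi>"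
| "C_k (Suc k) \<phi> \<longleftrightarrow> (\<forall>x. \<phi> differentiable at x) \<and> (\<forall>i. C_k k (partial_deriv i \<phi>))"

definition test_functions :: "(real^2) set \<Rightarrow> (real^2 \<Rightarrow> real) set" where
  "test_functions \<Omega> = {\<phi>. (\<forall>k. C_k k \<phi>) \<and>
     compact (closure {x. \<phi> x \<noteq> 0}) \<and> closure {x. \<phi> x \<noteq> 0} \<subseteq> \<Omega>}"

subsection \<open>Lebesgue and Sobolev spaces\<close>

definition L2 :: "(real^2) set \<Rightarrow> (real^2 \<Rightarrow> real) set" where
  "L2 \<Omega> = {u \<in> borel_measurable (lebesgue_on \<Omega>). integrable (lebesgue_on \<Omega>) (\<lambda>x. (u x)\<^sup>2)}"

definition L2_inner :: "(real^2) set \<Rightarrow> (real^2 \<Rightarrow> 'a::real_inner) \<Rightarrow> (real^2 \<Rightarrow> 'a) \<Rightarrow> real" where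
  "L2_inner \<Omega> u v = (\<integral>x. u x \<bullet> v x \<partial>lebesgue_on \<Omega>)"

definition is_weak_grad :: "(real^2) set \<Rightarrow> (real^2 \<Rightarrow> real) \<Rightarrow> (real^2 \<Rightarrow> real^2) \<Rightarrow> bool" where
  "is_weak_grad \<Omega> u G \<longleftrightarrow> (\<forall>i. (\<lambda>x. G x $ i) \<in> L2 \<Omega>) \<and>
     (\<forall>i. \<forall>\<phi>\<in>test_functions \<Omega>.
        (\<integral>x. u x * partial_deriv i \<phi> x \<partial>lebesgue_on \<Omega>) = - (\<integral>x. G x $ i * \<phi> x \<partial>lebesgue_on \<Omega>))"

definition H1 :: "(real^2) set \<Rightarrow> (real^2 \<Rightarrow> real) set" where
  "H1 \<Omega> = {u \<in> L2 \<Omega>. \<exists>G. is_weak_grad \<Omega> u G}"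

text \<open>The weak gradient is determined up to a null set, so the choice is immaterial.\<close>

definition weak_grad :: "(real^2) set \<Rightarrow> (real^2 \<Rightarrow> real) \<Rightarrow> real^2 \<Rightarrow> real^2" where
  "weak_grad \<Omega> u = (SOME G. is_weak_grad \<Omega> u G)"

definition H1_norm :: "(real^2) set \<Rightarrow> (real^2 \<Rightarrow> real) \<Rightarrow> real" where
  "H1_norm \<Omega> u = sqrt (L2_inner \<Omega> u u + L2_inner \<Omega> (weak_grad \<Omega> u) (weak_grad \<Omega> u))"

definition H10 :: "(real^2) set \<Rightarrow> (real^2 \<Rightarrow> real) set" where
  "H10 \<Omega> = {u \<in> H1 \<Omega>. \<exists>\<phi> :: nat \<Rightarrow> real^2 \<Rightarrow> real. (\<forall>n. \<phi> n \<in> test_functions \<Omega>) \<and>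
     (\<lambda>n. H1_norm \<Omega> (\<lambda>x. \<phi> n x - u x)) \<longlonglongrightarrow> 0}"

text \<open>The duality pairing of \<^term>\<open>f\<close> with \<^term>\<open>v\<close> is the application \<^term>\<open>f v\<close>. Boundedness and
  linearity make it independent of the representative of \<^term>\<open>v\<close>; values of \<^term>\<open>f\<close> off
  \<^term>\<open>H10 \<Omega>\<close> are irrelevant.\<close>

definition H_minus1 :: "(real^2) set \<Rightarrow> ((real^2 \<Rightarrow> real) \<Rightarrow> real) set" where
  "H_minus1 \<Omega> = {f.
     (\<forall>u\<in>H10 \<Omega>. \<forall>v\<in>H10 \<Omega>. f (\<lambda>x. u x + v x) = f u + f v) \<and>
     (\<forall>c. \<forall>v\<in>H10 \<Omega>. f (\<lambda>x. c * v x) = c * f v) \<and>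
     (\<exists>C. \<forall>v\<in>H10 \<Omega>. \<bar>f v\<bar> \<le> C * H1_norm \<Omega> v)}"

subsection \<open>First eigenvalue of the Dirichlet Laplacian\<close>

definition dirichlet_eigenvalue :: "(real^2) set \<Rightarrow> real \<Rightarrow> bool" where
  "dirichlet_eigenvalue \<Omega> \<mu> \<longleftrightarrow>
     (\<exists>u\<in>H10 \<Omega>. \<not> (AE x in lebesgue_on \<Omega>. u x = 0) \<and>
        (\<forall>v\<in>H10 \<Omega>. L2_inner \<Omega> (weak_grad \<Omega> u) (weak_grad \<Omega> v) = \<mu> * L2_inner \<Omega> u v))"

definition first_dirichlet_eigenvalue :: "(real^2) set \<Rightarrow> real" where
  "first_dirichlet_eigenvalue \<Omega> = (LEAST \<mu>. dirichlet_eigenvalue \<Omega> \<mu>)"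

subsection \<open>The weak problem\<close>

text \<open>The usual power for an integer exponent (used only for exponents at least 1), and the power
  of the absolute value for every other exponent.\<close>

definition conv_power :: "real \<Rightarrow> real \<Rightarrow> real" where
  "conv_power \<delta> s = (if \<delta> \<in> \<int> then s ^ nat \<lfloor>\<delta>\<rfloor> else \<bar>s\<bar> powr \<delta>)"

definition weak_solution ::
  "(real^2) set \<Rightarrow> real \<Rightarrow> real \<Rightarrow> real \<Rightarrow> real \<Rightarrow> real \<Rightarrow> ((real^2 \<Rightarrow> real) \<Rightarrow> real) \<Rightarrow> (real^2 \<Rightarrow> real) \<Rightarrow> bool"
where
  "weak_solution \<Omega> \<nu> \<alpha> \<beta> \<delta> \<gamma> f u \<longleftrightarrow> u \<in> H10 \<Omega> \<and>
     (\<forall>v\<in>H10 \<Omega>.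
        \<nu> * L2_inner \<Omega> (weak_grad \<Omega> u) (weak_grad \<Omega> v)
        + \<alpha> * (\<integral>x. conv_power \<delta> (u x) * (\<Sum>i\<in>UNIV. weak_grad \<Omega> u x $ i) * v x \<partial>lebesgue_on \<Omega>)
        - \<beta> * (\<integral>x. u x * (1 - conv_power \<delta> (u x)) * (conv_power \<delta> (u x) - \<gamma>) * v x
                 \<partial>lebesgue_on \<Omega>)
        = f v)"

end

theory Submission
  imports Defs
begin

text \<open>
  For \<open>\<nu>\<close> this large the operator of the problem is strongly monotone on the Hilbert space
  \<^term>\<open>H10 \<Omega>\<close> with the Dirichlet inner product. Testing the difference of two instances with
  \<open>w = u - v\<close>, the odd monomial \<open>s \<bar>s\<bar>\<^bsup>2\<delta>\<^esup>\<close> contributes \<open>\<beta>/2 \<integral>(\<bar>u\<bar>\<^bsup>2\<delta>\<^esup> + \<bar>v\<bar>\<^bsup>2\<delta>\<^esup>) w\<^sup>2\<close>. Half of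
  it absorbs the convective term, integrated by parts, and the other half absorbs the quadratic part
  of the reaction term up to a multiple of \<open>\<integral>w\<^sup>2\<close>, which the first eigenvalue controls. The operator
  is also Lipschitz on bounded sets, since in the plane \<^term>\<open>H10 \<Omega>\<close> embeds into every
  \<open>L\<^sup>p\<close> with \<open>p < \<infinity>\<close>; hence a damped Picard iteration contracts on a large ball, which gives existence,
  and strong monotonicity gives uniqueness.

  The least eigenvalue is attained because a minimizing sequence of the Rayleigh quotient is Cauchy
  along a subsequence: averages over the squares of a grid are finitely many bounded functionals, and
  they control the \<open>L\<^sup>2\<close> norm up to a small multiple of the Dirichlet energy.
\<close>

section \<open>Semi-inner products, monotone equations and Rayleigh quotients\<close>

text \<open>Functions are not identified when they agree almost everywhere, and a weak gradient is
  an arbitrary choice. So the Dirichlet form is only semidefinite on a set of functions, limits are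
  not unique, and the gradient is linear only almost everywhere; the abstract part is therefore
  written for semi-inner products. For non-integer \<delta> the power is C^1 but not smooth, so
  calculus is done with C^1 functions of compact support. A chain rule for weak gradients is
  avoided: identities and inequalities are proved for test functions and passed to limits. The
  budget of monotonicity, with E the Dirichlet energy of w, is \<nu> E = \<nu>/2 E for convection
  (the square of the sum of two partial derivatives costs a factor 2), plus \<nu>/4 E for reaction,
  plus \<nu>/4 E as the remaining monotonicity constant. Both thresholds on \<nu> enter through 4
  \<le> \<open>4 powr \<delta>\<close>, which comes from \<delta> \<ge> 1.\<close>

lemma quadratic_nonneg_imp_linear_coeff_zero:
  fixes b c :: real
  assumes "\<And>t. 0 \<le> 2 * t * b + t\<^sup>2 * c"
  shows "b = 0"
proof (rule ccontr)
  assume b: "b \<noteq> 0"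
  \<comment> \<open>With this t the linear term 2 t b equals -2 t^2 (|c| + 1), which outweighs t^2 c
    for either sign of c.\<close>
  define t where "t = - b / (\<bar>c\<bar> + 1)"
  have "\<bar>c\<bar> + 1 > 0" by simp
  hence tb: "t * (\<bar>c\<bar> + 1) = - b" unfolding t_def by (simp add: field_simps)
  have "t \<noteq> 0" using b tb by auto
  hence "t\<^sup>2 > 0" by simp
  have "t\<^sup>2 * c \<le> t\<^sup>2 * \<bar>c\<bar>" by (intro mult_left_mono) auto
  moreover have "t * b = - (t\<^sup>2 * \<bar>c\<bar> + t\<^sup>2)"
    using arg_cong[OF tb, of "\<lambda>z. - (t * z)"] by (simp add: power2_eq_square distrib_left)
  moreover have "0 \<le> t\<^sup>2 * \<bar>c\<bar>" by simp
  moreover have "2 * t * b = 2 * (t * b)" by simp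
  ultimately have "2 * t * b + t\<^sup>2 * c < 0" using \<open>t\<^sup>2 > 0\<close> by linarith
  thus False using assms[of t] by simp
qed

text \<open>Bolzano-Weierstrass for one functional at a time; those already treated stay convergent
  along the later subsequences. This is the finite-dimensional half of the compactness argument for
  the Rayleigh quotient.\<close>

lemma bounded_coordinates_convergent_subsequence:
  fixes X :: "nat \<Rightarrow> 'a" and S :: "('a \<Rightarrow> real) set"
  assumes "finite S" and "\<And>l. l \<in> S \<Longrightarrow> bounded (range (\<lambda>n. l (X n)))"
  shows "\<exists>r::nat \<Rightarrow> nat. strict_mono r \<and> (\<forall>l\<in>S. convergent (\<lambda>n. l (X (r n))))"
  using assms
proof (induction S)
  case empty
  show ?case by (auto intro: exI[of _ id] simp: strict_mono_def)
next
  case (insert l S)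
  then obtain r :: "nat \<Rightarrow> nat" where r: "strict_mono r" "\<forall>l\<in>S. convergent (\<lambda>n. l (X (r n)))"
    by auto
  have "bounded (range (\<lambda>n. l (X (r n))))"
    using insert.prems[of l] by (rule bounded_subset) auto
  then obtain a and s :: "nat \<Rightarrow> nat" where s: "strict_mono s" "((\<lambda>n. l (X (r n))) \<circ> s) \<longlonglongrightarrow> a"
    using bounded_imp_convergent_subsequence by blast
  have "convergent (\<lambda>n. k (X (r (s n))))" if "k \<in> S" for k
    using convergent_subseq_convergent[OF r(2)[rule_format, OF that] s(1)] by (simp add: o_def)
  moreover have "convergent (\<lambda>n. l (X (r (s n))))" using s(2) by (auto simp: o_def convergent_def)
  ultimately show ?case
    using strict_mono_o[OF r(1) s(1)] by (intro exI[of _ "r \<circ> s"]) (auto simp: o_def)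
qed

section \<open>Semi-inner product spaces of functions\<close>

locale semi_inner_space =
  fixes V :: "('b \<Rightarrow> real) set" and ip :: "('b \<Rightarrow> real) \<Rightarrow> ('b \<Rightarrow> real) \<Rightarrow> real"
  assumes zero_mem: "(\<lambda>_. 0) \<in> V"
    and add_mem: "u \<in> V \<Longrightarrow> v \<in> V \<Longrightarrow> (\<lambda>x. u x + v x) \<in> V"
    and scale_mem: "u \<in> V \<Longrightarrow> (\<lambda>x. c * u x) \<in> V"
    and ip_add: "u \<in> V \<Longrightarrow> v \<in> V \<Longrightarrow> w \<in> V \<Longrightarrow> ip (\<lambda>x. u x + v x) w = ip u w + ip v w"
    and ip_scale: "u \<in> V \<Longrightarrow> w \<in> V \<Longrightarrow> ip (\<lambda>x. c * u x) w = c * ip u w"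
    and ip_commute: "u \<in> V \<Longrightarrow> v \<in> V \<Longrightarrow> ip u v = ip v u"
    and ip_ge0: "u \<in> V \<Longrightarrow> 0 \<le> ip u u"
begin

definition nrm :: "('b \<Rightarrow> real) \<Rightarrow> real" where
  "nrm u = sqrt (ip u u)"

lemma minus_mem: "u \<in> V \<Longrightarrow> (\<lambda>x. - u x) \<in> V"
  using scale_mem[of u "-1"] by simp

lemma diff_mem: "u \<in> V \<Longrightarrow> v \<in> V \<Longrightarrow> (\<lambda>x. u x - v x) \<in> V"
  using add_mem[OF _ minus_mem, of u v] by simp

lemma ip_diff: "u \<in> V \<Longrightarrow> v \<in> V \<Longrightarrow> w \<in> V \<Longrightarrow> ip (\<lambda>x. u x - v x) w = ip u w - ip v w"
  using ip_add[OF _ scale_mem[of v "-1"], of u w] ip_scale[of v w "-1"] by simp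

lemma ip_add_right: "u \<in> V \<Longrightarrow> v \<in> V \<Longrightarrow> w \<in> V \<Longrightarrow> ip w (\<lambda>x. u x + v x) = ip w u + ip w v"
  using ip_add[of u v w] ip_commute[of w] add_mem[of u v] by simp

lemma ip_diff_right: "u \<in> V \<Longrightarrow> v \<in> V \<Longrightarrow> w \<in> V \<Longrightarrow> ip w (\<lambda>x. u x - v x) = ip w u - ip w v"
  using ip_diff[of u v w] ip_commute[of w] diff_mem[of u v] by simp

lemma ip_scale_right: "u \<in> V \<Longrightarrow> w \<in> V \<Longrightarrow> ip w (\<lambda>x. c * u x) = c * ip w u"
  using ip_scale[of u w c] ip_commute[of w] scale_mem[of u c] by simp

lemmas mem_intros = zero_mem add_mem scale_mem minus_mem diff_mem
lemmas ip_simps = ip_add ip_diff ip_scale ip_add_right ip_diff_right ip_scale_right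

lemma nrm_ge0: "u \<in> V \<Longrightarrow> 0 \<le> nrm u"
  by (simp add: nrm_def ip_ge0)

lemma nrm_power2: "u \<in> V \<Longrightarrow> (nrm u)\<^sup>2 = ip u u"
  by (simp add: nrm_def ip_ge0)

lemma ip_sq_le: assumes "u \<in> V" "v \<in> V" shows "(ip u v)\<^sup>2 \<le> ip u u * ip v v"
proof (cases "ip v v = 0")
  \<comment> \<open>A vector of norm zero need not be the zero function here. Perturbing
    \<open>v\<close> by \<open>t u\<close> gives a nonnegative quadratic in t without constant term,
    so its linear coefficient vanishes.\<close>
  case True
  have "0 \<le> 2 * t * (ip v u) + t\<^sup>2 * (ip u u)" for t
  proof -
    have "0 \<le> ip (\<lambda>x. v x + t * u x) (\<lambda>x. v x + t * u x)"
      using assms by (intro ip_ge0 mem_intros)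
    also have "\<dots> = 2 * t * (ip v u) + t\<^sup>2 * (ip u u)"
      using assms True by (simp add: ip_simps mem_intros ip_commute power2_eq_square algebra_simps)
    finally show ?thesis .
  qed
  hence "ip v u = 0" by (rule quadratic_nonneg_imp_linear_coeff_zero)
  thus ?thesis using assms True ip_commute by simp
next
  case False
  hence p: "ip v v > 0" using ip_ge0[OF assms(2)] by simp
  define t where "t = ip u v / ip v v"
  have "0 \<le> ip (\<lambda>x. u x - t * v x) (\<lambda>x. u x - t * v x)"
    using assms by (intro ip_ge0 mem_intros)
  also have "\<dots> = ip u u - 2 * t * ip u v + t\<^sup>2 * ip v v"
    using assms by (simp add: ip_simps mem_intros ip_commute[of v u] power2_eq_square algebra_simps)
  also have "\<dots> = ip u u - (ip u v)\<^sup>2 / ip v v"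
    using p by (simp add: t_def field_simps power2_eq_square)
  finally show ?thesis using p by (simp add: field_simps)
qed

lemma ip_le: assumes "u \<in> V" "v \<in> V" shows "\<bar>ip u v\<bar> \<le> nrm u * nrm v"
proof -
  have "\<bar>ip u v\<bar> = sqrt ((ip u v)\<^sup>2)" by simp
  also have "\<dots> \<le> sqrt (ip u u * ip v v)" using ip_sq_le[OF assms] by (rule real_sqrt_le_mono)
  finally show ?thesis by (simp add: nrm_def real_sqrt_mult)
qed

lemma nrm_triangle: assumes "u \<in> V" "v \<in> V" shows "nrm (\<lambda>x. u x + v x) \<le> nrm u + nrm v"
proof (rule power2_le_imp_le)
  have "(nrm (\<lambda>x. u x + v x))\<^sup>2 = ip u u + 2 * ip u v + ip v v"
    using assms by (simp add: nrm_power2 ip_simps mem_intros ip_commute[of v u])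
  also have "\<dots> \<le> ip u u + 2 * (nrm u * nrm v) + ip v v" using ip_le[OF assms] by simp
  also have "\<dots> = (nrm u + nrm v)\<^sup>2"
    using assms by (simp add: nrm_power2[symmetric] power2_sum)
  finally show "(nrm (\<lambda>x. u x + v x))\<^sup>2 \<le> (nrm u + nrm v)\<^sup>2" .
qed (use assms nrm_ge0 in auto)

lemma nrm_scale: "u \<in> V \<Longrightarrow> nrm (\<lambda>x. c * u x) = \<bar>c\<bar> * nrm u"
  by (simp add: nrm_def ip_simps mem_intros real_sqrt_mult mult.assoc[symmetric])

lemma nrm_minus: "u \<in> V \<Longrightarrow> nrm (\<lambda>x. - u x) = nrm u"
  using nrm_scale[of u "-1"] by simp

lemma nrm_zero: "nrm (\<lambda>_. 0) = 0"
  using nrm_scale[OF zero_mem, of 0] by simp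

lemma nrm_diff_commute: assumes "u \<in> V" "v \<in> V" shows "nrm (\<lambda>x. u x - v x) = nrm (\<lambda>x. v x - u x)"
  using nrm_minus[OF diff_mem[OF assms]] by simp

lemma nrm_diff_le: assumes "u \<in> V" "v \<in> V" shows "nrm (\<lambda>x. u x - v x) \<le> nrm u + nrm v"
  using nrm_triangle[OF assms(1) minus_mem[OF assms(2)]] nrm_minus[OF assms(2)] by simp

lemma nrm_diff_triangle:
  assumes "u \<in> V" "v \<in> V" "w \<in> V"
  shows "nrm (\<lambda>x. u x - w x) \<le> nrm (\<lambda>x. u x - v x) + nrm (\<lambda>x. v x - w x)"
  using nrm_triangle[OF diff_mem[OF assms(1,2)] diff_mem[OF assms(2,3)]] by simp

lemma nrm_reverse_triangle:
  assumes "u \<in> V" "v \<in> V" shows "\<bar>nrm u - nrm v\<bar> \<le> nrm (\<lambda>x. u x - v x)"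
  using nrm_triangle[OF diff_mem[OF assms] assms(2)]
    nrm_triangle[OF diff_mem[OF assms(2,1)] assms(1)] nrm_diff_commute[OF assms]
  by simp

lemma nrm_tendsto:
  assumes "\<And>n::nat. X n \<in> V" "u \<in> V" "(\<lambda>n. nrm (\<lambda>x. X n x - u x)) \<longlonglongrightarrow> 0"
  shows "(\<lambda>n. nrm (X n)) \<longlonglongrightarrow> nrm u"
  by (rule LIM_zero_cancel, rule tendsto_rabs_zero_cancel, rule tendsto_sandwich[OF _ _ tendsto_const assms(3)])
     (use nrm_reverse_triangle[OF assms(1,2)] in auto)

lemma ip_tendsto:
  assumes "\<And>n::nat. X n \<in> V" "u \<in> V" "(\<lambda>n. nrm (\<lambda>x. X n x - u x)) \<longlonglongrightarrow> 0"
    and "\<And>n. Y n \<in> V" "v \<in> V" "(\<lambda>n. nrm (\<lambda>x. Y n x - v x)) \<longlonglongrightarrow> 0"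
  shows "(\<lambda>n. ip (X n) (Y n)) \<longlonglongrightarrow> ip u v"
proof (rule LIM_zero_cancel, rule tendsto_rabs_zero_cancel, rule tendsto_sandwich[OF _ _ tendsto_const])
  show "\<forall>\<^sub>F n in sequentially. \<bar>ip (X n) (Y n) - ip u v\<bar>
      \<le> nrm (\<lambda>x. X n x - u x) * nrm (Y n) + nrm u * nrm (\<lambda>x. Y n x - v x)"
  proof (intro always_eventually allI)
    fix n
    have "ip (X n) (Y n) - ip u v = ip (\<lambda>x. X n x - u x) (Y n) + ip u (\<lambda>x. Y n x - v x)"
      using assms by (simp add: ip_simps)
    moreover have "\<bar>ip (\<lambda>x. X n x - u x) (Y n)\<bar> \<le> nrm (\<lambda>x. X n x - u x) * nrm (Y n)"
      using assms by (intro ip_le mem_intros) auto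
    moreover have "\<bar>ip u (\<lambda>x. Y n x - v x)\<bar> \<le> nrm u * nrm (\<lambda>x. Y n x - v x)"
      using assms by (intro ip_le mem_intros) auto
    ultimately show "\<bar>ip (X n) (Y n) - ip u v\<bar>
      \<le> nrm (\<lambda>x. X n x - u x) * nrm (Y n) + nrm u * nrm (\<lambda>x. Y n x - v x)" by linarith
  qed
  have "(\<lambda>n. nrm (\<lambda>x. X n x - u x) * nrm (Y n) + nrm u * nrm (\<lambda>x. Y n x - v x)) \<longlonglongrightarrow> 0 * nrm v + nrm u * 0"
    by (intro tendsto_intros assms nrm_tendsto[OF assms(4,5,6)])
  thus "(\<lambda>n. nrm (\<lambda>x. X n x - u x) * nrm (Y n) + nrm u * nrm (\<lambda>x. Y n x - v x)) \<longlonglongrightarrow> 0" by simp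
qed auto

end

section \<open>Complete spaces: Riesz representation, monotone equations, Rayleigh quotients\<close>

locale semi_hilbert_space = semi_inner_space V ip
  for V :: "('b \<Rightarrow> real) set" and ip +
  assumes complete: "(\<And>n::nat. X n \<in> V) \<Longrightarrow>
     (\<And>e. e > 0 \<Longrightarrow> \<exists>N. \<forall>m\<ge>N. \<forall>n\<ge>N. nrm (\<lambda>x. X m x - X n x) < e) \<Longrightarrow>
     \<exists>u\<in>V. (\<lambda>n. nrm (\<lambda>x. X n x - u x)) \<longlonglongrightarrow> 0"
begin

text \<open>Dirichlet principle: the representative minimises \<open>J\<close>. Completing the
  square with the bound on \<open>l\<close> shows that \<open>J\<close> is bounded below by the
  negative square of \<open>C\<close>, and the parallelogram law makes a minimising sequence
  Cauchy.\<close>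

theorem riesz_representation:
  fixes l :: "('b \<Rightarrow> real) \<Rightarrow> real"
  assumes l_add: "\<And>u v. u \<in> V \<Longrightarrow> v \<in> V \<Longrightarrow> l (\<lambda>x. u x + v x) = l u + l v"
    and l_scale: "\<And>c v. v \<in> V \<Longrightarrow> l (\<lambda>x. c * v x) = c * l v"
    and l_bound: "\<And>v. v \<in> V \<Longrightarrow> \<bar>l v\<bar> \<le> C * nrm v"
  shows "\<exists>u\<in>V. \<forall>v\<in>V. ip u v = l v"
proof -
  define J where "J v = ip v v - 2 * l v" for v
  have l_diff: "l (\<lambda>x. u x - v x) = l u - l v" if "u \<in> V" "v \<in> V" for u v
    using l_add[OF that(1) scale_mem[OF that(2), of "-1"]] l_scale[OF that(2), of "-1"] by simp
  have "- C\<^sup>2 \<le> J v" if "v \<in> V" for v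
  proof -
    have "0 \<le> (nrm v - C)\<^sup>2" by simp
    also have "\<dots> = ip v v - 2 * (C * nrm v) + C\<^sup>2" using that by (simp add: power2_diff nrm_power2)
    finally show ?thesis using l_bound[OF that] unfolding J_def by linarith
  qed
  hence bdd: "bdd_below (J ` V)" by (auto intro!: bdd_belowI)
  define m where "m = Inf (J ` V)"
  have m_le: "m \<le> J v" if "v \<in> V" for v
    unfolding m_def using bdd that by (auto intro: cInf_lower)
  have "\<exists>v\<in>V. J v < m + 1 / real (Suc n)" for n
  proof -
    have "Inf (J ` V) < m + 1 / real (Suc n)" by (simp add: m_def)
    thus ?thesis using zero_mem cInf_lessD[of "J ` V"] by auto
  qed
  then obtain X where XV: "\<And>n. X n \<in> V" and XJ: "\<And>n. J (X n) < m + 1 / real (Suc n)" by metis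
  \<comment> \<open>\<open>z\<close> is the midpoint. In 2 J u + 2 J v - 4 J z the linear parts
    cancel and the parallelogram law leaves the squared distance; \<open>J z\<close> is at least the
    infimum.\<close>
  have par: "ip (\<lambda>x. u x - v x) (\<lambda>x. u x - v x) \<le> 2 * (J u - m) + 2 * (J v - m)"
    if "u \<in> V" "v \<in> V" for u v
  proof -
    define z where "z = (\<lambda>x. 1/2 * (u x + v x))"
    have mem: "z \<in> V" unfolding z_def using that by (intro mem_intros)
    have "ip (\<lambda>x. u x - v x) (\<lambda>x. u x - v x) = 2 * J u + 2 * J v - 4 * J z"
      unfolding J_def z_def using that
      by (simp add: ip_simps mem_intros l_add l_scale[OF add_mem] ip_commute[of v u]
           del: times_divide_eq_left mult_1)
         (simp add: algebra_simps)
    also have "\<dots> \<le> 2 * (J u - m) + 2 * (J v - m)" using m_le[OF mem] by simp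
    finally show ?thesis .
  qed
  have "\<exists>N. \<forall>p\<ge>N. \<forall>q\<ge>N. nrm (\<lambda>x. X p x - X q x) < e" if "e > 0" for e
  proof -
    obtain N where N: "real N > 4 / e\<^sup>2" using reals_Archimedean2 by blast
    have "nrm (\<lambda>x. X p x - X q x) < e" if "p \<ge> N" "q \<ge> N" for p q
    proof -
      have *: "1 / real (Suc k) < e\<^sup>2 / 4" if "k \<ge> N" for k
      proof -
        have "4 / e\<^sup>2 < real (Suc k)" using N that by linarith
        thus ?thesis using \<open>e > 0\<close> by (simp add: field_simps)
      qed
      have "(nrm (\<lambda>x. X p x - X q x))\<^sup>2 \<le> 2 * (J (X p) - m) + 2 * (J (X q) - m)"
        using par[OF XV XV] by (simp add: nrm_power2 diff_mem XV)
      also have "\<dots> < 2 * (e\<^sup>2 / 4) + 2 * (e\<^sup>2 / 4)"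
        by (intro add_strict_mono mult_strict_left_mono)
           (use XJ[of p] XJ[of q] *[OF that(1)] *[OF that(2)] in linarith)+
      also have "\<dots> = e\<^sup>2" by simp
      finally show ?thesis using \<open>e > 0\<close> by (simp add: power2_less_imp_less)
    qed
    thus ?thesis by blast
  qed
  from complete[OF XV this] obtain u where u: "u \<in> V" and lim: "(\<lambda>n. nrm (\<lambda>x. X n x - u x)) \<longlonglongrightarrow> 0"
    by blast
  have "(\<lambda>n. l (X n)) \<longlonglongrightarrow> l u"
  proof (rule LIM_zero_cancel, rule tendsto_rabs_zero_cancel, rule tendsto_sandwich[OF _ _ tendsto_const])
    show "(\<lambda>n. C * nrm (\<lambda>x. X n x - u x)) \<longlonglongrightarrow> 0" using tendsto_mult[OF tendsto_const[of C] lim] by simp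
    show "\<forall>\<^sub>F n in sequentially. \<bar>l (X n) - l u\<bar> \<le> C * nrm (\<lambda>x. X n x - u x)"
      using l_bound[OF diff_mem[OF XV u]] l_diff[OF XV u] by simp
  qed auto
  hence "(\<lambda>n. J (X n)) \<longlonglongrightarrow> J u"
    unfolding J_def by (intro tendsto_intros ip_tendsto XV u lim)
  moreover have "(\<lambda>n. m + 1 / real (Suc n)) \<longlonglongrightarrow> m + 0"
    by (intro tendsto_intros LIMSEQ_Suc[OF lim_1_over_n])
  ultimately have Ju: "J u \<le> m"
    using XJ by (intro LIMSEQ_le[of "\<lambda>n. J (X n)" _ "\<lambda>n. m + 1 / real (Suc n)"]) (auto intro: less_imp_le)
  have "ip u v = l v" if v: "v \<in> V" for v
  proof -
    \<comment> \<open>First variation at the minimiser in the direction \<open>v\<close>;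
      nonnegativity for all t of both signs kills the linear coefficient.\<close>
    have "0 \<le> 2 * t * (ip u v - l v) + t\<^sup>2 * ip v v" for t
    proof -
      have "J u \<le> J (\<lambda>x. u x + t * v x)"
        by (rule order_trans[OF Ju m_le]) (intro mem_intros u v)
      thus ?thesis unfolding J_def using u v
        by (simp add: ip_simps mem_intros l_add l_scale ip_commute[of v u] power2_eq_square algebra_simps)
    qed
    thus ?thesis using quadratic_nonneg_imp_linear_coeff_zero by fastforce
  qed
  thus ?thesis using u by blast
qed


text \<open>Zarantonello's argument: \<open>a u\<close> is a functional that may depend nonlinearly
  on \<open>u\<close>, and \<open>T u\<close> is \<open>u\<close> minus \<rho> times its Riesz
  representative, so fixed points of \<open>T\<close> solve the equation. Since the Lipschitz
  constant depends on the ball, one ball that \<open>T\<close> maps into itself is fixed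
  beforehand.\<close>

theorem strongly_monotone_solution:
  fixes a :: "('b \<Rightarrow> real) \<Rightarrow> ('b \<Rightarrow> real) \<Rightarrow> real"
  assumes a_add: "\<And>u v w. u \<in> V \<Longrightarrow> v \<in> V \<Longrightarrow> w \<in> V \<Longrightarrow> a u (\<lambda>x. v x + w x) = a u v + a u w"
    and a_scale: "\<And>u c v. u \<in> V \<Longrightarrow> v \<in> V \<Longrightarrow> a u (\<lambda>x. c * v x) = c * a u v"
    and a_zero: "\<And>v. v \<in> V \<Longrightarrow> \<bar>a (\<lambda>_. 0) v\<bar> \<le> M * nrm v"
    and a_lipschitz: "\<And>R. \<exists>L. \<forall>u\<in>V. \<forall>v\<in>V. \<forall>w\<in>V. nrm u \<le> R \<longrightarrow> nrm v \<le> R \<longrightarrow>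
            \<bar>a u w - a v w\<bar> \<le> L * nrm (\<lambda>x. u x - v x) * nrm w"
    and c: "c > 0"
    and a_mono: "\<And>u v. u \<in> V \<Longrightarrow> v \<in> V \<Longrightarrow>
            c * (nrm (\<lambda>x. u x - v x))\<^sup>2 \<le> a u (\<lambda>x. u x - v x) - a v (\<lambda>x. u x - v x)"
  shows "\<exists>u\<in>V. \<forall>v\<in>V. a u v = 0"
proof -
  define M' where "M' = max M 0"
  have a_zero': "\<bar>a (\<lambda>_. 0) v\<bar> \<le> M' * nrm v" if "v \<in> V" for v
    by (rule order_trans[OF a_zero[OF that]]) (use nrm_ge0[OF that] in \<open>auto simp: M'_def intro: mult_right_mono\<close>)
  \<comment> \<open>\<open>T\<close> moves 0 by at most \<rho> M' = \<rho> c R / 2, while its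
    contraction factor is at most 1 - \<rho> c / 2. Hence the ball of radius \<open>R\<close> is
    mapped into itself, whatever the Lipschitz constant on it turns out to be.\<close>
  define R where "R = 2 * M' / c"
  have R0: "R \<ge> 0" using c by (simp add: R_def M'_def)
  have M'_eq: "M' = c * R / 2" using c by (simp add: R_def)
  define Bl where "Bl = {u \<in> V. nrm u \<le> R}"
  have BlV: "u \<in> V" if "u \<in> Bl" for u using that by (simp add: Bl_def)
  have zero_Bl: "(\<lambda>_. 0) \<in> Bl" using R0 by (simp add: Bl_def zero_mem nrm_zero)
  obtain L0 where L0: "\<forall>u\<in>V. \<forall>v\<in>V. \<forall>w\<in>V. nrm u \<le> R \<longrightarrow> nrm v \<le> R \<longrightarrow>
            \<bar>a u w - a v w\<bar> \<le> L0 * nrm (\<lambda>x. u x - v x) * nrm w"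
    using a_lipschitz[of R] by blast
  \<comment> \<open>Enlarging the constant to at least \<open>c\<close> gives c / L \<le> 1, so the
    square root defining \<open>q\<close> is taken of a nonnegative number.\<close>
  define L where "L = max L0 c"
  have Lc: "L \<ge> c" and Lp: "L > 0" using c by (auto simp: L_def)
  have lip: "\<bar>a u w - a v w\<bar> \<le> L * nrm (\<lambda>x. u x - v x) * nrm w"
    if "u \<in> Bl" "v \<in> Bl" "w \<in> V" for u v w
  proof (rule order_trans)
    show "\<bar>a u w - a v w\<bar> \<le> L0 * nrm (\<lambda>x. u x - v x) * nrm w"
      using L0 that by (auto simp: Bl_def)
    show "L0 * nrm (\<lambda>x. u x - v x) * nrm w \<le> L * nrm (\<lambda>x. u x - v x) * nrm w"
      using that BlV by (intro mult_right_mono nrm_ge0 mem_intros) (auto simp: L_def)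
  qed
  \<comment> \<open>This minimises 1 - 2 \<rho> c + \<rho>^2 L^2, the bound for the squared
    contraction factor; the minimum is 1 - (c / L)^2.\<close>
  define \<rho> where "\<rho> = c / L\<^sup>2"
  have rp: "\<rho> > 0" using c Lp by (simp add: \<rho>_def)
  have "\<exists>t\<in>V. \<forall>v\<in>V. ip t v = ip u v - \<rho> * a u v" if "u \<in> Bl" for u
  proof (rule riesz_representation)
    fix v assume v: "v \<in> V"
    have "\<bar>a u v\<bar> \<le> \<bar>a (\<lambda>_. 0) v\<bar> + \<bar>a u v - a (\<lambda>_. 0) v\<bar>" by linarith
    also have "\<dots> \<le> M' * nrm v + L * nrm u * nrm v"
      using a_zero'[OF v] lip[OF that zero_Bl v] by simp
    finally have "\<rho> * \<bar>a u v\<bar> \<le> \<rho> * (M' * nrm v + L * nrm u * nrm v)" using rp by simp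
    moreover have "\<bar>ip u v\<bar> \<le> nrm u * nrm v" using ip_le BlV that v by blast
    moreover have "\<bar>\<rho> * a u v\<bar> = \<rho> * \<bar>a u v\<bar>" using rp by (simp add: abs_mult)
    ultimately show "\<bar>ip u v - \<rho> * a u v\<bar> \<le> (nrm u + \<rho> * (M' + L * nrm u)) * nrm v"
      by (simp add: algebra_simps)
  qed (use BlV[OF that] in \<open>simp_all add: ip_simps a_add a_scale algebra_simps\<close>)
  then obtain T where TV: "\<And>u. u \<in> Bl \<Longrightarrow> T u \<in> V"
    and T: "\<And>u v. u \<in> Bl \<Longrightarrow> v \<in> V \<Longrightarrow> ip (T u) v = ip u v - \<rho> * a u v" by metis
  define q where "q = sqrt (1 - (c / L)\<^sup>2)"
  have cL: "0 < c / L" "c / L \<le> 1" using c Lp Lc by auto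
  have q0: "0 \<le> q" and q2: "q\<^sup>2 = 1 - (c / L)\<^sup>2" using cL by (auto simp: q_def abs_square_le_1)
  have q1: "q < 1" unfolding q_def using c Lp by simp
  \<comment> \<open>This is sqrt (1 - x) \<le> 1 - x / 2 with x = (c / L)^2 = \<rho> c.\<close>
  have qr: "q \<le> 1 - \<rho> * c / 2"
  proof (rule power2_le_imp_le)
    have e: "\<rho> * c = (c / L)\<^sup>2" by (simp add: \<rho>_def power2_eq_square)
    show "q\<^sup>2 \<le> (1 - \<rho> * c / 2)\<^sup>2" unfolding e q2 by (simp add: power2_diff)
    have "(c / L)\<^sup>2 \<le> 1" using cL by (simp add: abs_square_le_1)
    thus "0 \<le> 1 - \<rho> * c / 2" unfolding e by simp
  qed
  have contr: "nrm (\<lambda>x. T u x - T v x) \<le> q * nrm (\<lambda>x. u x - v x)" if u: "u \<in> Bl" and v: "v \<in> Bl" for u v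
  proof (rule power2_le_imp_le)
    note mem = BlV[OF u] BlV[OF v] TV[OF u] TV[OF v]
    define w where "w = (\<lambda>x. u x - v x)"
    \<comment> \<open>\<open>h\<close> represents the functional \<open>a u - a v\<close>, recovered
      from the images under \<open>T\<close>. Expanding the square of \<open>w - \<rho> h\<close>
      then needs only monotonicity for the mixed term and the Lipschitz bound for
      \<open>h\<close>.\<close>
    define h where "h = (\<lambda>x. (1/\<rho>) * (w x - (T u x - T v x)))"
    have w: "w \<in> V" and h: "h \<in> V" unfolding w_def h_def using mem by (intro mem_intros; simp)+
    have hz: "ip h z = a u z - a v z" if z: "z \<in> V" for z
    proof -
      have "ip h z = 1 / \<rho> * (ip u z - ip v z - (ip (T u) z - ip (T v) z))"
        unfolding h_def w_def using mem z by (simp add: ip_simps mem_intros del: times_divide_eq_left)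
      also have "ip u z - ip v z - (ip (T u) z - ip (T v) z) = \<rho> * (a u z - a v z)"
        using T[OF u z] T[OF v z] by (simp add: algebra_simps)
      finally show ?thesis using rp by simp
    qed
    have "(nrm h)\<^sup>2 \<le> (L * nrm w) * nrm h"
      using lip[OF u v h] hz[OF h] h by (simp add: nrm_power2 w_def)
    hence hL: "nrm h \<le> L * nrm w"
      using nrm_ge0[OF h] nrm_ge0[OF w] Lp by (cases "nrm h = 0") (auto simp: power2_eq_square)
    have "(\<lambda>x. T u x - T v x) = (\<lambda>x. w x - \<rho> * h x)"
      using rp by (simp add: h_def)
    hence "(nrm (\<lambda>x. T u x - T v x))\<^sup>2 = ip (\<lambda>x. w x - \<rho> * h x) (\<lambda>x. w x - \<rho> * h x)"
      using w h by (simp add: nrm_power2 mem_intros)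
    also have "\<dots> = (nrm w)\<^sup>2 - 2 * \<rho> * ip h w + \<rho>\<^sup>2 * (nrm h)\<^sup>2"
      unfolding nrm_power2[OF w] nrm_power2[OF h] using w h
      by (simp add: ip_simps mem_intros ip_commute[of w h] power2_eq_square algebra_simps)
    also have "\<dots> \<le> (nrm w)\<^sup>2 - 2 * \<rho> * (c * (nrm w)\<^sup>2) + \<rho>\<^sup>2 * (L * nrm w)\<^sup>2"
    proof -
      have "\<rho> * (c * (nrm w)\<^sup>2) \<le> \<rho> * ip h w"
        using a_mono[OF mem(1,2)] hz[OF w] rp unfolding w_def[symmetric] by (intro mult_left_mono) auto
      moreover have "\<rho>\<^sup>2 * (nrm h)\<^sup>2 \<le> \<rho>\<^sup>2 * (L * nrm w)\<^sup>2"
        using hL nrm_ge0[OF h] by (intro mult_left_mono power_mono) auto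
      ultimately show ?thesis by linarith
    qed
    also have "\<dots> = (q * nrm w)\<^sup>2"
      using Lp unfolding power_mult_distrib q2 by (simp add: \<rho>_def field_simps power2_eq_square)
    finally show "(nrm (\<lambda>x. T u x - T v x))\<^sup>2 \<le> (q * nrm (\<lambda>x. u x - v x))\<^sup>2" by (simp add: w_def)
    show "0 \<le> q * nrm (\<lambda>x. u x - v x)" using q0 nrm_ge0[OF w] by (simp add: w_def)
  qed
  have T0: "nrm (T (\<lambda>_. 0)) \<le> \<rho> * M'"
  proof -
    let ?t = "T (\<lambda>_. 0)"
    have t: "?t \<in> V" using TV[OF zero_Bl] .
    have "(nrm ?t)\<^sup>2 = - \<rho> * a (\<lambda>_. 0) ?t"
      using T[OF zero_Bl t] ip_scale[OF zero_mem t, of 0] t by (simp add: nrm_power2)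
    also have "\<dots> \<le> \<rho> * \<bar>a (\<lambda>_. 0) ?t\<bar>"
      using rp by (simp add: abs_if mult_le_0_iff)
    also have "\<dots> \<le> \<rho> * (M' * nrm ?t)" using a_zero'[OF t] rp by simp
    finally have "nrm ?t * nrm ?t \<le> (\<rho> * M') * nrm ?t" by (simp add: power2_eq_square)
    moreover have "0 \<le> \<rho> * M'" using rp by (simp add: M'_def)
    ultimately show ?thesis using nrm_ge0[OF t] by (cases "nrm ?t = 0") auto
  qed
  have TB: "T u \<in> Bl" if u: "u \<in> Bl" for u
  proof -
    have "nrm (T u) \<le> nrm (\<lambda>x. T u x - T (\<lambda>_. 0) x) + nrm (T (\<lambda>_. 0))"
      using nrm_triangle[OF diff_mem[OF TV[OF u] TV[OF zero_Bl]] TV[OF zero_Bl]] by simp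
    also have "\<dots> \<le> q * nrm u + \<rho> * M'" using contr[OF u zero_Bl] T0 by simp
    also have "q * nrm u \<le> (1 - \<rho> * c / 2) * R"
      using u qr q0 nrm_ge0[OF BlV[OF u]] by (intro mult_mono) (auto simp: Bl_def)
    also have "(1 - \<rho> * c / 2) * R + \<rho> * M' = R" unfolding M'_eq by (simp add: algebra_simps)
    finally show ?thesis using TV[OF u] by (simp add: Bl_def)
  qed
  define X where "X n = (T ^^ n) (\<lambda>_. 0)" for n
  have X_Suc: "X (Suc n) = T (X n)" for n by (simp add: X_def)
  have XB: "X n \<in> Bl" for n
    by (induction n) (simp_all add: X_Suc TB, simp add: X_def zero_Bl)
  hence XV: "X n \<in> V" for n by (rule BlV)
  define B where "B = nrm (\<lambda>x. X 1 x - X 0 x)"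
  have B0: "B \<ge> 0" unfolding B_def by (intro nrm_ge0 mem_intros XV)
  have step: "nrm (\<lambda>x. X (Suc n) x - X n x) \<le> q ^ n * B" for n
  proof (induction n)
    case (Suc n)
    have "nrm (\<lambda>x. X (Suc (Suc n)) x - X (Suc n) x) \<le> q * nrm (\<lambda>x. X (Suc n) x - X n x)"
      unfolding X_Suc[of "Suc n"] X_Suc[of n] by (rule contr) (auto intro: TB XB)
    also have "\<dots> \<le> q * (q ^ n * B)" using Suc q0 by (intro mult_left_mono) auto
    finally show ?case by simp
  qed (simp add: B_def)
  \<comment> \<open>Multiplying by 1 - q and keeping the factor 1 - q^k turns the geometric sum into
    a statement that closes under induction on k.\<close>
  have tail: "(1 - q) * nrm (\<lambda>x. X (n + k) x - X n x) \<le> q ^ n * (1 - q ^ k) * B" for n k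
  proof (induction k)
    case 0
    show ?case by (simp add: nrm_zero)
  next
    case (Suc k)
    have "(1 - q) * nrm (\<lambda>x. X (n + Suc k) x - X n x)
        \<le> (1 - q) * (nrm (\<lambda>x. X (n + Suc k) x - X (n + k) x) + nrm (\<lambda>x. X (n + k) x - X n x))"
      using q1 by (intro mult_left_mono nrm_diff_triangle XV) auto
    also have "\<dots> \<le> (1 - q) * (q ^ (n + k) * B) + q ^ n * (1 - q ^ k) * B"
      unfolding distrib_left using step[of "n + k"] q1 Suc by (intro add_mono mult_left_mono) auto
    also have "\<dots> = q ^ n * (1 - q ^ Suc k) * B" by (simp add: algebra_simps power_add)
    finally show ?case .
  qed
  have tail': "nrm (\<lambda>x. X (n + k) x - X n x) \<le> q ^ n * (B / (1 - q))" for n k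
  proof -
    have "q ^ n * (1 - q ^ k) * B \<le> q ^ n * 1 * B"
      using q0 B0 by (intro mult_right_mono mult_left_mono) auto
    thus ?thesis using tail[of n k] q1 by (simp add: field_simps)
  qed
  have lim0: "(\<lambda>n. q ^ n * (B / (1 - q))) \<longlonglongrightarrow> 0"
    using tendsto_mult_left_zero[OF LIMSEQ_realpow_zero[OF q0 q1]] .
  have "\<exists>N. \<forall>m\<ge>N. \<forall>n\<ge>N. nrm (\<lambda>x. X m x - X n x) < e" if "e > 0" for e
  proof -
    obtain N where N: "\<forall>n\<ge>N. \<bar>q ^ n * (B / (1 - q))\<bar> < e / 2"
      using LIMSEQ_D[OF lim0, of "e/2"] \<open>e > 0\<close> by auto
    have *: "nrm (\<lambda>x. X m x - X N x) < e / 2" if "m \<ge> N" for m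
    proof -
      have "nrm (\<lambda>x. X m x - X N x) \<le> q ^ N * (B / (1 - q))"
        using tail'[of N "m - N"] that by (simp del: times_divide_eq_right)
      also have "\<dots> < e / 2" using N[rule_format, of N] by (rule order_le_less_trans[OF abs_ge_self]) simp
      finally show ?thesis .
    qed
    have "nrm (\<lambda>x. X m x - X n x) < e" if "m \<ge> N" "n \<ge> N" for m n
      using *[OF that(1)] *[OF that(2)] nrm_diff_triangle[OF XV[of m] XV[of N] XV[of n]]
        nrm_diff_commute[OF XV[of n] XV[of N]] by linarith
    thus ?thesis by blast
  qed
  from complete[OF XV this] obtain u where u: "u \<in> V" and lim: "(\<lambda>n. nrm (\<lambda>x. X n x - u x)) \<longlonglongrightarrow> 0"
    by blast
  have "nrm u \<le> R"
    by (rule LIMSEQ_le_const2[OF nrm_tendsto[OF XV u lim]]) (use XB in \<open>auto simp: Bl_def\<close>)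
  hence uB: "u \<in> Bl" using u by (simp add: Bl_def)
  have "a u v = 0" if v: "v \<in> V" for v
  proof -
    have "(\<lambda>n. a (X n) v) \<longlonglongrightarrow> a u v"
    proof (rule LIM_zero_cancel, rule tendsto_rabs_zero_cancel, rule tendsto_sandwich[OF _ _ tendsto_const])
      show "(\<lambda>n. L * nrm (\<lambda>x. X n x - u x) * nrm v) \<longlonglongrightarrow> 0"
        using tendsto_mult_left_zero[OF tendsto_mult_right_zero[OF lim]] .
      show "\<forall>\<^sub>F n in sequentially. \<bar>a (X n) v - a u v\<bar> \<le> L * nrm (\<lambda>x. X n x - u x) * nrm v"
        using lip[OF XB uB v] by simp
    qed auto
    \<comment> \<open>The limit need not be recognised as a fixed point: \<rho> times
      \<open>a (X n) v\<close> is a difference of consecutive terms of a convergent sequence of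
      pairings, so it tends to 0.\<close>
    hence "(\<lambda>n. \<rho> * a (X n) v) \<longlonglongrightarrow> \<rho> * a u v" by (intro tendsto_intros)
    moreover have "\<rho> * a (X n) v = ip (X n) v - ip (X (Suc n)) v" for n
      using T[OF XB[of n] v] by (simp add: X_Suc)
    moreover have c1: "(\<lambda>n. ip (X n) v) \<longlonglongrightarrow> ip u v"
      by (rule ip_tendsto) (auto intro: XV u lim v simp: nrm_zero)
    moreover have "(\<lambda>n. ip (X n) v - ip (X (Suc n)) v) \<longlonglongrightarrow> ip u v - ip u v"
      by (intro tendsto_diff c1 LIMSEQ_Suc[OF c1])
    ultimately have "\<rho> * a u v = 0" using LIMSEQ_unique by fastforce
    thus ?thesis using rp by simp
  qed
  thus ?thesis using u by blast
qed

text \<open>The last hypothesis plays the role of the Rellich theorem: up to a small multiple of the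
  energy, the weaker form \<open>b\<close> is controlled by finitely many bounded functionals. The
  argument rests on the form \<open>ip - m b\<close>, semidefinite because \<open>m\<close> is the
  infimum; a minimising sequence tends to zero in its seminorm.\<close>

theorem rayleigh_minimizer:
  fixes b :: "('b \<Rightarrow> real) \<Rightarrow> ('b \<Rightarrow> real) \<Rightarrow> real"
  assumes b: "semi_inner_space V b"
    and b_le: "\<And>v. v \<in> V \<Longrightarrow> b v v \<le> C * ip v v"
    and nontriv: "u0 \<in> V" "b u0 u0 > 0"
    and compact: "\<And>\<epsilon>. \<epsilon> > 0 \<Longrightarrow> \<exists>S K. finite S \<and>
        (\<forall>l\<in>S. \<forall>u\<in>V. \<forall>v\<in>V. l (\<lambda>x. u x - v x) = l u - l v) \<and>
        (\<forall>l\<in>S. \<exists>D. \<forall>v\<in>V. \<bar>l v\<bar> \<le> D * nrm v) \<and>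
        (\<forall>v\<in>V. b v v \<le> \<epsilon> * ip v v + K * (\<Sum>l\<in>S. (l v)\<^sup>2))"
  shows "\<exists>m u. m > 0 \<and> u \<in> V \<and> b u u = 1 \<and>
      (\<forall>v\<in>V. m * b v v \<le> ip v v) \<and> (\<forall>v\<in>V. ip u v = m * b u v)"
proof -
  interpret B: semi_inner_space V b by fact
  define I where "I = {ip v v | v. v \<in> V \<and> b v v = 1}"
  define m where "m = Inf I"
  have normalize: "b (\<lambda>x. (1 / sqrt (b v v)) * v x) (\<lambda>x. (1 / sqrt (b v v)) * v x) = 1
      \<and> ip (\<lambda>x. (1 / sqrt (b v v)) * v x) (\<lambda>x. (1 / sqrt (b v v)) * v x) = ip v v / b v v"
    if "v \<in> V" "b v v > 0" for v
    using that by (simp add: ip_simps B.ip_simps mem_intros del: times_divide_eq_left)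
      (simp add: field_simps)
  have I_ne: "I \<noteq> {}"
    using normalize[OF nontriv] scale_mem[OF nontriv(1)] unfolding I_def by blast
  have C: "C > 0"
  proof (rule ccontr)
    assume "\<not> C > 0"
    hence "C * ip u0 u0 \<le> 0" using ip_ge0[OF nontriv(1)] by (simp add: mult_nonpos_nonneg)
    thus False using b_le[OF nontriv(1)] nontriv by simp
  qed
  have I_low: "1 / C \<le> r" if "r \<in> I" for r
    using that b_le C unfolding I_def by (force simp: field_simps)
  hence bdd: "bdd_below I" by (auto intro!: bdd_belowI)
  have "1 / C \<le> m" unfolding m_def using I_ne I_low by (intro cInf_greatest)
  hence mp: "m > 0" using C by (smt (verit) divide_pos_pos)
  have m_le: "m * b v v \<le> ip v v" if v: "v \<in> V" for v
  proof (cases "b v v > 0")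
    case True
    have "ip v v / b v v \<in> I"
      unfolding I_def mem_Collect_eq using normalize[OF v True] scale_mem[OF v]
      by (intro exI[of _ "\<lambda>x. (1 / sqrt (b v v)) * v x"] conjI) (simp_all del: times_divide_eq_left)
    hence "m \<le> ip v v / b v v" unfolding m_def using bdd by (rule cInf_lower)
    thus ?thesis using True by (simp add: field_simps)
  next
    case False
    thus ?thesis using B.ip_ge0[OF v] ip_ge0[OF v] by (simp add: antisym_conv1)
  qed
  \<comment> \<open>Having \<open>ip - m b\<close> as a semi-inner product gives the triangle
    inequality for the defect of a difference, and Cauchy-Schwarz for the eigenvalue equation at the
    end.\<close>
  interpret E: semi_inner_space V "\<lambda>u v. ip u v - m * b u v"
    by unfold_locales
       (use mem_intros m_le in \<open>auto simp: ip_simps B.ip_simps ip_commute B.ip_commute algebra_simps\<close>)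
  have "\<exists>v\<in>V. b v v = 1 \<and> ip v v < m + 1 / real (Suc n)" for n
  proof -
    have "Inf I < m + 1 / real (Suc n)" by (simp add: m_def)
    thus ?thesis using cInf_lessD[OF I_ne] unfolding I_def by blast
  qed
  then obtain X where XV: "\<And>n. X n \<in> V" and Xb: "\<And>n. b (X n) (X n) = 1"
    and Xip: "\<And>n. ip (X n) (X n) < m + 1 / real (Suc n)" by metis
  \<comment> \<open>With this \<epsilon> the bound for \<open>m * b w w\<close> contains exactly
    half of \<open>ip w w\<close>, which is moved to the left-hand side.\<close>
  have "1 / (2 * m) > 0" using mp by simp
  from compact[OF this] obtain S K where SK: "finite S"
      "\<forall>l\<in>S. \<forall>u\<in>V. \<forall>v\<in>V. l (\<lambda>x. u x - v x) = l u - l v"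
      "\<forall>l\<in>S. \<exists>D. \<forall>v\<in>V. \<bar>l v\<bar> \<le> D * nrm v"
      "\<forall>v\<in>V. b v v \<le> 1 / (2 * m) * ip v v + K * (\<Sum>l\<in>S. (l v)\<^sup>2)"
    by (elim exE conjE) (rule that)
  note S = SK(1) and l_diff = SK(2)[rule_format] and l_bound = SK(3)[rule_format]
    and b_compact = SK(4)[rule_format]
  have X_bounded: "nrm (X n) \<le> sqrt (m + 1)" for n
  proof -
    have "ip (X n) (X n) \<le> m + 1 / real (Suc n)" using Xip by (rule less_imp_le)
    also have "\<dots> \<le> m + 1" by simp
    finally show ?thesis unfolding nrm_def by (rule real_sqrt_le_mono)
  qed
  have "bounded (range (\<lambda>n. l (X n)))" if l: "l \<in> S" for l
  proof -
    from l_bound[OF l] obtain D where D: "\<forall>v\<in>V. \<bar>l v\<bar> \<le> D * nrm v" by blast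
    have "\<bar>l (X n)\<bar> \<le> \<bar>D\<bar> * sqrt (m + 1)" for n
    proof -
      have "\<bar>l (X n)\<bar> \<le> D * nrm (X n)" using D XV by blast
      also have "\<dots> \<le> \<bar>D\<bar> * nrm (X n)" using nrm_ge0[OF XV] by (intro mult_right_mono) auto
      also have "\<dots> \<le> \<bar>D\<bar> * sqrt (m + 1)" using X_bounded by (intro mult_left_mono) auto
      finally show ?thesis .
    qed
    thus ?thesis by (auto simp: bounded_iff)
  qed
  from bounded_coordinates_convergent_subsequence[OF S, of X, OF this] obtain r :: "nat \<Rightarrow> nat"
    where r: "strict_mono r" and conv: "\<And>l. l \<in> S \<Longrightarrow> convergent (\<lambda>n. l (X (r n)))" by blast
  define Y where "Y n = X (r n)" for n
  have YV: "Y n \<in> V" and Yb: "b (Y n) (Y n) = 1" for n using XV Xb by (auto simp: Y_def)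
  have Yip: "ip (Y n) (Y n) < m + 1 / real (Suc n)" for n
  proof -
    have "n \<le> r n" using r by (rule seq_suble)
    hence "1 / real (Suc (r n)) \<le> 1 / real (Suc n)" by (simp add: field_simps)
    thus ?thesis using Xip[of "r n"] unfolding Y_def by linarith
  qed
  have inv0: "(\<lambda>n. 1 / real (Suc n)) \<longlonglongrightarrow> 0" by (rule LIMSEQ_Suc[OF lim_1_over_n])
  have Y_lim_ip: "(\<lambda>n. ip (Y n) (Y n)) \<longlonglongrightarrow> m"
  proof (rule tendsto_sandwich[OF _ _ tendsto_const])
    show "(\<lambda>n. m + 1 / real (Suc n)) \<longlonglongrightarrow> m" using tendsto_add[OF tendsto_const[of m] inv0] by simp
    show "\<forall>\<^sub>F n in sequentially. m \<le> ip (Y n) (Y n)" using m_le[OF YV] Yb by simp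
    show "\<forall>\<^sub>F n in sequentially. ip (Y n) (Y n) \<le> m + 1 / real (Suc n)"
      by (intro always_eventually allI less_imp_le Yip)
  qed
  have E_small: "(E.nrm (Y n))\<^sup>2 \<le> 1 / real (Suc n)" for n
    using Yip[of n] Yb[of n] by (simp add: E.nrm_power2 YV)
  have cauchy: "\<exists>N. \<forall>p\<ge>N. \<forall>q\<ge>N. nrm (\<lambda>x. Y p x - Y q x) < e" if e: "e > 0" for e
  proof -
    \<comment> \<open>Chosen so that the functionals contribute at most e^2 / 4. The defect
      contributes less than e^2 / 4 as well, and half of \<open>ip w w\<close> has been absorbed, so
      \<open>ip w w\<close> stays below e^2. The summand 1 keeps the denominator positive.\<close>
    define d where "d = e\<^sup>2 / (4 * (m * \<bar>K\<bar> * real (card S) + 1))"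
    have den: "m * \<bar>K\<bar> * real (card S) + 1 > 0" using mp by (simp add: add_nonneg_pos)
    have dp: "d > 0" unfolding d_def using e den by simp
    have "\<exists>N. \<forall>p\<ge>N. \<forall>q\<ge>N. \<forall>l\<in>S. (l (Y p) - l (Y q))\<^sup>2 \<le> d"
    proof -
      have "\<exists>N. \<forall>p\<ge>N. \<forall>q\<ge>N. \<bar>l (Y p) - l (Y q)\<bar> < sqrt d" if "l \<in> S" for l
      proof -
        have "Cauchy (\<lambda>n. l (Y n))" using conv[OF that] by (simp add: Y_def Cauchy_convergent_iff)
        thus ?thesis using CauchyD[of "\<lambda>n. l (Y n)" "sqrt d"] dp by auto
      qed
      then obtain N where N: "\<And>l p q. l \<in> S \<Longrightarrow> p \<ge> N l \<Longrightarrow> q \<ge> N l \<Longrightarrow> \<bar>l (Y p) - l (Y q)\<bar> < sqrt d"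
        by metis
      have "(l (Y p) - l (Y q))\<^sup>2 \<le> d" if "l \<in> S" "p \<ge> Max (N ` S)" "q \<ge> Max (N ` S)" for l p q
      proof -
        have "N l \<le> Max (N ` S)" using S that(1) by simp
        hence "\<bar>l (Y p) - l (Y q)\<bar> < sqrt d" using N that by force
        hence "\<bar>l (Y p) - l (Y q)\<bar>\<^sup>2 \<le> (sqrt d)\<^sup>2" by (intro power_mono) auto
        thus ?thesis using dp by simp
      qed
      thus ?thesis by blast
    qed
    then obtain N1 where N1: "\<And>p q l. p \<ge> N1 \<Longrightarrow> q \<ge> N1 \<Longrightarrow> l \<in> S \<Longrightarrow> (l (Y p) - l (Y q))\<^sup>2 \<le> d" by blast
    obtain N2 :: nat where N2: "real N2 > 16 / e\<^sup>2" using reals_Archimedean2 by blast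
    have "nrm (\<lambda>x. Y p x - Y q x) < e" if "p \<ge> max N1 N2" "q \<ge> max N1 N2" for p q
    proof -
      define w where "w = (\<lambda>x. Y p x - Y q x)"
      have w: "w \<in> V" unfolding w_def by (intro mem_intros YV)
      have sm: "E.nrm (Y k) < e / 4" if "k \<ge> N2" for k
      proof (rule power2_less_imp_less)
        have "16 / e\<^sup>2 < real (Suc k)" using N2 that by linarith
        hence "1 / real (Suc k) < (e / 4)\<^sup>2" using e by (simp add: field_simps power2_eq_square)
        thus "(E.nrm (Y k))\<^sup>2 < (e / 4)\<^sup>2" using E_small[of k] by linarith
      qed (use e in auto)
      have "E.nrm w \<le> E.nrm (Y p) + E.nrm (Y q)" unfolding w_def by (rule E.nrm_diff_le) (rule YV)+
      hence "E.nrm w < e / 2" using sm[of p] sm[of q] that by simp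
      hence "(E.nrm w)\<^sup>2 < (e / 2)\<^sup>2" using E.nrm_ge0[OF w] by (intro power_strict_mono) auto
      hence Ew: "ip w w - m * b w w < e\<^sup>2 / 4" using w by (simp add: E.nrm_power2 power_divide)
      have "(\<Sum>l\<in>S. (l w)\<^sup>2) \<le> (\<Sum>l\<in>S. d)"
        using N1 that by (intro sum_mono) (simp add: w_def l_diff YV)
      hence "\<bar>K\<bar> * (\<Sum>l\<in>S. (l w)\<^sup>2) \<le> \<bar>K\<bar> * (real (card S) * d)" by (intro mult_left_mono) auto
      moreover have "K * (\<Sum>l\<in>S. (l w)\<^sup>2) \<le> \<bar>K\<bar> * (\<Sum>l\<in>S. (l w)\<^sup>2)"
        by (intro mult_right_mono sum_nonneg) auto
      ultimately have "b w w \<le> 1 / (2 * m) * ip w w + \<bar>K\<bar> * (real (card S) * d)"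
        using b_compact[OF w] by linarith
      hence "m * b w w \<le> m * (1 / (2 * m) * ip w w + \<bar>K\<bar> * (real (card S) * d))"
        using mp by (intro mult_left_mono) auto
      also have "\<dots> = ip w w / 2 + m * \<bar>K\<bar> * real (card S) * d" using mp by (simp add: field_simps)
      also have "m * \<bar>K\<bar> * real (card S) * d \<le> (m * \<bar>K\<bar> * real (card S) + 1) * d" using dp by simp
      also have "\<dots> = e\<^sup>2 / 4"
      proof -
        have "z * (y / (4 * z)) = y / 4" if "z > 0" for y z :: real using that by simp
        from this[OF den] show ?thesis unfolding d_def .
      qed
      finally have "ip w w < e\<^sup>2" using Ew by simp
      hence "(nrm w)\<^sup>2 < e\<^sup>2" by (simp add: nrm_power2 w)
      thus ?thesis using e unfolding w_def[symmetric] by (simp add: power2_less_imp_less)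
    qed
    thus ?thesis by blast
  qed
  from complete[OF YV cauchy] obtain u where u: "u \<in> V" and lim: "(\<lambda>n. nrm (\<lambda>x. Y n x - u x)) \<longlonglongrightarrow> 0"
    by blast
  have limB: "(\<lambda>n. B.nrm (\<lambda>x. Y n x - u x)) \<longlonglongrightarrow> 0"
  proof (rule tendsto_sandwich[OF _ _ tendsto_const])
    show "(\<lambda>n. sqrt C * nrm (\<lambda>x. Y n x - u x)) \<longlonglongrightarrow> 0" using tendsto_mult_right_zero[OF lim] .
    show "\<forall>\<^sub>F n in sequentially. B.nrm (\<lambda>x. Y n x - u x) \<le> sqrt C * nrm (\<lambda>x. Y n x - u x)"
      unfolding B.nrm_def nrm_def real_sqrt_mult[symmetric]
      by (intro always_eventually allI real_sqrt_le_mono b_le mem_intros YV u)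
    show "\<forall>\<^sub>F n in sequentially. 0 \<le> B.nrm (\<lambda>x. Y n x - u x)"
      by (intro always_eventually allI B.nrm_ge0 mem_intros YV u)
  qed
  have bu: "b u u = 1"
    using LIMSEQ_unique[OF B.ip_tendsto[OF YV u limB YV u limB]] Yb by simp
  have ipu: "ip u u = m"
    using LIMSEQ_unique[OF ip_tendsto[OF YV u lim YV u lim] Y_lim_ip] .
  have "ip u v = m * b u v" if v: "v \<in> V" for v
  proof -
    \<comment> \<open>The minimiser is a null vector of the semi-inner product
      \<open>ip - m b\<close>. By Cauchy-Schwarz it pairs to zero with every \<open>v\<close>, which
      is the eigenvalue equation.\<close>
    have "E.nrm u = 0" by (simp add: E.nrm_def bu ipu)
    thus ?thesis using E.ip_le[OF u v] by simp
  qed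
  thus ?thesis using mp u bu m_le by blast
qed

end

section \<open>Smooth functions of compact support\<close>

lemma partial_deriv_eq:
  assumes "(\<phi> has_derivative \<phi>') (at x)" shows "partial_deriv i \<phi> x = \<phi>' (axis i 1)"
  using frechet_derivative_at[OF assms] by (simp add: partial_deriv_def)

lemma partial_deriv_const: "partial_deriv i (\<lambda>_. c) = (\<lambda>_. 0)"
  by (rule ext) (simp add: partial_deriv_eq[OF has_derivative_const])

lemma partial_deriv_add:
  assumes "\<phi> differentiable at x" "\<psi> differentiable at x"
  shows "partial_deriv i (\<lambda>x. \<phi> x + \<psi> x) x = partial_deriv i \<phi> x + partial_deriv i \<psi> x"
  using partial_deriv_eq[OF has_derivative_add[OF assms[unfolded frechet_derivative_works]], of i]
  by (simp add: partial_deriv_def)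

lemma partial_deriv_mult:
  assumes "\<phi> differentiable at x" "\<psi> differentiable at x"
  shows "partial_deriv i (\<lambda>x. \<phi> x * \<psi> x) x = \<phi> x * partial_deriv i \<psi> x + partial_deriv i \<phi> x * \<psi> x"
  using partial_deriv_eq[OF has_derivative_mult[OF assms[unfolded frechet_derivative_works]], of i]
  by (simp add: partial_deriv_def)

lemma has_derivative_real_compose:
  assumes "\<phi> differentiable at x" "(F has_real_derivative d) (at (\<phi> x))"
  shows "((\<lambda>x. F (\<phi> x)) has_derivative (\<lambda>h. d * frechet_derivative \<phi> (at x) h)) (at x)"
  using has_derivative_compose[OF assms(1)[unfolded frechet_derivative_works]
      assms(2)[unfolded has_field_derivative_def]] .

lemma partial_deriv_compose:
  assumes "\<phi> differentiable at x" "(F has_real_derivative d) (at (\<phi> x))"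
  shows "partial_deriv i (\<lambda>x. F (\<phi> x)) x = d * partial_deriv i \<phi> x"
  using partial_deriv_eq[OF has_derivative_real_compose[OF assms]] by (simp add: partial_deriv_def)

lemma has_real_derivative_along_axis:
  assumes "\<phi> differentiable at (x + t *\<^sub>R axis i 1)"
  shows "((\<lambda>t. \<phi> (x + t *\<^sub>R axis i 1)) has_real_derivative partial_deriv i \<phi> (x + t *\<^sub>R axis i 1)) (at t)"
proof -
  have "((\<lambda>t. x + t *\<^sub>R axis i 1) has_derivative (\<lambda>s. s *\<^sub>R axis i 1)) (at t)"
    by (auto intro!: derivative_eq_intros)
  from has_derivative_compose[OF this assms[unfolded frechet_derivative_works]]
  have "((\<lambda>t. \<phi> (x + t *\<^sub>R axis i 1)) has_derivative
      (\<lambda>s. frechet_derivative \<phi> (at (x + t *\<^sub>R axis i 1)) (s *\<^sub>R axis i 1))) (at t)" .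
  moreover have "linear (frechet_derivative \<phi> (at (x + t *\<^sub>R axis i 1)))"
    using assms by (rule linear_frechet_derivative)
  ultimately show ?thesis
    by (simp add: has_field_derivative_def partial_deriv_def linear_scale mult.commute[of _ "frechet_derivative _ _ _"]
        cong: if_cong)
qed

lemma C_k_Suc_imp: "C_k (Suc k) \<phi> \<Longrightarrow> C_k k \<phi>"
proof (induction k arbitrary: \<phi>)
  case 0
  thus ?case
    by (auto simp: continuous_on_eq_continuous_at intro!: differentiable_imp_continuous_within)
next
  case (Suc k)
  thus ?case by auto
qed

lemma C_k_const: "C_k k (\<lambda>_. c)"
  by (induction k arbitrary: c) (auto simp: partial_deriv_const)

lemma C_k_add: "C_k k \<phi> \<Longrightarrow> C_k k \<psi> \<Longrightarrow> C_k k (\<lambda>x. \<phi> x + \<psi> x)"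
proof (induction k arbitrary: \<phi> \<psi>)
  case (Suc k)
  have "partial_deriv i (\<lambda>x. \<phi> x + \<psi> x) = (\<lambda>x. partial_deriv i \<phi> x + partial_deriv i \<psi> x)" for i
    using Suc.prems by (intro ext partial_deriv_add) auto
  thus ?case using Suc by auto
qed (auto intro: continuous_intros)

lemma C_k_mult: "C_k k \<phi> \<Longrightarrow> C_k k \<psi> \<Longrightarrow> C_k k (\<lambda>x. \<phi> x * \<psi> x)"
proof (induction k arbitrary: \<phi> \<psi>)
  case (Suc k)
  have "partial_deriv i (\<lambda>x. \<phi> x * \<psi> x) = (\<lambda>x. \<phi> x * partial_deriv i \<psi> x + partial_deriv i \<phi> x * \<psi> x)" for i
    using Suc.prems by (intro ext partial_deriv_mult) auto
  moreover have "C_k k \<phi>" "C_k k \<psi>" using Suc.prems C_k_Suc_imp by blast+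
  ultimately show ?case using Suc by (auto intro!: C_k_add)
qed (auto intro: continuous_intros)

lemma C_k_cmult: "C_k k \<phi> \<Longrightarrow> C_k k (\<lambda>x. c * \<phi> x)"
  using C_k_mult[OF C_k_const] .

lemma closure_nonzero_subset:
  assumes "closed K" "\<And>x. x \<notin> K \<Longrightarrow> \<phi> x = 0" shows "closure {x. \<phi> x \<noteq> 0} \<subseteq> K"
  using assms by (intro closure_minimal) auto

text \<open>Any compact set outside which the function vanishes certifies the support, so sums can
  use unions of such sets without computing closures.\<close>

lemma test_functionsI:
  assumes "\<And>k. C_k k \<phi>" "compact K" "K \<subseteq> \<Omega>" "\<And>x. x \<notin> K \<Longrightarrow> \<phi> x = 0"
  shows "\<phi> \<in> test_functions \<Omega>"
proof -
  have sub: "closure {x. \<phi> x \<noteq> 0} \<subseteq> K"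
    using closure_nonzero_subset[OF compact_imp_closed[OF assms(2)]] assms(4) by blast
  hence "compact (closure {x. \<phi> x \<noteq> 0})"
    using compact_Int_closed[OF assms(2) closed_closure, of "{x. \<phi> x \<noteq> 0}"] by (simp add: Int_absorb1)
  thus ?thesis using sub assms(1,3) unfolding test_functions_def by blast
qed

lemma test_functions_support:
  assumes "\<phi> \<in> test_functions \<Omega>"
  obtains K where "compact K" "K \<subseteq> \<Omega>" "\<And>x. x \<notin> K \<Longrightarrow> \<phi> x = 0"
  using assms closure_subset[of "{x. \<phi> x \<noteq> 0}"] unfolding test_functions_def by blast

lemma test_functions_add:
  assumes "\<phi> \<in> test_functions \<Omega>" "\<psi> \<in> test_functions \<Omega>"
  shows "(\<lambda>x. \<phi> x + \<psi> x) \<in> test_functions \<Omega>"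
proof -
  obtain K L where "compact K" "K \<subseteq> \<Omega>" "\<And>x. x \<notin> K \<Longrightarrow> \<phi> x = 0"
    "compact L" "L \<subseteq> \<Omega>" "\<And>x. x \<notin> L \<Longrightarrow> \<psi> x = 0"
    using assms test_functions_support by metis
  thus ?thesis using assms
    by (intro test_functionsI[of _ "K \<union> L"] C_k_add) (auto simp: test_functions_def)
qed

lemma test_functions_cmult:
  assumes "\<phi> \<in> test_functions \<Omega>" shows "(\<lambda>x. c * \<phi> x) \<in> test_functions \<Omega>"
proof -
  obtain K where "compact K" "K \<subseteq> \<Omega>" "\<And>x. x \<notin> K \<Longrightarrow> \<phi> x = 0"
    using assms test_functions_support by metis
  thus ?thesis using assms
    by (intro test_functionsI[of _ K] C_k_cmult) (auto simp: test_functions_def)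
qed

lemma test_functions_zero: "(\<lambda>_. 0) \<in> test_functions \<Omega>"
  by (rule test_functionsI[of _ "{}"]) (auto intro: C_k_const)

section \<open>Continuously differentiable functions of compact support\<close>

definition C1_compact :: "(real^2) set \<Rightarrow> (real^2 \<Rightarrow> real) set" where
  "C1_compact \<Omega> = {\<phi>. (\<forall>x. \<phi> differentiable at x) \<and> (\<forall>i. continuous_on UNIV (partial_deriv i \<phi>)) \<and>
     (\<exists>K. compact K \<and> K \<subseteq> \<Omega> \<and> (\<forall>x. x \<notin> K \<longrightarrow> \<phi> x = 0))}"

lemma test_functions_C1: "\<phi> \<in> test_functions \<Omega> \<Longrightarrow> \<phi> \<in> C1_compact \<Omega>"
  unfolding C1_compact_def
  by (rule test_functions_support) (auto simp: test_functions_def dest!: spec[of _ "Suc 0"])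

lemma C1_compact_differentiable: "\<phi> \<in> C1_compact \<Omega> \<Longrightarrow> \<phi> differentiable at x"
  by (auto simp: C1_compact_def)

lemma C1_compact_continuous: "\<phi> \<in> C1_compact \<Omega> \<Longrightarrow> continuous_on A \<phi>"
  by (rule continuous_on_subset[of UNIV])
     (auto simp: C1_compact_def continuous_on_eq_continuous_at intro!: differentiable_imp_continuous_within)

lemma C1_compact_continuous_partial: "\<phi> \<in> C1_compact \<Omega> \<Longrightarrow> continuous_on A (partial_deriv i \<phi>)"
  by (rule continuous_on_subset[of UNIV]) (auto simp: C1_compact_def)

lemma C1_compact_support:
  assumes "\<phi> \<in> C1_compact \<Omega>"
  obtains K where "compact K" "K \<subseteq> \<Omega>" "\<And>x. x \<notin> K \<Longrightarrow> \<phi> x = 0"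
    "\<And>x i. x \<notin> K \<Longrightarrow> partial_deriv i \<phi> x = 0"
proof -
  obtain K where K: "compact K" "K \<subseteq> \<Omega>" "\<And>x. x \<notin> K \<Longrightarrow> \<phi> x = 0"
    using assms by (auto simp: C1_compact_def)
  have "partial_deriv i \<phi> x = 0" if "x \<notin> K" for x i
  proof -
    have "(\<phi> has_derivative (\<lambda>_. 0)) (at x)"
    proof (rule has_derivative_transform_within_open[OF has_derivative_const[of 0]])
      show "open (- K)" using K compact_imp_closed by blast
    qed (use K that in auto)
    thus ?thesis by (rule partial_deriv_eq)
  qed
  with K show ?thesis by (rule that)
qed

lemma C1_compact_zero_outside:
  assumes "\<phi> \<in> C1_compact \<Omega>" "x \<notin> \<Omega>" shows "\<phi> x = 0" "partial_deriv i \<phi> x = 0"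
  using C1_compact_support[OF assms(1)] assms(2) by (metis subsetD)+

text \<open>This closure property is why the class is C^1 and not smooth: \<open>F\<close> may be
  the flux or another function with merely continuous derivative. The factor \<open>\<psi>\<close>
  supplies the compact support, so \<open>F\<close> may be nonzero at 0.\<close>

lemma C1_compact_mult_compose:
  assumes \<phi>: "\<phi> \<in> C1_compact \<Omega>" and \<psi>: "\<psi> \<in> C1_compact \<Omega>"
    and F: "\<And>s. (F has_real_derivative F' s) (at s)" "continuous_on UNIV F'"
  shows "(\<lambda>x. F (\<phi> x) * \<psi> x) \<in> C1_compact \<Omega>"
    and "partial_deriv i (\<lambda>x. F (\<phi> x) * \<psi> x) x
      = F (\<phi> x) * partial_deriv i \<psi> x + F' (\<phi> x) * partial_deriv i \<phi> x * \<psi> x"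
proof -
  have d: "(\<lambda>x. F (\<phi> x)) differentiable at x" for x
    using has_derivative_real_compose[OF C1_compact_differentiable[OF \<phi>] F(1)]
    unfolding differentiable_def by blast
  have p: "partial_deriv i (\<lambda>x. F (\<phi> x) * \<psi> x) x
      = F (\<phi> x) * partial_deriv i \<psi> x + F' (\<phi> x) * partial_deriv i \<phi> x * \<psi> x" for i x
    using partial_deriv_mult[OF d C1_compact_differentiable[OF \<psi>], of i x]
      partial_deriv_compose[OF C1_compact_differentiable[OF \<phi>] F(1), of i x] by simp
  show "partial_deriv i (\<lambda>x. F (\<phi> x) * \<psi> x) x
      = F (\<phi> x) * partial_deriv i \<psi> x + F' (\<phi> x) * partial_deriv i \<phi> x * \<psi> x" by (rule p)
  have Fc: "continuous_on UNIV F"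
    using F(1) by (auto intro!: DERIV_continuous simp: continuous_on_eq_continuous_at)
  have "continuous_on UNIV (\<lambda>x. F (\<phi> x))" "continuous_on UNIV (\<lambda>x. F' (\<phi> x))"
    using C1_compact_continuous[OF \<phi>, of UNIV]
    by (auto intro: continuous_on_compose2[OF Fc] continuous_on_compose2[OF F(2)])
  hence "continuous_on UNIV (partial_deriv i (\<lambda>x. F (\<phi> x) * \<psi> x))" for i
    unfolding p[abs_def]
    by (intro continuous_intros C1_compact_continuous_partial[OF \<phi>]
        C1_compact_continuous_partial[OF \<psi>] C1_compact_continuous[OF \<psi>])
  moreover obtain K where "compact K" "K \<subseteq> \<Omega>" "\<And>x. x \<notin> K \<Longrightarrow> \<psi> x = 0"
    using C1_compact_support[OF \<psi>] by metis
  ultimately show "(\<lambda>x. F (\<phi> x) * \<psi> x) \<in> C1_compact \<Omega>"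
    unfolding C1_compact_def using d C1_compact_differentiable[OF \<psi>] by (auto intro!: exI[of _ K])
qed

lemma integrable_continuous_compact_support:
  fixes f :: "real^2 \<Rightarrow> real"
  assumes "continuous_on UNIV f" "compact K" "\<And>x. x \<notin> K \<Longrightarrow> f x = 0"
  shows "integrable lborel f"
proof -
  have "integrable lborel (\<lambda>x. indicator K x *\<^sub>R f x)"
    using assms by (intro borel_integrable_compact) (auto intro: continuous_on_subset[of UNIV])
  moreover have "(\<lambda>x. indicator K x *\<^sub>R f x) = f" using assms(3) by (auto simp: indicator_def fun_eq_iff)
  ultimately show ?thesis by simp
qed

lemma bounded_continuous_compact_support:
  fixes f :: "real^2 \<Rightarrow> real"
  assumes "continuous_on UNIV f" "compact K" "\<And>x. x \<notin> K \<Longrightarrow> f x = 0"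
  obtains B where "B > 0" "\<And>x. \<bar>f x\<bar> \<le> B"
proof -
  have "bounded (f ` K)"
    using assms by (intro compact_imp_bounded compact_continuous_image) (auto intro: continuous_on_subset[of UNIV])
  then obtain B where "B > 0" "\<forall>x\<in>K. \<bar>f x\<bar> \<le> B" by (auto simp: bounded_pos)
  thus ?thesis using assms(3) by (intro that[of B]) (metis abs_zero less_imp_le)+
qed

text \<open>The mean of a difference quotient vanishes by translation invariance.\<close>

lemma integral_partial_deriv_zero:
  assumes \<phi>: "\<phi> \<in> C1_compact \<Omega>" shows "(\<integral>x. partial_deriv i \<phi> x \<partial>lborel) = 0"
proof -
  obtain K where K: "compact K" "\<And>x. x \<notin> K \<Longrightarrow> \<phi> x = 0" "\<And>x i. x \<notin> K \<Longrightarrow> partial_deriv i \<phi> x = 0"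
    using C1_compact_support[OF \<phi>] by metis
  obtain B where B: "B > 0" "\<And>x. \<bar>partial_deriv i \<phi> x\<bar> \<le> B"
    using bounded_continuous_compact_support[OF C1_compact_continuous_partial[OF \<phi>] K(1) K(3)] by metis
  obtain r where r: "r > 0" "K \<subseteq> ball 0 r" using compact_imp_bounded[OF K(1)] bounded_subset_ballD by blast
  define e :: "real^2" where "e = axis i 1"
  have ne: "norm e = 1" by (simp add: e_def)
  define h :: "nat \<Rightarrow> real" where "h n = 1 / real (Suc n)" for n
  have h: "0 < h n" "h n \<le> 1" for n by (auto simp: h_def)
  define g where "g n x = (\<phi> (x + h n *\<^sub>R e) - \<phi> x) / h n" for n x
  have cont: "continuous_on UNIV \<phi>" using C1_compact_continuous[OF \<phi>] .
  have int: "integrable lborel \<phi>" using integrable_continuous_compact_support[OF cont K(1,2)] .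
  have meas[measurable]: "\<phi> \<in> borel_measurable borel" using cont by (rule borel_measurable_continuous_onI)
  have meas'[measurable]: "partial_deriv i \<phi> \<in> borel_measurable borel"
    using C1_compact_continuous_partial[OF \<phi>] by (rule borel_measurable_continuous_onI)
  have tr: "has_bochner_integral lborel (\<lambda>x. \<phi> (x + a)) (\<integral>x. \<phi> x \<partial>lborel)" for a
  proof -
    have "integrable (distr lborel borel ((+) a)) \<phi>" using int by (simp add: lborel_distr_plus)
    hence "integrable lborel (\<lambda>x. \<phi> (a + x))" by (subst (asm) integrable_distr_eq) auto
    moreover have "(\<integral>x. \<phi> x \<partial>lborel) = (\<integral>x. \<phi> (a + x) \<partial>lborel)"
      by (subst lborel_distr_plus[of a, symmetric], subst integral_distr) auto
    ultimately show ?thesis by (simp add: has_bochner_integral_iff add.commute)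
  qed
  have g0: "(\<integral>x. g n x \<partial>lborel) = 0" for n
    using tr[of "h n *\<^sub>R e"] int
    by (simp add: g_def has_bochner_integral_iff)
  \<comment> \<open>The step sizes are at most 1, so all difference quotients vanish outside one
    ball of radius r + 1, and the mean value theorem bounds them by \<open>B\<close>. This is the
    integrable majorant for dominated convergence.\<close>
  have g_bound: "norm (g n x) \<le> B * indicator (cball 0 (r + 1)) x" for n x
  proof (cases "x \<in> cball 0 (r + 1)")
    case True
    have "\<exists>z>0. z < h n \<and> \<phi> (x + h n *\<^sub>R e) - \<phi> (x + 0 *\<^sub>R e) = (h n - 0) * partial_deriv i \<phi> (x + z *\<^sub>R e)"
      using h[of n] unfolding e_def
      by (intro MVT2 has_real_derivative_along_axis C1_compact_differentiable[OF \<phi>])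
    then obtain z where "\<phi> (x + h n *\<^sub>R e) - \<phi> x = h n * partial_deriv i \<phi> (x + z *\<^sub>R e)" by auto
    thus ?thesis using h[of n] B(2) True by (simp add: g_def)
  next
    case False
    have "x \<notin> K" using r(2) False by auto
    moreover have "x + h n *\<^sub>R e \<notin> K"
    proof
      assume "x + h n *\<^sub>R e \<in> K"
      hence "norm (x + h n *\<^sub>R e) < r" using r(2) by auto
      moreover have "norm x \<le> norm (x + h n *\<^sub>R e) + norm (h n *\<^sub>R e)"
        using norm_triangle_ineq4[of "x + h n *\<^sub>R e" "h n *\<^sub>R e"] by simp
      ultimately show False using False h[of n] ne by auto
    qed
    ultimately show ?thesis using K(2) False by (simp add: g_def)
  qed
  have h0: "h \<longlonglongrightarrow> 0" unfolding h_def by (rule LIMSEQ_Suc[OF lim_1_over_n])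
  have g_lim: "(\<lambda>n. g n x) \<longlonglongrightarrow> partial_deriv i \<phi> x" for x
  proof -
    have "((\<lambda>t. \<phi> (x + t *\<^sub>R e)) has_real_derivative partial_deriv i \<phi> (x + 0 *\<^sub>R e)) (at 0)"
      unfolding e_def by (intro has_real_derivative_along_axis C1_compact_differentiable[OF \<phi>])
    hence "((\<lambda>t. (\<phi> (x + t *\<^sub>R e) - \<phi> x) / t) \<longlongrightarrow> partial_deriv i \<phi> x) (at 0)"
      by (simp add: has_field_derivative_iff)
    moreover have "filterlim h (at 0) sequentially"
      using h0 h by (auto simp: filterlim_at intro!: always_eventually less_imp_neq[symmetric])
    ultimately show ?thesis unfolding g_def by (rule filterlim_compose)
  qed
  have "(\<lambda>n. \<integral>x. g n x \<partial>lborel) \<longlonglongrightarrow> (\<integral>x. partial_deriv i \<phi> x \<partial>lborel)"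
  proof (rule integral_dominated_convergence)
    show "integrable lborel (\<lambda>x. B * indicator (cball 0 (r + 1)) x :: real)"
      by (intro integrable_mult_right integrable_real_indicator) (auto intro!: emeasure_bounded_finite[unfolded infinity_ennreal_def])
  qed (use g_lim g_bound in \<open>auto simp: g_def[abs_def]\<close>)
  thus ?thesis using g0 by (simp add: LIMSEQ_const_iff)
qed

section \<open>Coordinates of the plane and iterated integrals\<close>

definition vec2 :: "real \<Rightarrow> real \<Rightarrow> real^2" where
  "vec2 x y = vector [x, y]"

lemma vec2_nth [simp]: "vec2 x y $ 1 = x" "vec2 x y $ 2 = y"
  by (simp_all add: vec2_def)

lemma vec2_eq: "vec2 x y = x *\<^sub>R axis 1 1 + y *\<^sub>R axis 2 1"
  by (simp add: vec_eq_iff forall_2 axis_def)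

lemma vec2_shift1: "vec2 x y = vec2 0 y + x *\<^sub>R axis 1 1"
  and vec2_shift2: "vec2 x y = vec2 x 0 + y *\<^sub>R axis 2 1"
  by (simp_all add: vec2_eq)

lemma continuous_vec2 [continuous_intros]:
  "continuous_on A f \<Longrightarrow> continuous_on A g \<Longrightarrow> continuous_on A (\<lambda>p. vec2 (f p) (g p))"
  unfolding vec2_eq by (intro continuous_intros)

lemma measurable_vec2 [measurable (raw)]:
  assumes "f \<in> borel_measurable M" "g \<in> borel_measurable M"
  shows "(\<lambda>p. vec2 (f p) (g p)) \<in> borel_measurable M"
  unfolding vec2_eq using assms by measurable

text \<open>Lebesgue measure is determined by its values on boxes, and boxes of the plane pull back
  to products of intervals. This carries the Fubini theorem over from pairs to
  \<open>real^2\<close>.\<close>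

lemma lborel_vec2: "(lborel :: (real^2) measure) = distr (lborel \<Otimes>\<^sub>M lborel) borel (\<lambda>(x, y). vec2 x y)"
proof (rule lborel_eqI)
  fix l u :: "real^2"
  assume "\<And>b. b \<in> Basis \<Longrightarrow> l \<bullet> b \<le> u \<bullet> b"
  hence lu: "l $ i \<le> u $ i" for i by (simp add: cart_eq_inner_axis axis_in_Basis_iff)
  have "(\<lambda>(x, y). vec2 x y) -` box l u = box (l $ 1) (u $ 1) \<times> box (l $ 2) (u $ 2)"
    by (auto simp: mem_box_cart forall_2 box_real)
  hence "emeasure (distr (lborel \<Otimes>\<^sub>M lborel) borel (\<lambda>(x, y). vec2 x y)) (box l u)
      = emeasure (lborel \<Otimes>\<^sub>M lborel) (box (l $ 1) (u $ 1) \<times> box (l $ 2) (u $ 2))"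
    by (subst emeasure_distr) (auto simp: space_pair_measure split_beta')
  also have "\<dots> = emeasure lborel (box (l $ 1) (u $ 1)) * emeasure lborel (box (l $ 2) (u $ 2))"
    by (intro lborel.emeasure_pair_measure_Times) auto
  also have "\<dots> = ennreal ((u $ 1 - l $ 1) * (u $ 2 - l $ 2))"
    using lu by (simp add: box_real ennreal_mult)
  also have "(u $ 1 - l $ 1) * (u $ 2 - l $ 2) = (\<Prod>b\<in>Basis. (u - l) \<bullet> b)"
  proof -
    have "(\<Prod>b\<in>Basis. (u - l) \<bullet> b) = (\<Prod>b\<in>(\<lambda>i. axis i 1 :: real^2) ` UNIV. (u - l) \<bullet> b)"
      by (intro prod.cong) (auto simp: Basis_vec_def)
    also have "\<dots> = (\<Prod>i\<in>UNIV. (u - l) \<bullet> axis i 1)"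
      by (subst prod.reindex) (auto simp: inj_on_def axis_eq_axis)
    finally show ?thesis by (simp add: UNIV_2 inner_axis)
  qed
  finally show "emeasure (distr (lborel \<Otimes>\<^sub>M lborel) borel (\<lambda>(x, y). vec2 x y)) (box l u)
      = ennreal (\<Prod>b\<in>Basis. (u - l) \<bullet> b)" .
qed simp

lemma nn_integral_vec2:
  assumes [measurable]: "f \<in> borel_measurable borel"
  shows "(\<integral>\<^sup>+p. f p \<partial>lborel) = (\<integral>\<^sup>+x. (\<integral>\<^sup>+y. f (vec2 x y) \<partial>lborel) \<partial>lborel)"
    and "(\<integral>\<^sup>+p. f p \<partial>lborel) = (\<integral>\<^sup>+y. (\<integral>\<^sup>+x. f (vec2 x y) \<partial>lborel) \<partial>lborel)"
proof -
  have "(\<integral>\<^sup>+p. f p \<partial>lborel) = (\<integral>\<^sup>+p. f (case p of (x, y) \<Rightarrow> vec2 x y) \<partial>(lborel \<Otimes>\<^sub>M lborel))"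
    by (subst lborel_vec2, subst nn_integral_distr) (auto simp: split_beta')
  also have "\<dots> = (\<integral>\<^sup>+x. (\<integral>\<^sup>+y. f (vec2 x y) \<partial>lborel) \<partial>lborel)"
    by (subst lborel.nn_integral_fst[symmetric]) (auto simp: split_beta')
  finally show 1: "(\<integral>\<^sup>+p. f p \<partial>lborel) = (\<integral>\<^sup>+x. (\<integral>\<^sup>+y. f (vec2 x y) \<partial>lborel) \<partial>lborel)" .
  also have "\<dots> = (\<integral>\<^sup>+y. (\<integral>\<^sup>+x. f (vec2 x y) \<partial>lborel) \<partial>lborel)"
    by (rule lborel_pair.Fubini') (auto simp: split_beta')
  finally show "(\<integral>\<^sup>+p. f p \<partial>lborel) = (\<integral>\<^sup>+y. (\<integral>\<^sup>+x. f (vec2 x y) \<partial>lborel) \<partial>lborel)" .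
qed

text \<open>The spaces are defined with the completed measure restricted to \<open>\<Omega>\<close>,
  whereas translation invariance and Fubini are used on the whole plane. This is the bridge between
  the two.\<close>

lemma lebesgue_on_eq_lborel:
  fixes g :: "real^2 \<Rightarrow> real"
  assumes "\<Omega> \<in> sets lebesgue" and g: "g \<in> borel_measurable borel" and "\<And>x. x \<notin> \<Omega> \<Longrightarrow> g x = 0"
  shows "integrable (lebesgue_on \<Omega>) g \<longleftrightarrow> integrable lborel g"
    and "integral\<^sup>L (lebesgue_on \<Omega>) g = integral\<^sup>L lborel g"
    and "(\<integral>\<^sup>+x. ennreal (g x) \<partial>lebesgue_on \<Omega>) = (\<integral>\<^sup>+x. ennreal (g x) \<partial>lborel)"
proof -
  have e: "(\<lambda>x. indicator \<Omega> x *\<^sub>R g x) = g" "(\<lambda>x. ennreal (g x) * indicator \<Omega> x) = (\<lambda>x. ennreal (g x))"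
    using assms(3) by (auto simp: indicator_def fun_eq_iff)
  show "integrable (lebesgue_on \<Omega>) g \<longleftrightarrow> integrable lborel g"
    using assms(1) g by (simp add: integrable_restrict_space e[simplified] integrable_completion)
  show "integral\<^sup>L (lebesgue_on \<Omega>) g = integral\<^sup>L lborel g"
    using assms(1) g by (simp add: integral_restrict_space e[simplified] integral_completion)
  show "(\<integral>\<^sup>+x. ennreal (g x) \<partial>lebesgue_on \<Omega>) = (\<integral>\<^sup>+x. ennreal (g x) \<partial>lborel)"
    using assms(1) by (simp add: nn_integral_restrict_space e nn_integral_completion)
qed

lemma borel_measurable_lebesgue_on:
  fixes g :: "real^2 \<Rightarrow> real"
  shows "g \<in> borel_measurable borel \<Longrightarrow> g \<in> borel_measurable (lebesgue_on \<Omega>)"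
  by (simp add: measurable_completion measurable_restrict_space1)

section \<open>Test functions and the space L2\<close>

definition bump_fun :: "nat \<Rightarrow> real \<Rightarrow> real \<Rightarrow> real" where
  "bump_fun n c s = (if s > 0 then exp (- c / s) / s ^ n else 0)"

lemma bump_fun_tendsto_0:
  fixes c :: real
  assumes "c > 0" shows "((\<lambda>s. exp (- c / s) / s ^ n) \<longlongrightarrow> 0) (at_right 0)"
proof -
  have "filterlim (\<lambda>s. c / s) at_top (at_right 0)"
    unfolding divide_inverse
    by (rule filterlim_tendsto_pos_mult_at_top[where c = c])
       (use assms in \<open>auto intro: filterlim_inverse_at_top_right\<close>)
  hence "((\<lambda>s. (c / s) ^ n / exp (c / s)) \<longlongrightarrow> 0) (at_right 0)"
    by (rule filterlim_compose[OF tendsto_power_div_exp_0])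
  hence "((\<lambda>s. (1 / c ^ n) * ((c / s) ^ n / exp (c / s))) \<longlongrightarrow> 0) (at_right 0)"
    by (rule tendsto_mult_right_zero)
  moreover have "(\<lambda>s. (1 / c ^ n) * ((c / s) ^ n / exp (c / s))) = (\<lambda>s. exp (- c / s) / s ^ n)"
    using assms by (auto simp: fun_eq_iff power_divide exp_minus field_simps)
  ultimately show ?thesis by simp
qed

text \<open>The powers of s in the denominator make the family closed under differentiation, so C^k
  follows for all members by induction on k. At 0 the right difference quotient is the next member
  of the family, which tends to 0 by the exponential.\<close>

lemma bump_fun_deriv:
  assumes c: "c > 0"
  shows "(bump_fun n c has_real_derivative c * bump_fun (n + 2) c s - real n * bump_fun (n + 1) c s) (at s)"
proof (cases s "0::real" rule: linorder_cases)
  case less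
  have "(bump_fun n c has_real_derivative 0) (at s)"
    by (rule has_field_derivative_transform_within_open[OF DERIV_const[of 0], where S = "{..<0}"])
       (use less in \<open>auto simp: bump_fun_def\<close>)
  thus ?thesis using less by (simp add: bump_fun_def)
next
  case greater
  have "((\<lambda>s. exp (- c / s) / s ^ n) has_real_derivative
      (exp (- c / s) * (c / s\<^sup>2) * s ^ n - exp (- c / s) * (real n * s ^ (n - 1))) / (s ^ n * s ^ n)) (at s)"
    using greater by (auto intro!: derivative_eq_intros simp: power2_eq_square)
  moreover have "(exp (- c / s) * (c / s\<^sup>2) * s ^ n - exp (- c / s) * (real n * s ^ (n - 1))) / (s ^ n * s ^ n)
      = c * bump_fun (n + 2) c s - real n * bump_fun (n + 1) c s"
    using greater by (cases n) (auto simp: bump_fun_def field_simps power2_eq_square)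
  ultimately have "((\<lambda>s. exp (- c / s) / s ^ n) has_real_derivative
      c * bump_fun (n + 2) c s - real n * bump_fun (n + 1) c s) (at s)" by simp
  thus ?thesis
    by (rule has_field_derivative_transform_within_open[where S = "{0<..}"])
       (use greater in \<open>auto simp: bump_fun_def\<close>)
next
  case equal
  have "((\<lambda>h. bump_fun n c h / h) \<longlongrightarrow> 0) (at_left 0)"
    by (rule tendsto_eventually) (auto simp: eventually_at_left_field bump_fun_def intro!: exI[of _ "-1"])
  moreover have "((\<lambda>h. bump_fun n c h / h) \<longlongrightarrow> 0) (at_right 0)"
  proof (rule Lim_transform_eventually[OF bump_fun_tendsto_0[OF c, of "Suc n"]])
    show "\<forall>\<^sub>F s in at_right 0. exp (- c / s) / s ^ Suc n = bump_fun n c s / s"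
      by (auto simp: eventually_at_right_field bump_fun_def intro!: exI[of _ 1])
  qed
  ultimately have "((\<lambda>h. bump_fun n c h / h) \<longlongrightarrow> 0) (at 0)" by (simp add: filterlim_at_split)
  thus ?thesis using equal by (simp add: has_field_derivative_iff bump_fun_def)
qed

lemma bump_fun_bounds: "c > 0 \<Longrightarrow> 0 \<le> bump_fun 0 c s" "c > 0 \<Longrightarrow> bump_fun 0 c s \<le> 1"
  by (auto simp: bump_fun_def)

lemma C_k_bump_affine:
  assumes c: "c > 0" shows "C_k k (\<lambda>x. bump_fun n c (a * x $ i + b))"
proof (induction k arbitrary: n)
  case 0
  have "continuous_on UNIV (bump_fun n c)"
    using bump_fun_deriv[OF c] by (auto intro!: DERIV_continuous simp: continuous_on_eq_continuous_at)
  thus ?case by (auto intro!: continuous_on_compose2[of UNIV "bump_fun n c"] continuous_intros)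
next
  case (Suc k)
  have d: "((\<lambda>x. a * x $ i + b) has_derivative (\<lambda>h. a * h $ i)) (at x)" for x :: "real^2"
    by (auto intro!: derivative_eq_intros bounded_linear.has_derivative[OF bounded_linear_vec_nth])
  define D where "D x = c * bump_fun (n + 2) c (a * x $ i + b) - real n * bump_fun (n + 1) c (a * x $ i + b)"
    for x :: "real^2"
  have d2: "((\<lambda>x. bump_fun n c (a * x $ i + b)) has_derivative (\<lambda>h. D x * (a * h $ i))) (at x)" for x :: "real^2"
    using has_derivative_compose[OF d bump_fun_deriv[OF c, unfolded has_field_derivative_def]]
    unfolding D_def .
  have "partial_deriv j (\<lambda>x. bump_fun n c (a * x $ i + b))
      = (\<lambda>x. (a * axis j 1 $ i * c) * bump_fun (n + 2) c (a * x $ i + b)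
          + (- (a * axis j 1 $ i * real n)) * bump_fun (n + 1) c (a * x $ i + b))" for j
    by (rule ext, subst partial_deriv_eq[OF d2]) (simp add: D_def algebra_simps)
  moreover have "C_k k (\<lambda>x. (a * axis j 1 $ i * c) * bump_fun (n + 2) c (a * x $ i + b)
          + (- (a * axis j 1 $ i * real n)) * bump_fun (n + 1) c (a * x $ i + b))" for j by (intro C_k_add C_k_cmult Suc.IH)
  ultimately show ?case using d2 by (auto simp: differentiable_def)
qed

text \<open>The factors 1 and -1 and the added constants put every argument into the affine shape
  for which \<open>C_k_bump_affine\<close> is stated. As \<open>c\<close> tends to 0 each factor
  tends to the indicator of a half plane.\<close>

definition box_bump :: "real \<Rightarrow> real^2 \<Rightarrow> real^2 \<Rightarrow> real^2 \<Rightarrow> real" where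
  "box_bump c a b x = (bump_fun 0 c (1 * x $ 1 + (- a $ 1)) * bump_fun 0 c ((-1) * x $ 1 + b $ 1)) *
     (bump_fun 0 c (1 * x $ 2 + (- a $ 2)) * bump_fun 0 c ((-1) * x $ 2 + b $ 2))"

lemma C_k_box_bump: "c > 0 \<Longrightarrow> C_k k (box_bump c a b)"
  unfolding box_bump_def[abs_def] by (intro C_k_mult C_k_bump_affine)

lemma box_bump_bounds: assumes "c > 0" shows "0 \<le> box_bump c a b x" "box_bump c a b x \<le> 1"
  unfolding box_bump_def using assms by (intro mult_nonneg_nonneg bump_fun_bounds mult_le_one; simp)+

lemma box_bump_outside: "x \<notin> box a b \<Longrightarrow> box_bump c a b x = 0"
  by (auto simp: box_bump_def bump_fun_def mem_box_cart forall_2)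

lemma box_bump_tendsto_1:
  assumes "x \<in> box a b" shows "(\<lambda>n. box_bump (1 / real (Suc n)) a b x) \<longlonglongrightarrow> 1"
proof -
  have *: "(\<lambda>n. bump_fun 0 (1 / real (Suc n)) s) \<longlonglongrightarrow> 1" if "s > 0" for s
  proof -
    have "(\<lambda>n. exp (- (1 / real (Suc n)) / s)) \<longlonglongrightarrow> exp (- 0 / s)"
      using that by (intro tendsto_intros LIMSEQ_Suc[OF lim_1_over_n]) auto
    thus ?thesis using that by (simp add: bump_fun_def)
  qed
  have "(\<lambda>n. box_bump (1 / real (Suc n)) a b x) \<longlonglongrightarrow> (1 * 1) * (1 * 1)"
    unfolding box_bump_def using assms by (intro tendsto_mult *) (auto simp: mem_box_cart forall_2)
  thus ?thesis by simp
qed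

lemma C_k_prod: "(\<And>j. j < n \<Longrightarrow> C_k k (f j)) \<Longrightarrow> C_k k (\<lambda>x. \<Prod>j<n. f j x)" for n :: nat
  by (induction n) (auto intro: C_k_const C_k_mult)

text \<open>By Lindelof, \<open>U\<close> is a countable union of open boxes whose closures lie in
  \<open>U\<close>. The approximation is 1 minus a product of complements, a smooth substitute for a
  maximum of bumps. The index n counts the boxes used and also sharpens the bumps, which have
  parameter 1 / (n + 1).\<close>

lemma open_indicator_test_approx:
  assumes U: "open U"
  shows "\<exists>\<phi>::nat \<Rightarrow> real^2 \<Rightarrow> real. (\<forall>n. \<phi> n \<in> test_functions U) \<and>
     (\<forall>n x. 0 \<le> \<phi> n x \<and> \<phi> n x \<le> 1) \<and> (\<forall>x. (\<lambda>n. \<phi> n x) \<longlonglongrightarrow> indicator U x)"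
proof -
  define \<F> where "\<F> = {B. \<exists>a b. B = box a b \<and> cbox a b \<subseteq> U}"
  have cover: "\<Union>\<F> = U"
  proof
    show "\<Union>\<F> \<subseteq> U" using box_subset_cbox unfolding \<F>_def by blast
    show "U \<subseteq> \<Union>\<F>"
    proof
      fix x assume "x \<in> U"
      then obtain e where e: "e > 0" "cball x e \<subseteq> U" using U open_contains_cball by blast
      obtain a b where ab: "x \<in> box a b" "box a b \<subseteq> ball x e" using rational_boxes[OF e(1)] by blast
      have "cbox a b = closure (box a b)" using ab(1) by (intro closure_box[symmetric]) auto
      also have "\<dots> \<subseteq> cball x e" using ab(2) ball_subset_cball by (intro closure_minimal) auto
      finally show "x \<in> \<Union>\<F>" using ab(1) e(2) unfolding \<F>_def by blast
    qed
  qed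
  obtain \<G> where \<G>: "\<G> \<subseteq> \<F>" "countable \<G>" "\<Union>\<G> = U"
    using Lindelof[of \<F>] cover unfolding \<F>_def by (auto simp: open_box)
  show ?thesis
  proof (cases "U = {}")
    case True
    thus ?thesis by (intro exI[of _ "\<lambda>_ _. 0"]) (auto simp: test_functions_zero)
  next
    case False
    hence "\<G> \<noteq> {}" using \<G> by auto
    hence ne: "range (from_nat_into \<G>) = \<G>" using \<G>(2) by (rule range_from_nat_into)
    hence "\<forall>k. \<exists>a b. from_nat_into \<G> k = box a b \<and> cbox a b \<subseteq> U"
      using \<G>(1) unfolding \<F>_def by blast
    then obtain a b where ab: "\<And>k. from_nat_into \<G> k = box (a k) (b k)" "\<And>k. cbox (a k) (b k) \<subseteq> U"
      by metis
    define \<psi> where "\<psi> n k = box_bump (1 / real (Suc n)) (a k) (b k)" for n k :: nat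
    have \<psi>: "0 \<le> \<psi> n k x" "\<psi> n k x \<le> 1" for n k x unfolding \<psi>_def by (rule box_bump_bounds; simp)+
    define \<phi> where "\<phi> n x = 1 + (-1) * (\<Prod>k<n. 1 + (-1) * \<psi> n k x)" for n x
    have bounds: "0 \<le> \<phi> n x \<and> \<phi> n x \<le> 1" for n x
      unfolding \<phi>_def using \<psi> by (auto intro!: prod_nonneg prod_le_1)
    have out: "\<phi> n x = 0" if "x \<notin> (\<Union>k<n. cbox (a k) (b k))" for n x
    proof -
      have "\<psi> n k x = 0" if "k < n" for k
        unfolding \<psi>_def using \<open>x \<notin> _\<close> that box_subset_cbox by (intro box_bump_outside) blast
      thus ?thesis by (simp add: \<phi>_def)
    qed
    have "\<phi> n \<in> test_functions U" for n
    proof (rule test_functionsI)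
      show "compact (\<Union>k<n. cbox (a k) (b k))" by (intro compact_UN) auto
      show "C_k k (\<phi> n)" for k unfolding \<phi>_def[abs_def] \<psi>_def
        by (intro C_k_add C_k_cmult C_k_const C_k_prod C_k_box_bump) simp
    qed (use ab out in auto)
    moreover have "(\<lambda>n. \<phi> n x) \<longlonglongrightarrow> indicator U x" for x
    proof (cases "x \<in> U")
      case False
      hence "\<phi> n x = 0" for n using ab(2) by (intro out) auto
      thus ?thesis using False by simp
    next
      case True
      then obtain k where k: "x \<in> box (a k) (b k)" using \<G>(3) ne ab(1) by (metis UN_iff Union_iff image_iff)
      have lim: "(\<lambda>n. \<psi> n k x) \<longlonglongrightarrow> 1" unfolding \<psi>_def using k by (rule box_bump_tendsto_1)
      have "(\<lambda>n. \<phi> n x) \<longlonglongrightarrow> 1"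
      proof (rule tendsto_sandwich[OF _ _ lim tendsto_const])
        show "\<forall>\<^sub>F n in sequentially. \<psi> n k x \<le> \<phi> n x"
        proof (rule eventually_sequentiallyI[of "Suc k"])
          fix n assume n: "Suc k \<le> n"
          \<comment> \<open>All factors lie in [0, 1], so dropping all but the k-th one only
            increases the product; hence the approximation is at least the single bump.\<close>
          have "(\<Prod>j<n. 1 + (-1) * \<psi> n j x) = (1 + (-1) * \<psi> n k x) * (\<Prod>j\<in>{..<n} - {k}. 1 + (-1) * \<psi> n j x)"
            using n by (intro prod.remove) auto
          also have "\<dots> \<le> (1 + (-1) * \<psi> n k x) * 1"
            using \<psi> by (intro mult_left_mono prod_le_1) auto
          finally show "\<psi> n k x \<le> \<phi> n x" by (simp add: \<phi>_def)
        qed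
      qed (use bounds in auto)
      thus ?thesis using True by simp
    qed
    ultimately show ?thesis using bounds by blast
  qed
qed

lemma test_functions_mono: "\<Omega> \<subseteq> \<Omega>' \<Longrightarrow> test_functions \<Omega> \<subseteq> test_functions \<Omega>'"
  unfolding test_functions_def by blast

text \<open>Orthogonality extends by dominated convergence from test functions to indicators of open
  sets, from those to G-delta sets, and up to a null set to all Lebesgue sets. The set where
  \<open>g\<close> is positive or negative is one of them.\<close>

lemma fundamental_lemma_variations:
  fixes g :: "real^2 \<Rightarrow> real"
  assumes \<Omega>: "open \<Omega>" and g: "integrable (lebesgue_on \<Omega>) g"
    and zero: "\<And>\<phi>. \<phi> \<in> test_functions \<Omega> \<Longrightarrow> (\<integral>x. g x * \<phi> x \<partial>lebesgue_on \<Omega>) = 0"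
  shows "AE x in lebesgue_on \<Omega>. g x = 0"
proof -
  have \<Omega>m: "\<Omega> \<in> sets lebesgue" using \<Omega> by simp
  have meas[measurable]: "g \<in> borel_measurable (lebesgue_on \<Omega>)" using g by simp
  have ind[measurable]: "indicator A \<in> borel_measurable (lebesgue_on \<Omega>)" if "A \<in> sets lebesgue" for A :: "(real^2) set"
    using that by (intro measurable_restrict_space1 borel_measurable_indicator) auto
  have lim_step: "(\<integral>x. g x * h x \<partial>lebesgue_on \<Omega>) = 0"
    if "\<And>n. (\<integral>x. g x * f n x \<partial>lebesgue_on \<Omega>) = 0" "\<And>n. f n \<in> borel_measurable (lebesgue_on \<Omega>)"
      "h \<in> borel_measurable (lebesgue_on \<Omega>)"
      "\<And>n x. 0 \<le> f n x \<and> f n x \<le> 1" "\<And>x. (\<lambda>n. f n x) \<longlonglongrightarrow> h x" for f :: "nat \<Rightarrow> _" and h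
  proof -
    have "(\<lambda>n. \<integral>x. g x * f n x \<partial>lebesgue_on \<Omega>) \<longlonglongrightarrow> (\<integral>x. g x * h x \<partial>lebesgue_on \<Omega>)"
    proof (rule integral_dominated_convergence)
      show "integrable (lebesgue_on \<Omega>) (\<lambda>x. \<bar>g x\<bar>)" using g by simp
      show "AE x in lebesgue_on \<Omega>. norm (g x * f n x) \<le> \<bar>g x\<bar>" for n
        using that(4) by (intro AE_I2) (simp add: abs_mult mult_left_le)
      show "AE x in lebesgue_on \<Omega>. (\<lambda>n. g x * f n x) \<longlonglongrightarrow> g x * h x"
        using that(5) by (intro AE_I2 tendsto_intros)
    qed (use that(2,3) in measurable)
    thus ?thesis using that(1) by (simp add: LIMSEQ_const_iff)
  qed
  have openU: "(\<integral>x. g x * indicator U x \<partial>lebesgue_on \<Omega>) = 0" if U: "open U" "U \<subseteq> \<Omega>" for U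
  proof -
    obtain \<phi> :: "nat \<Rightarrow> real^2 \<Rightarrow> real" where \<phi>: "\<And>n. \<phi> n \<in> test_functions U"
      "\<And>n x. 0 \<le> \<phi> n x \<and> \<phi> n x \<le> 1" "\<And>x. (\<lambda>n. \<phi> n x) \<longlonglongrightarrow> indicator U x"
      using open_indicator_test_approx[OF U(1)] by blast
    have t: "\<phi> n \<in> test_functions \<Omega>" for n using \<phi>(1) test_functions_mono[OF U(2)] by blast
    have m: "\<phi> n \<in> borel_measurable (lebesgue_on \<Omega>)" for n
      by (intro borel_measurable_lebesgue_on borel_measurable_continuous_onI
          C1_compact_continuous[OF test_functions_C1[OF t]])
    have i: "indicator U \<in> borel_measurable (lebesgue_on \<Omega>)" using U(1) by (intro ind) simp
    show ?thesis by (rule lim_step[OF zero[OF t] m i \<phi>(2,3)])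
  qed
  have lebA: "(\<integral>x. g x * indicator A x \<partial>lebesgue_on \<Omega>) = 0" if A: "A \<in> sets lebesgue" "A \<subseteq> \<Omega>" for A
  proof -
    obtain C T where CT: "gdelta C" "T \<in> null_sets lebesgue" "A \<union> T = C" "disjnt A T"
      using lebesgue_set_almost_gdelta[OF A(1)] .
    obtain F :: "nat \<Rightarrow> _" where F: "C = \<Inter>(range F)" "\<And>n. open (F n)" using CT(1) by cases blast
    \<comment> \<open>Finite intersections keep the sets open, intersecting with
      \<open>\<Omega>\<close> keeps them admissible, and the sequence decreases to the G-delta set
      inside \<open>\<Omega>\<close>.\<close>
    define W where "W n = \<Omega> \<inter> (\<Inter>k\<le>n. F k)" for n
    have W: "open (W n)" "W n \<subseteq> \<Omega>" for n unfolding W_def using \<Omega> F(2) by (auto intro!: open_Int open_INT)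
    have CL: "C \<inter> \<Omega> \<in> sets lebesgue" using CT A \<Omega>m by (auto simp: null_sets_def intro!: sets.Int)
    have "(\<integral>x. g x * indicator (C \<inter> \<Omega>) x \<partial>lebesgue_on \<Omega>) = 0"
    proof (rule lim_step[of "\<lambda>n. indicator (W n)"])
      show "(\<lambda>n. indicator (W n) x :: real) \<longlonglongrightarrow> indicator (C \<inter> \<Omega>) x" for x
      proof -
        have "decseq W" unfolding W_def by (intro decseq_SucI) (auto simp: atMost_Suc)
        moreover have "(\<Inter>n. W n) = C \<inter> \<Omega>" unfolding W_def F(1) by auto
        ultimately show ?thesis using LIMSEQ_indicator_decseq[of W x] by simp
      qed
    qed (use W CL openU in \<open>auto intro!: ind\<close>)
    moreover have "(\<integral>x. g x * indicator (C \<inter> \<Omega>) x \<partial>lebesgue_on \<Omega>) = (\<integral>x. g x * indicator A x \<partial>lebesgue_on \<Omega>)"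
    proof (rule integral_cong_AE)
      have "AE x in lebesgue_on \<Omega>. x \<notin> T"
        using AE_not_in[OF CT(2)] \<Omega>m by (auto simp: AE_restrict_space_iff)
      moreover have "g x * indicator (C \<inter> \<Omega>) x = g x * indicator A x" if "x \<notin> T" for x
        using that CT(3) A(2) by (auto simp: indicator_def)
      ultimately show "AE x in lebesgue_on \<Omega>. g x * indicator (C \<inter> \<Omega>) x = g x * indicator A x" by auto
      show "(\<lambda>x. g x * indicator (C \<inter> \<Omega>) x) \<in> borel_measurable (lebesgue_on \<Omega>)"
        using ind[OF CL] by measurable
      show "(\<lambda>x. g x * indicator A x) \<in> borel_measurable (lebesgue_on \<Omega>)"
        using ind[OF A(1)] by measurable
    qed
    ultimately show ?thesis by simp
  qed
  \<comment> \<open>The scalar s is taken as 1 and as -1, so one argument excludes both signs of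
    \<open>g\<close>.\<close>
  have sgn_step: "AE x in lebesgue_on \<Omega>. s * g x \<le> 0" for s
  proof -
    define A where "A = {x \<in> \<Omega>. s * g x > 0}"
    have "A \<in> sets (lebesgue_on \<Omega>)"
    proof -
      have "{x \<in> space (lebesgue_on \<Omega>). s * g x > 0} \<in> sets (lebesgue_on \<Omega>)" by measurable
      thus ?thesis by (simp add: A_def)
    qed
    hence A: "A \<in> sets lebesgue" "A \<subseteq> \<Omega>" using \<Omega>m by (auto simp: sets_restrict_space_iff A_def)
    have i0: "integrable (lebesgue_on \<Omega>) (\<lambda>x. g x * indicator A x)"
      by (rule Bochner_Integration.integrable_bound[OF g])
         (use borel_measurable_times[OF meas ind[OF A(1)]] in \<open>auto simp: indicator_def\<close>)
    hence "(\<integral>x. s * (g x * indicator A x) \<partial>lebesgue_on \<Omega>) = 0" using lebA[OF A] by simp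
    hence "AE x in lebesgue_on \<Omega>. s * (g x * indicator A x) = 0"
      using i0 by (subst (asm) integral_nonneg_eq_0_iff_AE) (auto simp: A_def indicator_def intro!: AE_I2)
    moreover have "AE x in lebesgue_on \<Omega>. x \<in> \<Omega>" by (intro AE_I2) simp
    ultimately show ?thesis by eventually_elim (auto simp: A_def indicator_def split: if_splits)
  qed
  show ?thesis using sgn_step[of 1] sgn_step[of "-1"] by eventually_elim auto
qed

section \<open>The space of square integrable functions and its completeness\<close>

lemma fatou_bound:
  fixes f :: "nat \<Rightarrow> 'a \<Rightarrow> real"
  assumes [measurable]: "\<And>n. f n \<in> borel_measurable M"
    and lim: "AE x in M. (\<lambda>n. f n x) \<longlonglongrightarrow> g x"
    and bound: "\<forall>\<^sub>F n in sequentially. (\<integral>\<^sup>+x. ennreal (f n x) \<partial>M) \<le> C"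
  shows "(\<integral>\<^sup>+x. ennreal (g x) \<partial>M) \<le> C"
proof -
  have "(\<integral>\<^sup>+x. ennreal (g x) \<partial>M) = (\<integral>\<^sup>+x. liminf (\<lambda>n. ennreal (f n x)) \<partial>M)"
    using lim by (intro nn_integral_cong_AE, eventually_elim)
      (metis lim_imp_Liminf sequentially_bot tendsto_ennrealI)
  also have "\<dots> \<le> liminf (\<lambda>n. \<integral>\<^sup>+x. ennreal (f n x) \<partial>M)" by (intro nn_integral_liminf) measurable
  also have "\<dots> \<le> C" using bound by (intro Liminf_le) auto
  finally show ?thesis .
qed

lemma L2_I: "u \<in> borel_measurable (lebesgue_on \<Omega>) \<Longrightarrow> integrable (lebesgue_on \<Omega>) (\<lambda>x. (u x)\<^sup>2) \<Longrightarrow> u \<in> L2 \<Omega>"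
  by (simp add: L2_def)

lemma L2_D: assumes "u \<in> L2 \<Omega>"
  shows "u \<in> borel_measurable (lebesgue_on \<Omega>)" "integrable (lebesgue_on \<Omega>) (\<lambda>x. (u x)\<^sup>2)"
  using assms by (auto simp: L2_def)

lemma L2_mult_integrable:
  assumes "u \<in> L2 \<Omega>" "v \<in> L2 \<Omega>" shows "integrable (lebesgue_on \<Omega>) (\<lambda>x. u x * v x)"
proof (rule Bochner_Integration.integrable_bound)
  show "integrable (lebesgue_on \<Omega>) (\<lambda>x. (u x)\<^sup>2 + (v x)\<^sup>2)" using assms L2_D by auto
  have "\<bar>u x * v x\<bar> \<le> (u x)\<^sup>2 + (v x)\<^sup>2" for x
  proof -
    have "2 * (\<bar>u x\<bar> * \<bar>v x\<bar>) \<le> \<bar>u x\<bar>\<^sup>2 + \<bar>v x\<bar>\<^sup>2" using sum_squares_bound[of "\<bar>u x\<bar>" "\<bar>v x\<bar>"] by (simp add: mult.assoc)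
    moreover have "0 \<le> \<bar>u x\<bar> * \<bar>v x\<bar>" by simp
    ultimately show ?thesis unfolding abs_mult power2_abs by linarith
  qed
  thus "AE x in lebesgue_on \<Omega>. norm (u x * v x) \<le> norm ((u x)\<^sup>2 + (v x)\<^sup>2)" by (intro AE_I2) simp
qed (use assms L2_D in measurable)

interpretation L2: semi_inner_space "L2 \<Omega>" "L2_inner \<Omega>" for \<Omega>
proof
  show "(\<lambda>_. 0) \<in> L2 \<Omega>" by (simp add: L2_def)
  show "(\<lambda>x. u x + v x) \<in> L2 \<Omega>" if "u \<in> L2 \<Omega>" "v \<in> L2 \<Omega>" for u v
  proof (rule L2_I)
    have "integrable (lebesgue_on \<Omega>) (\<lambda>x. (u x)\<^sup>2 + (v x)\<^sup>2 + 2 * (u x * v x))"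
      using that L2_D L2_mult_integrable by (intro Bochner_Integration.integrable_add integrable_mult_right) auto
    thus "integrable (lebesgue_on \<Omega>) (\<lambda>x. (u x + v x)\<^sup>2)" by (simp add: power2_sum mult.assoc)
  qed (use that L2_D in measurable)
  show "(\<lambda>x. c * u x) \<in> L2 \<Omega>" if "u \<in> L2 \<Omega>" for u c
    using that by (auto simp: L2_def power_mult_distrib)
  show "L2_inner \<Omega> u v = L2_inner \<Omega> v u" for u v :: "real^2 \<Rightarrow> real"
    by (simp add: L2_inner_def mult.commute)
qed (auto simp: L2_inner_def L2_mult_integrable distrib_right mult.assoc)

lemma L2_nn_integral_le:
  assumes u: "u \<in> borel_measurable (lebesgue_on \<Omega>)" and le: "(\<integral>\<^sup>+x. ennreal ((u x)\<^sup>2) \<partial>lebesgue_on \<Omega>) \<le> ennreal (C\<^sup>2)"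
    and C: "C \<ge> 0"
  shows "u \<in> L2 \<Omega>" "L2.nrm \<Omega> u \<le> C"
proof -
  have i: "integrable (lebesgue_on \<Omega>) (\<lambda>x. (u x)\<^sup>2)"
    using u le by (intro integrableI_nonneg) (auto intro: le_less_trans)
  thus "u \<in> L2 \<Omega>" using u by (rule L2_I[rotated])
  have "ennreal (L2_inner \<Omega> u u) \<le> ennreal (C\<^sup>2)"
    using le nn_integral_eq_integral[OF i] by (simp add: L2_inner_def power2_eq_square)
  hence "L2_inner \<Omega> u u \<le> C\<^sup>2" by simp
  thus "L2.nrm \<Omega> u \<le> C" using C by (simp add: L2.nrm_def real_le_lsqrt)
qed

lemma L2_nn_integral_eq:
  assumes u: "u \<in> L2 \<Omega>" shows "(\<integral>\<^sup>+x. ennreal ((u x)\<^sup>2) \<partial>lebesgue_on \<Omega>) = ennreal ((L2.nrm \<Omega> u)\<^sup>2)"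
  unfolding L2.nrm_power2[OF u] using nn_integral_eq_integral[OF L2_D(2)[OF u]]
  by (simp add: L2_inner_def power2_eq_square)

lemma L2_AE_subseq:
  assumes X: "\<And>n::nat. X n \<in> L2 \<Omega>" and u: "u \<in> L2 \<Omega>"
    and lim: "(\<lambda>n. L2.nrm \<Omega> (\<lambda>x. X n x - u x)) \<longlonglongrightarrow> 0"
  shows "\<exists>r::nat\<Rightarrow>nat. strict_mono r \<and> (AE x in lebesgue_on \<Omega>. (\<lambda>n. X (r n) x) \<longlonglongrightarrow> u x)"
proof -
  note d = L2.diff_mem[OF X u]
  have "(\<lambda>n. (L2.nrm \<Omega> (\<lambda>x. X n x - u x))\<^sup>2) \<longlonglongrightarrow> 0\<^sup>2" by (intro tendsto_power lim)
  hence "(\<lambda>n. \<integral>x. norm ((X n x - u x)\<^sup>2) \<partial>lebesgue_on \<Omega>) \<longlonglongrightarrow> 0"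
    unfolding L2.nrm_power2[OF d] by (simp add: L2_inner_def power2_eq_square)
  from tendsto_L1_AE_subseq[OF L2_D(2)[OF d] this] obtain r :: "nat \<Rightarrow> nat"
    where r: "strict_mono r" "AE x in lebesgue_on \<Omega>. (\<lambda>n. (X (r n) x - u x)\<^sup>2) \<longlonglongrightarrow> 0" by blast
  from r(2) have "AE x in lebesgue_on \<Omega>. (\<lambda>n. X (r n) x) \<longlonglongrightarrow> u x"
  proof eventually_elim
    case (elim x)
    hence "(\<lambda>n. sqrt ((X (r n) x - u x)\<^sup>2)) \<longlonglongrightarrow> sqrt 0" by (intro tendsto_intros)
    hence "(\<lambda>n. X (r n) x - u x) \<longlonglongrightarrow> 0" by (simp add: tendsto_rabs_zero_iff)
    thus ?case by (rule LIM_zero_cancel)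
  qed
  with r(1) show ?thesis by blast
qed

lemma lebesgue_on_bounded_finite:
  fixes \<Omega> :: "(real^2) set"
  assumes "bounded \<Omega>" "\<Omega> \<in> sets lebesgue" shows "finite_measure (lebesgue_on \<Omega>)"
proof
  obtain r where "\<Omega> \<subseteq> ball 0 r" using bounded_subset_ballD[OF assms(1), of 0] by blast
  hence "emeasure lebesgue \<Omega> \<le> emeasure lebesgue (ball (0::real^2) r)"
    by (intro emeasure_mono) auto
  also have "\<dots> < \<infinity>" using emeasure_bounded_finite[of "ball (0::real^2) r"] by simp
  finally show "emeasure (lebesgue_on \<Omega>) (space (lebesgue_on \<Omega>)) \<noteq> \<infinity>"
    using assms(2) by (simp add: emeasure_restrict_space)
qed

lemma L2_const: "bounded \<Omega> \<Longrightarrow> \<Omega> \<in> sets lebesgue \<Longrightarrow> (\<lambda>_. c) \<in> L2 \<Omega>"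
  using finite_measure.integrable_const[OF lebesgue_on_bounded_finite] by (auto simp: L2_def)

lemma L2_integrable: "bounded \<Omega> \<Longrightarrow> \<Omega> \<in> sets lebesgue \<Longrightarrow> u \<in> L2 \<Omega> \<Longrightarrow> integrable (lebesgue_on \<Omega>) u"
  using L2_mult_integrable[OF _ L2_const[of \<Omega> 1]] by simp

text \<open>Riesz-Fischer. On a set of finite measure, Cauchy-Schwarz against the constant 1 turns
  small L^2 steps of a fast subsequence into summable L^1 steps, hence convergence almost
  everywhere; Fatou then gives convergence in norm of the whole sequence.\<close>

lemma L2_complete:
  assumes b: "bounded \<Omega>" "\<Omega> \<in> sets lebesgue" and X: "\<And>n::nat. X n \<in> L2 \<Omega>"
    and cauchy: "\<And>e. e > 0 \<Longrightarrow> \<exists>N. \<forall>m\<ge>N. \<forall>n\<ge>N. L2.nrm \<Omega> (\<lambda>x. X m x - X n x) < e"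
  shows "\<exists>u\<in>L2 \<Omega>. (\<lambda>n. L2.nrm \<Omega> (\<lambda>x. X n x - u x)) \<longlonglongrightarrow> 0"
proof -
  let ?M = "lebesgue_on \<Omega>"
  have meas[measurable]: "X n \<in> borel_measurable ?M" for n using X L2_D by blast
  have "\<exists>r::nat\<Rightarrow>nat. strict_mono r \<and> (\<forall>k. L2.nrm \<Omega> (\<lambda>x. X (r (Suc k)) x - X (r k) x) < (1/2) ^ k)"
  proof -
    have "\<forall>k. \<exists>N. \<forall>m\<ge>N. \<forall>n\<ge>N. L2.nrm \<Omega> (\<lambda>x. X m x - X n x) < (1/2) ^ k" using cauchy by simp
    then obtain N where N: "\<And>k m n. m \<ge> N k \<Longrightarrow> n \<ge> N k \<Longrightarrow> L2.nrm \<Omega> (\<lambda>x. X m x - X n x) < (1/2) ^ k"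
      by metis
    \<comment> \<open>The partial sums dominate \<open>N k\<close>, and the added k makes the
      sequence strictly increasing, so both of two consecutive indices lie beyond
      \<open>N k\<close>.\<close>
    define r where "r k = (\<Sum>j\<le>k. N j) + k" for k
    have "N k \<le> r k" for k unfolding r_def using member_le_sum[of k "{..k}" N] by simp
    moreover have "strict_mono r" by (rule strict_monoI_Suc) (simp add: r_def)
    moreover have "r k \<le> r (Suc k)" for k by (simp add: r_def)
    ultimately show ?thesis using N order_trans by (intro exI[of _ r]) blast
  qed
  then obtain r :: "nat \<Rightarrow> nat" where r: "strict_mono r"
    and fast: "\<And>k. L2.nrm \<Omega> (\<lambda>x. X (r (Suc k)) x - X (r k) x) < (1/2) ^ k" by blast
  define d where "d k x = \<bar>X (r (Suc k)) x - X (r k) x\<bar>" for k x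
  have d_meas[measurable]: "d k \<in> borel_measurable ?M" for k unfolding d_def[abs_def] by measurable
  define c where "c = L2.nrm \<Omega> (\<lambda>_. 1)"
  have c0: "c \<ge> 0" unfolding c_def by (intro L2.nrm_ge0 L2_const b)
  have d_int: "(\<integral>\<^sup>+x. ennreal (d k x) \<partial>?M) \<le> ennreal (c * (1/2) ^ k)" for k
  proof -
    define e where "e = (\<lambda>x. X (r (Suc k)) x - X (r k) x)"
    have e: "e \<in> L2 \<Omega>" unfolding e_def by (intro L2.diff_mem X)
    hence ea: "(\<lambda>x. \<bar>e x\<bar>) \<in> L2 \<Omega>" by (auto simp: L2_def)
    have "(\<integral>\<^sup>+x. ennreal (d k x) \<partial>?M) = ennreal (\<integral>x. \<bar>e x\<bar> \<partial>?M)"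
      unfolding d_def e_def[symmetric, THEN fun_cong]
      by (intro nn_integral_eq_integral L2_integrable[OF b ea]) (simp add: e_def)
    also have "(\<integral>x. \<bar>e x\<bar> \<partial>?M) = L2_inner \<Omega> (\<lambda>_. 1) (\<lambda>x. \<bar>e x\<bar>)" by (simp add: L2_inner_def)
    also have "\<dots> \<le> c * L2.nrm \<Omega> (\<lambda>x. \<bar>e x\<bar>)"
      unfolding c_def using L2.ip_le[OF L2_const[OF b] ea] by (rule order_trans[OF abs_ge_self])
    also have "L2.nrm \<Omega> (\<lambda>x. \<bar>e x\<bar>) = L2.nrm \<Omega> e" by (simp add: L2.nrm_def L2_inner_def)
    also have "c * \<dots> \<le> c * (1/2) ^ k" using fast[of k] c0 unfolding e_def by (intro mult_left_mono) auto
    finally show ?thesis by (simp add: ennreal_leI)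
  qed
  have "(\<integral>\<^sup>+x. (\<Sum>k. ennreal (d k x)) \<partial>?M) = (\<Sum>k. \<integral>\<^sup>+x. ennreal (d k x) \<partial>?M)"
    by (intro nn_integral_suminf) measurable
  also have "\<dots> \<le> (\<Sum>k. ennreal (c * (1/2) ^ k))" by (intro suminf_le d_int) auto
  also have "\<dots> = ennreal (\<Sum>k. c * (1/2) ^ k)"
    using c0 by (intro suminf_ennreal2 summable_mult summable_geometric) auto
  finally have "(\<integral>\<^sup>+x. (\<Sum>k. ennreal (d k x)) \<partial>?M) \<noteq> \<infinity>" by (auto simp: top_unique)
  hence "AE x in ?M. (\<Sum>k. ennreal (d k x)) \<noteq> \<infinity>"
    by (intro nn_integral_PInf_AE) measurable
  hence conv: "AE x in ?M. convergent (\<lambda>k. X (r k) x)"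
  proof eventually_elim
    case (elim x)
    have "summable (\<lambda>k. d k x)"
      using elim by (intro summable_suminf_not_top) (auto simp: d_def)
    hence "summable (\<lambda>k. X (r (Suc k)) x - X (r k) x)"
      unfolding d_def by (rule summable_rabs_cancel)
    hence "convergent (\<lambda>n. \<Sum>k<n. X (r (Suc k)) x - X (r k) x)" by (simp add: summable_iff_convergent)
    hence "convergent (\<lambda>n. X (r n) x - X (r 0) x)" by (simp add: sum_lessThan_telescope[of "\<lambda>n. X (r n) x"])
    hence "convergent (\<lambda>n. (X (r n) x - X (r 0) x) + X (r 0) x)" by (intro convergent_add convergent_const)
    thus ?case by simp
  qed
  \<comment> \<open>\<open>lim\<close> is unspecified where the subsequence diverges; by
    \<open>conv\<close> this concerns a null set only.\<close>
  define u where "u x = lim (\<lambda>k. X (r k) x)" for x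
  have u_meas[measurable]: "u \<in> borel_measurable ?M" unfolding u_def[abs_def] by measurable
  have u_lim: "AE x in ?M. (\<lambda>k. X (r k) x) \<longlonglongrightarrow> u x"
    using conv by eventually_elim (simp add: u_def convergent_LIMSEQ_iff)
  have close: "\<exists>N. \<forall>m\<ge>N. (\<lambda>x. X m x - u x) \<in> L2 \<Omega> \<and> L2.nrm \<Omega> (\<lambda>x. X m x - u x) \<le> e" if e: "e > 0" for e
  proof -
    obtain N where N: "\<And>m n. m \<ge> N \<Longrightarrow> n \<ge> N \<Longrightarrow> L2.nrm \<Omega> (\<lambda>x. X m x - X n x) < e" using cauchy[OF e] by blast
    have "(\<lambda>x. X m x - u x) \<in> L2 \<Omega> \<and> L2.nrm \<Omega> (\<lambda>x. X m x - u x) \<le> e" if m: "m \<ge> N" for m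
    proof -
      have "(\<integral>\<^sup>+x. ennreal ((X m x - u x)\<^sup>2) \<partial>?M) \<le> ennreal (e\<^sup>2)"
      proof (rule fatou_bound[of "\<lambda>k x. (X m x - X (r k) x)\<^sup>2"])
        show "AE x in ?M. (\<lambda>k. (X m x - X (r k) x)\<^sup>2) \<longlonglongrightarrow> (X m x - u x)\<^sup>2"
          using u_lim by eventually_elim (intro tendsto_intros)
        show "\<forall>\<^sub>F k in sequentially. (\<integral>\<^sup>+x. ennreal ((X m x - X (r k) x)\<^sup>2) \<partial>?M) \<le> ennreal (e\<^sup>2)"
        proof (rule eventually_sequentiallyI[of N])
          fix k assume "N \<le> k"
          hence "N \<le> r k" using seq_suble[OF r, of k] by simp
          hence "L2.nrm \<Omega> (\<lambda>x. X m x - X (r k) x) \<le> e" using N m by (auto intro: less_imp_le)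
          thus "(\<integral>\<^sup>+x. ennreal ((X m x - X (r k) x)\<^sup>2) \<partial>?M) \<le> ennreal (e\<^sup>2)"
            by (subst L2_nn_integral_eq[OF L2.diff_mem[OF X X]])
               (intro ennreal_leI power_mono L2.nrm_ge0 L2.diff_mem X)
        qed
      qed measurable
      thus ?thesis using L2_nn_integral_le[of "\<lambda>x. X m x - u x" \<Omega> e] e by simp
    qed
    thus ?thesis by blast
  qed
  obtain N where "(\<lambda>x. X N x - u x) \<in> L2 \<Omega>" using close[of 1] by auto
  hence u: "u \<in> L2 \<Omega>" using L2.diff_mem[OF X[of N], of "\<lambda>x. X N x - u x"] by simp
  have "(\<lambda>n. L2.nrm \<Omega> (\<lambda>x. X n x - u x)) \<longlonglongrightarrow> 0"
  proof (rule LIMSEQ_I)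
    fix e :: real assume "e > 0"
    then obtain N where "\<And>m. m \<ge> N \<Longrightarrow> L2.nrm \<Omega> (\<lambda>x. X m x - u x) \<le> e / 2" using close[of "e/2"] by auto
    thus "\<exists>N. \<forall>n\<ge>N. norm (L2.nrm \<Omega> (\<lambda>x. X n x - u x) - 0) < e"
      using L2.nrm_ge0[OF L2.diff_mem[OF X u]] \<open>e > 0\<close> by (intro exI[of _ N]) (force simp: abs_of_nonneg)
  qed
  with u show ?thesis by blast
qed

section \<open>Inequalities of Ladyzhenskaya and Poincare\<close>

lemma nn_integral_deriv_ge:
  fixes f :: "real \<Rightarrow> real"
  assumes ab: "a \<le> b" and f: "\<And>t. (f has_real_derivative f' t) (at t)" "continuous_on UNIV f'"
  shows "ennreal \<bar>f b - f a\<bar> \<le> (\<integral>\<^sup>+t. ennreal \<bar>f' t\<bar> \<partial>lborel)"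
proof -
  have c: "isCont f' t" for t using f(2) by (simp add: continuous_on_eq_continuous_at)
  note I = has_bochner_integral_FTC_Icc_real[OF ab f(1) c]
  have "ennreal (norm (\<integral>t. f' t * indicator {a..b} t \<partial>lborel)) \<le> (\<integral>\<^sup>+t. norm (f' t * indicator {a..b} t) \<partial>lborel)"
    using I by (intro integral_norm_bound_ennreal) (auto simp: has_bochner_integral_iff)
  also have "\<dots> \<le> (\<integral>\<^sup>+t. ennreal \<bar>f' t\<bar> \<partial>lborel)"
    by (intro nn_integral_mono ennreal_leI) (auto simp: abs_mult indicator_def)
  finally show ?thesis using I by (simp add: has_bochner_integral_iff)
qed

text \<open>One-dimensional input for the inequality on squares. The interval is half-open because
  the squares of the grid are, so that they tile without overlap.\<close>

lemma square_diff_le_integral_deriv: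
  fixes f :: "real \<Rightarrow> real"
  assumes f: "\<And>t. (f has_real_derivative f' t) (at t)" "continuous_on UNIV f'"
    and x: "x \<in> {a..<a+h}" and y: "y \<in> {a..<a+h}"
  shows "ennreal ((f x - f y)\<^sup>2) \<le> ennreal h * (\<integral>\<^sup>+t. ennreal ((f' t)\<^sup>2) * indicator {a..<a+h} t \<partial>lborel)"
proof -
  have c: "isCont f' t" for t using f(2) by (simp add: continuous_on_eq_continuous_at)
  have main: "ennreal ((f v - f u)\<^sup>2) \<le> ennreal h * (\<integral>\<^sup>+t. ennreal ((f' t)\<^sup>2) * indicator {a..<a+h} t \<partial>lborel)"
    if uv: "u \<in> {a..<a+h}" "v \<in> {a..<a+h}" "u < v" for u v
  proof -
    \<comment> \<open>The mean slope. Expanding the nonnegative integral of (f' - m)^2 is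
      Cauchy-Schwarz for f' against the constant 1.\<close>
    define m where "m = (f v - f u) / (v - u)"
    note I1 = has_bochner_integral_FTC_Icc_real[OF less_imp_le[OF uv(3)] f(1) c]
    have I2: "integrable lborel (\<lambda>t. (f' t)\<^sup>2 * indicator {u..v} t)"
      using c by (intro borel_integrable_atLeastAtMost) auto
    have I0: "integrable lborel (\<lambda>t. indicator {u..v} t :: real)" using uv(3) by (intro integrable_real_indicator) auto
    define S where "S = (\<integral>t. (f' t)\<^sup>2 * indicator {u..v} t \<partial>lborel)"
    have "0 \<le> (\<integral>t. (f' t - m)\<^sup>2 * indicator {u..v} t \<partial>lborel)" by (intro integral_nonneg_AE) auto
    also have "\<dots> = (\<integral>t. (f' t)\<^sup>2 * indicator {u..v} t - 2 * m * (f' t * indicator {u..v} t)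
        + m\<^sup>2 * indicator {u..v} t \<partial>lborel)"
      by (intro Bochner_Integration.integral_cong) (auto simp: power2_diff algebra_simps)
    also have "\<dots> = S - 2 * m * (f v - f u) + m\<^sup>2 * (v - u)"
      using I0 I1 I2 uv(3) by (simp add: has_bochner_integral_iff S_def)
    also have "\<dots> = S - (f v - f u)\<^sup>2 / (v - u)"
      using uv(3) by (simp add: m_def power2_eq_square)
    finally have "(f v - f u)\<^sup>2 \<le> (v - u) * S" using uv(3) by (simp add: field_simps)
    also have "\<dots> \<le> h * S" using uv by (intro mult_right_mono) (auto simp: S_def intro!: integral_nonneg_AE)
    finally have "ennreal ((f v - f u)\<^sup>2) \<le> ennreal h * ennreal S"
      using uv by (subst ennreal_mult'[symmetric]) (auto intro: ennreal_leI)
    also have "ennreal S = (\<integral>\<^sup>+t. ennreal ((f' t)\<^sup>2 * indicator {u..v} t) \<partial>lborel)"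
      unfolding S_def using I2 by (intro nn_integral_eq_integral[symmetric]) auto
    also have "\<dots> \<le> (\<integral>\<^sup>+t. ennreal ((f' t)\<^sup>2) * indicator {a..<a+h} t \<partial>lborel)"
      using uv by (intro nn_integral_mono) (auto simp: indicator_def)
    finally show ?thesis by (simp add: mult_left_mono)
  qed
  show ?thesis
  proof (cases x y rule: linorder_cases)
    case less thus ?thesis using main[OF x y] by (simp add: power2_commute)
  next
    case greater thus ?thesis using main[OF y x] by simp
  qed simp
qed

lemma C1_compact_section:
  assumes "\<phi> \<in> C1_compact \<Omega>"
  shows "((\<lambda>t. \<phi> (vec2 t y)) has_real_derivative partial_deriv 1 \<phi> (vec2 t y)) (at t)"
    and "((\<lambda>s. \<phi> (vec2 x s)) has_real_derivative partial_deriv 2 \<phi> (vec2 x s)) (at s)"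
    and "continuous_on UNIV (\<lambda>t. partial_deriv 1 \<phi> (vec2 t y))"
    and "continuous_on UNIV (\<lambda>s. partial_deriv 2 \<phi> (vec2 x s))"
proof -
  show "((\<lambda>t. \<phi> (vec2 t y)) has_real_derivative partial_deriv 1 \<phi> (vec2 t y)) (at t)"
    using has_real_derivative_along_axis[OF C1_compact_differentiable[OF assms], of "vec2 0 y" 1 t]
    by (simp add: vec2_shift1[symmetric])
  show "((\<lambda>s. \<phi> (vec2 x s)) has_real_derivative partial_deriv 2 \<phi> (vec2 x s)) (at s)"
    using has_real_derivative_along_axis[OF C1_compact_differentiable[OF assms], of "vec2 x 0" 2 s]
    by (simp add: vec2_shift2[symmetric])
  show "continuous_on UNIV (\<lambda>t. partial_deriv 1 \<phi> (vec2 t y))" "continuous_on UNIV (\<lambda>s. partial_deriv 2 \<phi> (vec2 x s))"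
    by (auto intro!: continuous_on_compose2[OF C1_compact_continuous_partial[OF assms]] continuous_intros)
qed

lemma C1_compact_borel:
  assumes "\<phi> \<in> C1_compact \<Omega>"
  shows "\<phi> \<in> borel_measurable borel" "partial_deriv i \<phi> \<in> borel_measurable borel"
  using C1_compact_continuous[OF assms] C1_compact_continuous_partial[OF assms]
  by (auto intro: borel_measurable_continuous_onI)

lemma norm_vec2_ge: "\<bar>x\<bar> \<le> norm (vec2 x y)" "\<bar>y\<bar> \<le> norm (vec2 x y)"
  using component_le_norm_cart[of "vec2 x y" 1] component_le_norm_cart[of "vec2 x y" 2] by simp_all

text \<open>Each value of \<phi> is bounded by the integral of the first derivative along its row,
  which depends on y alone, and by that of the second along its column, which depends on x alone.
  The product of the two bounds integrates to a product.\<close>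

lemma ladyzhenskaya_L1:
  assumes \<phi>: "\<phi> \<in> C1_compact \<Omega>"
  shows "(\<integral>\<^sup>+p. ennreal ((\<phi> p)\<^sup>2) \<partial>lborel)
    \<le> (\<integral>\<^sup>+p. ennreal \<bar>partial_deriv 1 \<phi> p\<bar> \<partial>lborel) * (\<integral>\<^sup>+p. ennreal \<bar>partial_deriv 2 \<phi> p\<bar> \<partial>lborel)"
proof -
  note [measurable] = C1_compact_borel[OF \<phi>]
  obtain K where K: "compact K" "\<And>x. x \<notin> K \<Longrightarrow> \<phi> x = 0" using C1_compact_support[OF \<phi>] by metis
  obtain r where r: "K \<subseteq> ball 0 r" using bounded_subset_ballD[OF compact_imp_bounded[OF K(1)], of 0] by blast
  have far: "\<phi> (vec2 x y) = 0" if "\<bar>x\<bar> \<ge> r \<or> \<bar>y\<bar> \<ge> r" for x y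
    using that r norm_vec2_ge[where x=x and y=y] by (intro K(2)) (auto dest!: subsetD)
  define P where "P y = (\<integral>\<^sup>+t. ennreal \<bar>partial_deriv 1 \<phi> (vec2 t y)\<bar> \<partial>lborel)" for y
  define Q where "Q x = (\<integral>\<^sup>+s. ennreal \<bar>partial_deriv 2 \<phi> (vec2 x s)\<bar> \<partial>lborel)" for x
  have [measurable]: "P \<in> borel_measurable borel" "Q \<in> borel_measurable borel"
    unfolding P_def[abs_def] Q_def[abs_def] by measurable
  have leP: "ennreal \<bar>\<phi> (vec2 x y)\<bar> \<le> P y" for x y
  proof -
    \<comment> \<open>A starting point not to the right of x and of modulus at least r, hence
      outside the support, for either sign of r.\<close>
    have "min x (- \<bar>r\<bar>) \<le> x" "r \<le> \<bar>min x (- \<bar>r\<bar>)\<bar>" by (auto simp: min_def)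
    thus ?thesis
      using nn_integral_deriv_ge[OF _ C1_compact_section(1,3)[OF \<phi>], of "min x (- \<bar>r\<bar>)" x y] far[of "min x (- \<bar>r\<bar>)" y]
      by (simp add: P_def)
  qed
  have leQ: "ennreal \<bar>\<phi> (vec2 x y)\<bar> \<le> Q x" for x y
  proof -
    have "min y (- \<bar>r\<bar>) \<le> y" "r \<le> \<bar>min y (- \<bar>r\<bar>)\<bar>" by (auto simp: min_def)
    thus ?thesis
      using nn_integral_deriv_ge[OF _ C1_compact_section(2,4)[OF \<phi>], of "min y (- \<bar>r\<bar>)" y x] far[of x "min y (- \<bar>r\<bar>)"]
      by (simp add: Q_def)
  qed
  have "(\<integral>\<^sup>+p. ennreal ((\<phi> p)\<^sup>2) \<partial>lborel) = (\<integral>\<^sup>+x. \<integral>\<^sup>+y. ennreal ((\<phi> (vec2 x y))\<^sup>2) \<partial>lborel \<partial>lborel)"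
    by (rule nn_integral_vec2) measurable
  also have "\<dots> \<le> (\<integral>\<^sup>+x. \<integral>\<^sup>+y. P y * Q x \<partial>lborel \<partial>lborel)"
  proof (intro nn_integral_mono)
    fix x y
    have "ennreal ((\<phi> (vec2 x y))\<^sup>2) = ennreal \<bar>\<phi> (vec2 x y)\<bar> * ennreal \<bar>\<phi> (vec2 x y)\<bar>"
      by (subst ennreal_mult[symmetric]) (auto simp: power2_eq_square abs_mult[symmetric])
    also have "\<dots> \<le> P y * Q x" by (intro mult_mono leP leQ) auto
    finally show "ennreal ((\<phi> (vec2 x y))\<^sup>2) \<le> P y * Q x" .
  qed
  also have "\<dots> = (\<integral>\<^sup>+y. P y \<partial>lborel) * (\<integral>\<^sup>+x. Q x \<partial>lborel)"
    by (simp add: nn_integral_multc nn_integral_cmult)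
  also have "(\<integral>\<^sup>+y. P y \<partial>lborel) = (\<integral>\<^sup>+p. ennreal \<bar>partial_deriv 1 \<phi> p\<bar> \<partial>lborel)"
    unfolding P_def by (rule nn_integral_vec2(2)[symmetric]) measurable
  also have "(\<integral>\<^sup>+x. Q x \<partial>lborel) = (\<integral>\<^sup>+p. ennreal \<bar>partial_deriv 2 \<phi> p\<bar> \<partial>lborel)"
    unfolding Q_def by (rule nn_integral_vec2(1)[symmetric]) measurable
  finally show ?thesis .
qed

section \<open>Sobolev bounds for all even powers\<close>

lemma L2_bounded:
  assumes "bounded \<Omega>" "\<Omega> \<in> sets lebesgue" "u \<in> borel_measurable (lebesgue_on \<Omega>)" "\<And>x. \<bar>u x\<bar> \<le> B"
  shows "u \<in> L2 \<Omega>"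
proof (rule L2_I)
  show "integrable (lebesgue_on \<Omega>) (\<lambda>x. (u x)\<^sup>2)"
  proof (rule Bochner_Integration.integrable_bound[OF L2_D(2)[OF L2_const[OF assms(1,2), of B]]])
    have "\<bar>u x\<bar>\<^sup>2 \<le> B\<^sup>2" for x by (rule power_mono[OF assms(4)]) simp
    thus "AE x in lebesgue_on \<Omega>. norm ((u x)\<^sup>2) \<le> norm (B\<^sup>2)" by (intro AE_I2) simp
  qed (use assms in measurable)
qed fact

lemma C1_compact_power_L2:
  assumes "bounded \<Omega>" "\<Omega> \<in> sets lebesgue" "\<phi> \<in> C1_compact \<Omega>"
  shows "(\<lambda>x. \<phi> x ^ k) \<in> L2 \<Omega>"
proof -
  obtain K where K: "compact K" "\<And>x. x \<notin> K \<Longrightarrow> \<phi> x = 0" using C1_compact_support[OF assms(3)] by metis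
  obtain B where B: "\<And>x. \<bar>\<phi> x\<bar> \<le> B"
    using bounded_continuous_compact_support[OF C1_compact_continuous[OF assms(3)] K] by metis
  have [measurable]: "\<phi> \<in> borel_measurable (lebesgue_on \<Omega>)"
    using C1_compact_borel[OF assms(3)] by (intro borel_measurable_lebesgue_on)
  show ?thesis
    using power_mono[OF B] by (intro L2_bounded[OF assms(1,2), where B = "B ^ k"]) (auto simp: power_abs)
qed

lemma C1_compact_L2:
  assumes "bounded \<Omega>" "\<Omega> \<in> sets lebesgue" "\<phi> \<in> C1_compact \<Omega>"
  shows "\<phi> \<in> L2 \<Omega>"
  using C1_compact_power_L2[OF assms, of 1] by simp

lemma C1_compact_partial_L2:
  assumes "bounded \<Omega>" "\<Omega> \<in> sets lebesgue" "\<phi> \<in> C1_compact \<Omega>"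
  shows "partial_deriv i \<phi> \<in> L2 \<Omega>"
proof -
  obtain K where K: "compact K" "\<And>x. x \<notin> K \<Longrightarrow> partial_deriv i \<phi> x = 0"
    using C1_compact_support[OF assms(3)] by metis
  obtain B where B: "\<And>x. \<bar>partial_deriv i \<phi> x\<bar> \<le> B"
    using bounded_continuous_compact_support[OF C1_compact_continuous_partial[OF assms(3)] K] by metis
  show ?thesis using B C1_compact_borel[OF assms(3)]
    by (intro L2_bounded[OF assms(1,2), where B = B] borel_measurable_lebesgue_on) auto
qed

definition smooth_energy :: "(real^2) set \<Rightarrow> (real^2 \<Rightarrow> real) \<Rightarrow> real" where
  "smooth_energy \<Omega> \<phi> = (\<Sum>i\<in>UNIV. L2_inner \<Omega> (partial_deriv i \<phi>) (partial_deriv i \<phi>))"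

text \<open>The product inequality is applied to the power k + 1 of \<phi>. Its partial derivatives
  carry the factor k + 1 and the k-th power of \<phi>, so Cauchy-Schwarz bounds each L^1 norm by the
  L^2 norms of that power and of a first derivative.\<close>

lemma C1_compact_power_step:
  assumes b: "bounded \<Omega>" "\<Omega> \<in> sets lebesgue" and \<phi>: "\<phi> \<in> C1_compact \<Omega>"
  shows "(\<integral>x. \<phi> x ^ (2 * Suc k) \<partial>lebesgue_on \<Omega>)
    \<le> (real (Suc k))\<^sup>2 * (\<integral>x. \<phi> x ^ (2 * k) \<partial>lebesgue_on \<Omega>) * smooth_energy \<Omega> \<phi>"
proof -
  let ?M = "lebesgue_on \<Omega>"
  have F: "((\<lambda>s. s ^ k) has_real_derivative real k * s ^ (k - 1)) (at s)" for s
    by (auto intro!: derivative_eq_intros)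
  have Fc: "continuous_on UNIV (\<lambda>s::real. real k * s ^ (k - 1))" by (intro continuous_intros)
  define \<psi> where "\<psi> x = \<phi> x ^ k * \<phi> x" for x
  have \<psi>: "\<psi> \<in> C1_compact \<Omega>" unfolding \<psi>_def by (rule C1_compact_mult_compose(1)[OF \<phi> \<phi> F Fc])
  have pd: "partial_deriv i \<psi> x = real (Suc k) * (\<phi> x ^ k * partial_deriv i \<phi> x)" for i x
    unfolding \<psi>_def C1_compact_mult_compose(2)[OF \<phi> \<phi> F Fc] by (cases k) (auto simp: algebra_simps)
  define n where "n = L2.nrm \<Omega> (\<lambda>x. \<phi> x ^ k)"
  define D where "D i = L2.nrm \<Omega> (partial_deriv i \<phi>)" for i
  note L = C1_compact_power_L2[OF b \<phi>] C1_compact_partial_L2[OF b \<phi>]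
  have n0: "n \<ge> 0" and D0: "D i \<ge> 0" for i unfolding n_def D_def by (intro L2.nrm_ge0 L)+
  have n2: "n\<^sup>2 = (\<integral>x. \<phi> x ^ (2 * k) \<partial>?M)"
    unfolding n_def L2.nrm_power2[OF L(1)] by (simp add: L2_inner_def power_add[symmetric] mult_2)
  have J: "(\<integral>\<^sup>+p. ennreal \<bar>partial_deriv i \<psi> p\<bar> \<partial>lborel) \<le> ennreal (real (Suc k) * n * D i)" for i
  proof -
    have ab: "(\<lambda>x. \<bar>\<phi> x ^ k\<bar>) \<in> L2 \<Omega>" "(\<lambda>x. \<bar>partial_deriv i \<phi> x\<bar>) \<in> L2 \<Omega>"
      using L(1)[of k] L(2)[of i] by (auto simp: L2_def)
    have "(\<integral>\<^sup>+p. ennreal \<bar>partial_deriv i \<psi> p\<bar> \<partial>lborel) = (\<integral>\<^sup>+p. ennreal \<bar>partial_deriv i \<psi> p\<bar> \<partial>?M)"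
      using C1_compact_borel[OF \<psi>] C1_compact_zero_outside[OF \<psi>]
      by (intro lebesgue_on_eq_lborel(3)[symmetric] b) auto
    also have "\<dots> = ennreal (\<integral>x. real (Suc k) * (\<bar>\<phi> x ^ k\<bar> * \<bar>partial_deriv i \<phi> x\<bar>) \<partial>?M)"
      unfolding pd using L2_mult_integrable[OF ab]
      by (subst nn_integral_eq_integral[symmetric]) (auto simp: abs_mult)
    also have "(\<integral>x. real (Suc k) * (\<bar>\<phi> x ^ k\<bar> * \<bar>partial_deriv i \<phi> x\<bar>) \<partial>?M)
        = real (Suc k) * L2_inner \<Omega> (\<lambda>x. \<bar>\<phi> x ^ k\<bar>) (\<lambda>x. \<bar>partial_deriv i \<phi> x\<bar>)"
      by (simp add: L2_inner_def)
    also have "\<dots> \<le> real (Suc k) * (L2.nrm \<Omega> (\<lambda>x. \<bar>\<phi> x ^ k\<bar>) * L2.nrm \<Omega> (\<lambda>x. \<bar>partial_deriv i \<phi> x\<bar>))"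
      by (intro mult_left_mono order_trans[OF abs_ge_self L2.ip_le] ab) auto
    also have "L2.nrm \<Omega> (\<lambda>x. \<bar>\<phi> x ^ k\<bar>) = n" by (simp add: n_def L2.nrm_def L2_inner_def)
    also have "L2.nrm \<Omega> (\<lambda>x. \<bar>partial_deriv i \<phi> x\<bar>) = D i" by (simp add: D_def L2.nrm_def L2_inner_def)
    finally show ?thesis by (simp add: ennreal_leI mult.assoc)
  qed
  have "(\<integral>\<^sup>+p. ennreal ((\<psi> p)\<^sup>2) \<partial>?M) = (\<integral>\<^sup>+p. ennreal ((\<psi> p)\<^sup>2) \<partial>lborel)"
    using C1_compact_borel[OF \<psi>] C1_compact_zero_outside[OF \<psi>] by (intro lebesgue_on_eq_lborel(3) b) auto
  also have "\<dots> \<le> ennreal (real (Suc k) * n * D 1) * ennreal (real (Suc k) * n * D 2)"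
    by (rule order_trans[OF ladyzhenskaya_L1[OF \<psi>] mult_mono[OF J J]]) auto
  also have "\<dots> = ennreal ((real (Suc k))\<^sup>2 * n\<^sup>2 * (D 1 * D 2))"
    using n0 D0 by (subst ennreal_mult[symmetric]) (auto simp: power2_eq_square algebra_simps)
  also have "\<dots> \<le> ennreal ((real (Suc k))\<^sup>2 * n\<^sup>2 * smooth_energy \<Omega> \<phi>)"
  proof (intro ennreal_leI mult_left_mono)
    have "2 * (D 1 * D 2) \<le> (D 1)\<^sup>2 + (D 2)\<^sup>2" using sum_squares_bound[of "D 1" "D 2"] by (simp add: mult.assoc)
    moreover have "0 \<le> D 1 * D 2" using D0 by simp
    ultimately show "D 1 * D 2 \<le> smooth_energy \<Omega> \<phi>"
      unfolding smooth_energy_def D_def by (simp add: UNIV_2 L2.nrm_power2[OF L(2)])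
  qed auto
  finally have le: "(\<integral>\<^sup>+p. ennreal ((\<psi> p)\<^sup>2) \<partial>?M) \<le> ennreal ((real (Suc k))\<^sup>2 * n\<^sup>2 * smooth_energy \<Omega> \<phi>)" .
  have "0 \<le> smooth_energy \<Omega> \<phi>" unfolding smooth_energy_def by (intro sum_nonneg L2.ip_ge0 L(2))
  moreover have "integrable ?M (\<lambda>p. (\<psi> p)\<^sup>2)" using L2_D(2)[OF C1_compact_L2[OF b \<psi>]] .
  ultimately have "(\<integral>p. (\<psi> p)\<^sup>2 \<partial>?M) \<le> (real (Suc k))\<^sup>2 * n\<^sup>2 * smooth_energy \<Omega> \<phi>"
    using le by (subst (asm) nn_integral_eq_integral) auto
  thus ?thesis unfolding n2 \<psi>_def by (simp add: power_mult_distrib power_mult power_even_eq power2_eq_square mult_ac power_add)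
qed

text \<open>Iterating the step from k = 0, where the integral is the measure of
  \<open>\<Omega>\<close>; the factors k + 1 multiply up to the factorial. The case k = 1 is the
  Poincare inequality.\<close>

lemma C1_compact_sobolev:
  assumes b: "bounded \<Omega>" "\<Omega> \<in> sets lebesgue" and \<phi>: "\<phi> \<in> C1_compact \<Omega>"
  shows "(\<integral>x. \<phi> x ^ (2 * k) \<partial>lebesgue_on \<Omega>) \<le> (fact k)\<^sup>2 * measure lebesgue \<Omega> * smooth_energy \<Omega> \<phi> ^ k"
proof (induction k)
  case 0
  show ?case using b(2) by (simp add: measure_restrict_space)
next
  case (Suc k)
  have e0: "0 \<le> smooth_energy \<Omega> \<phi>"
    unfolding smooth_energy_def by (intro sum_nonneg L2.ip_ge0 C1_compact_partial_L2 b \<phi>)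
  have "(\<integral>x. \<phi> x ^ (2 * Suc k) \<partial>lebesgue_on \<Omega>)
    \<le> (real (Suc k))\<^sup>2 * (\<integral>x. \<phi> x ^ (2 * k) \<partial>lebesgue_on \<Omega>) * smooth_energy \<Omega> \<phi>"
    by (rule C1_compact_power_step[OF b \<phi>])
  also have "\<dots> \<le> (real (Suc k))\<^sup>2 * ((fact k)\<^sup>2 * measure lebesgue \<Omega> * smooth_energy \<Omega> \<phi> ^ k) * smooth_energy \<Omega> \<phi>"
    using Suc e0 by (intro mult_right_mono mult_left_mono) auto
  finally show ?case by (simp add: power2_eq_square algebra_simps)
qed

section \<open>Poincare inequality on squares and compactness\<close>

definition square :: "real \<Rightarrow> real \<Rightarrow> real \<Rightarrow> (real^2) set" where
  "square a b h = {p. p $ 1 \<in> {a..<a+h} \<and> p $ 2 \<in> {b..<b+h}}"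

lemma indicator_square: "indicator (square a b h) p = (indicator {a..<a+h} (p $ 1) * indicator {b..<b+h} (p $ 2) :: 'a::comm_semiring_1)"
  by (auto simp: square_def indicator_def)

lemma square_borel [measurable]: "square a b h \<in> sets borel"
proof -
  have [measurable]: "(\<lambda>p::real^2. p $ i) \<in> borel_measurable borel" for i
    by (intro borel_measurable_continuous_onI continuous_intros)
  have "{p \<in> space borel. p $ 1 \<in> {a..<a+h} \<and> p $ 2 \<in> {b..<b+h}} \<in> sets (borel :: (real^2) measure)" by measurable
  thus ?thesis by (simp add: square_def)
qed

lemma emeasure_square: "h > 0 \<Longrightarrow> emeasure lborel (square a b h) = ennreal (h * h)"
proof -
  assume h: "h > 0"
  have "emeasure lborel (square a b h) = (\<integral>\<^sup>+p. indicator (square a b h) p \<partial>lborel)" by simp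
  also have "\<dots> = (\<integral>\<^sup>+x. \<integral>\<^sup>+y. indicator {a..<a+h} x * indicator {b..<b+h} y \<partial>lborel \<partial>lborel)"
    by (subst nn_integral_vec2) (auto simp: indicator_square)
  also have "\<dots> = ennreal h * ennreal h"
    using h by (simp add: nn_integral_cmult nn_integral_multc)
  finally show ?thesis using h by (simp add: ennreal_mult)
qed

text \<open>The variance over a square is half the mean of the squared differences, and a difference is
  estimated by moving first horizontally and then vertically.\<close>

lemma poincare_square:
  assumes \<phi>: "\<phi> \<in> C1_compact \<Omega>" and h: "h > 0"
  shows "(\<integral>p. (\<phi> p)\<^sup>2 * indicator (square a b h) p \<partial>lborel)
    \<le> (\<integral>p. \<phi> p * indicator (square a b h) p \<partial>lborel)\<^sup>2 / h\<^sup>2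
      + h\<^sup>2 * (\<integral>p. ((partial_deriv 1 \<phi> p)\<^sup>2 + (partial_deriv 2 \<phi> p)\<^sup>2) * indicator (square a b h) p \<partial>lborel)"
proof -
  note [measurable] = C1_compact_borel[OF \<phi>]
  let ?Q = "square a b h" let ?I = "{a..<a+h}" let ?J = "{b..<b+h}"
  obtain K where K: "compact K" "\<And>x. x \<notin> K \<Longrightarrow> \<phi> x = 0" "\<And>x i. x \<notin> K \<Longrightarrow> partial_deriv i \<phi> x = 0"
    using C1_compact_support[OF \<phi>] by metis
  have [measurable]: "(\<lambda>p::real^2. p $ i) \<in> borel_measurable borel" for i
    by (intro borel_measurable_continuous_onI continuous_intros)
  have ind_int: "integrable lborel (\<lambda>p. f p * indicator ?Q p)"
    if "continuous_on UNIV f" "\<And>x. x \<notin> K \<Longrightarrow> f x = 0" for f :: "real^2 \<Rightarrow> real"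
    using integrable_mult_indicator[OF _ integrable_continuous_compact_support[OF that(1) K(1) that(2)], of ?Q]
    by (simp add: mult.commute)
  have i1: "integrable lborel (\<lambda>p. \<phi> p * indicator ?Q p)"
    using C1_compact_continuous[OF \<phi>] K(2) by (intro ind_int) auto
  have i2: "integrable lborel (\<lambda>p. (\<phi> p)\<^sup>2 * indicator ?Q p)"
    using C1_compact_continuous[OF \<phi>] K(2) by (intro ind_int continuous_intros) auto
  have i3: "integrable lborel (\<lambda>p. ((partial_deriv 1 \<phi> p)\<^sup>2 + (partial_deriv 2 \<phi> p)\<^sup>2) * indicator ?Q p)"
    using C1_compact_continuous_partial[OF \<phi>] K(3) by (intro ind_int continuous_intros) auto
  have i0: "integrable lborel (indicator ?Q :: _ \<Rightarrow> real)"
    using emeasure_square[OF h] by (intro integrable_real_indicator) auto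
  have m0: "(\<integral>p. indicator ?Q p \<partial>lborel) = h * h"
    using emeasure_square[OF h, of a b] h by (simp add: measure_def)
  define m where "m = (\<integral>p. \<phi> p * indicator ?Q p \<partial>lborel)"
  define S where "S = (\<integral>p. (\<phi> p)\<^sup>2 * indicator ?Q p \<partial>lborel)"
  define G where "G = (\<integral>p. ((partial_deriv 1 \<phi> p)\<^sup>2 + (partial_deriv 2 \<phi> p)\<^sup>2) * indicator ?Q p \<partial>lborel)"
  have G0: "G \<ge> 0" unfolding G_def by (intro integral_nonneg_AE) auto
  \<comment> \<open>The integral over q is a quadratic polynomial in the value at p; integrating
    once more over p yields twice h^2 S - m^2, the variance up to normalisation.\<close>
  have inner: "(\<integral>\<^sup>+q. ennreal ((\<phi> p - \<phi> q)\<^sup>2 * indicator ?Q q) \<partial>lborel)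
      = ennreal ((\<phi> p)\<^sup>2 * (h * h) - 2 * \<phi> p * m + S)" for p
  proof -
    have e: "(\<lambda>q. (\<phi> p - \<phi> q)\<^sup>2 * indicator ?Q q)
        = (\<lambda>q. (\<phi> p)\<^sup>2 * indicator ?Q q - 2 * \<phi> p * (\<phi> q * indicator ?Q q) + (\<phi> q)\<^sup>2 * indicator ?Q q)"
      by (auto simp: fun_eq_iff power2_diff algebra_simps)
    have "has_bochner_integral lborel (\<lambda>q. (\<phi> p - \<phi> q)\<^sup>2 * indicator ?Q q)
        ((\<phi> p)\<^sup>2 * (h * h) - 2 * \<phi> p * m + S)"
      unfolding e m_def S_def m0[symmetric]
      by (intro has_bochner_integral_add has_bochner_integral_diff has_bochner_integral_mult_right
          has_bochner_integral_integrable i0 i1 i2)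
    thus ?thesis by (subst nn_integral_eq_integral) (auto simp: has_bochner_integral_iff)
  qed
  have pos: "0 \<le> (\<phi> p)\<^sup>2 * (h * h) - 2 * \<phi> p * m + S" for p
  proof -
    have "0 \<le> (\<integral>q. (\<phi> p - \<phi> q)\<^sup>2 * indicator ?Q q \<partial>lborel)" by (intro integral_nonneg_AE) auto
    also have "\<dots> = (\<integral>q. (\<phi> p)\<^sup>2 * indicator ?Q q - 2 * \<phi> p * (\<phi> q * indicator ?Q q) + (\<phi> q)\<^sup>2 * indicator ?Q q \<partial>lborel)"
      by (intro Bochner_Integration.integral_cong) (auto simp: power2_diff algebra_simps)
    also have "\<dots> = (\<phi> p)\<^sup>2 * (h * h) - 2 * \<phi> p * m + S"
      using i0 i1 i2 unfolding m_def S_def m0[symmetric] by simp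
    finally show ?thesis .
  qed
  have lhs: "(\<integral>\<^sup>+p. (\<integral>\<^sup>+q. ennreal ((\<phi> p - \<phi> q)\<^sup>2 * indicator ?Q q) \<partial>lborel) * indicator ?Q p \<partial>lborel)
      = ennreal (2 * (h * h * S) - 2 * m\<^sup>2)"
  proof -
    have e: "(\<lambda>p. ((\<phi> p)\<^sup>2 * (h * h) - 2 * \<phi> p * m + S) * indicator ?Q p)
        = (\<lambda>p. (h * h) * ((\<phi> p)\<^sup>2 * indicator ?Q p) - 2 * m * (\<phi> p * indicator ?Q p) + S * indicator ?Q p)"
      by (auto simp: fun_eq_iff algebra_simps)
    have "has_bochner_integral lborel (\<lambda>p. ((\<phi> p)\<^sup>2 * (h * h) - 2 * \<phi> p * m + S) * indicator ?Q p)
        ((h * h) * S - 2 * m * m + S * (h * h))"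
      unfolding e unfolding m_def S_def m0[symmetric]
      by (intro has_bochner_integral_add has_bochner_integral_diff has_bochner_integral_mult_right
          has_bochner_integral_integrable i0 i1 i2)
    moreover have "(\<integral>\<^sup>+p. (\<integral>\<^sup>+q. ennreal ((\<phi> p - \<phi> q)\<^sup>2 * indicator ?Q q) \<partial>lborel) * indicator ?Q p \<partial>lborel)
        = (\<integral>\<^sup>+p. ennreal (((\<phi> p)\<^sup>2 * (h * h) - 2 * \<phi> p * m + S) * indicator ?Q p) \<partial>lborel)"
      unfolding inner by (intro nn_integral_cong) (auto simp: indicator_def)
    moreover have "(h * h) * S - 2 * m * m + S * (h * h) = 2 * (h * h * S) - 2 * m\<^sup>2"
      by (simp add: power2_eq_square)
    ultimately show ?thesis using pos
      by (subst (asm) (2) nn_integral_eq_integral) (auto simp: has_bochner_integral_iff)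
  qed
  \<comment> \<open>\<open>A y\<close> is the energy of the first derivative along the row at height
    y, \<open>B x\<close> that of the second along the column at x. Each is constant in the other
    coordinate, so integrating it over the square costs only a factor h.\<close>
  define A where "A y = (\<integral>\<^sup>+t. ennreal ((partial_deriv 1 \<phi> (vec2 t y))\<^sup>2) * indicator ?I t \<partial>lborel)" for y
  define B where "B x = (\<integral>\<^sup>+t. ennreal ((partial_deriv 2 \<phi> (vec2 x t))\<^sup>2) * indicator ?J t \<partial>lborel)" for x
  have [measurable]: "A \<in> borel_measurable borel" "B \<in> borel_measurable borel"
    unfolding A_def[abs_def] B_def[abs_def] by measurable
  have pt: "ennreal ((\<phi> p - \<phi> q)\<^sup>2) \<le> 2 * ennreal h * A (p $ 2) + 2 * ennreal h * B (q $ 1)"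
    if p: "p \<in> ?Q" and q: "q \<in> ?Q" for p q
  proof -
    have pq: "p = vec2 (p $ 1) (p $ 2)" "q = vec2 (q $ 1) (q $ 2)" by (auto simp: vec_eq_iff forall_2)
    let ?z = "vec2 (q $ 1) (p $ 2)"
    have 1: "ennreal ((\<phi> p - \<phi> ?z)\<^sup>2) \<le> ennreal h * A (p $ 2)"
      using square_diff_le_integral_deriv[OF C1_compact_section(1,3)[OF \<phi>], of "p $ 1" a h "q $ 1" "p $ 2"] p q pq(1)
      unfolding A_def square_def by auto
    have 2: "ennreal ((\<phi> ?z - \<phi> q)\<^sup>2) \<le> ennreal h * B (q $ 1)"
      using square_diff_le_integral_deriv[OF C1_compact_section(2,4)[OF \<phi>], of "p $ 2" b h "q $ 2" "q $ 1"] p q pq(2)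
      unfolding B_def square_def by auto
    have "(\<phi> p - \<phi> q)\<^sup>2 \<le> 2 * (\<phi> p - \<phi> ?z)\<^sup>2 + 2 * (\<phi> ?z - \<phi> q)\<^sup>2"
      using sum_squares_bound[of "\<phi> p - \<phi> ?z" "\<phi> ?z - \<phi> q"] by (simp add: power2_eq_square algebra_simps)
    hence "ennreal ((\<phi> p - \<phi> q)\<^sup>2) \<le> 2 * ennreal ((\<phi> p - \<phi> ?z)\<^sup>2) + 2 * ennreal ((\<phi> ?z - \<phi> q)\<^sup>2)"
      using ennreal_leI by (fastforce simp: ennreal_plus ennreal_mult)
    also have "\<dots> \<le> 2 * (ennreal h * A (p $ 2)) + 2 * (ennreal h * B (q $ 1))"
      by (intro add_mono mult_left_mono 1 2) auto
    finally show ?thesis by (simp add: mult.assoc)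
  qed
  have hh: "ennreal h * ennreal h = emeasure lborel ?Q" using emeasure_square[OF h, of a b] h by (simp add: ennreal_mult)
  have IA: "(\<integral>\<^sup>+p. A (p $ 2) * indicator ?Q p \<partial>lborel)
      = ennreal h * (\<integral>\<^sup>+p. ennreal ((partial_deriv 1 \<phi> p)\<^sup>2) * indicator ?Q p \<partial>lborel)"
  proof -
    have "(\<integral>\<^sup>+p. A (p $ 2) * indicator ?Q p \<partial>lborel)
        = (\<integral>\<^sup>+y. \<integral>\<^sup>+x. (A y * indicator ?J y) * indicator ?I x \<partial>lborel \<partial>lborel)"
      by (subst nn_integral_vec2(2)) (auto simp: indicator_square mult_ac)
    also have "\<dots> = (\<integral>\<^sup>+y. (A y * indicator ?J y) * ennreal h \<partial>lborel)" using h by (simp add: nn_integral_cmult)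
    also have "\<dots> = ennreal h * (\<integral>\<^sup>+y. A y * indicator ?J y \<partial>lborel)" by (simp add: nn_integral_multc nn_integral_cmult mult.commute)
    also have "(\<integral>\<^sup>+y. A y * indicator ?J y \<partial>lborel)
        = (\<integral>\<^sup>+y. \<integral>\<^sup>+x. ennreal ((partial_deriv 1 \<phi> (vec2 x y))\<^sup>2) * indicator ?Q (vec2 x y) \<partial>lborel \<partial>lborel)"
      unfolding A_def by (intro nn_integral_cong, subst nn_integral_multc[symmetric])
        (auto simp: indicator_square mult_ac)
    also have "\<dots> = (\<integral>\<^sup>+p. ennreal ((partial_deriv 1 \<phi> p)\<^sup>2) * indicator ?Q p \<partial>lborel)"
      by (rule nn_integral_vec2(2)[symmetric]) measurable
    finally show ?thesis .
  qed
  have IB: "(\<integral>\<^sup>+p. B (p $ 1) * indicator ?Q p \<partial>lborel)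
      = ennreal h * (\<integral>\<^sup>+p. ennreal ((partial_deriv 2 \<phi> p)\<^sup>2) * indicator ?Q p \<partial>lborel)"
  proof -
    have "(\<integral>\<^sup>+p. B (p $ 1) * indicator ?Q p \<partial>lborel)
        = (\<integral>\<^sup>+x. \<integral>\<^sup>+y. (B x * indicator ?I x) * indicator ?J y \<partial>lborel \<partial>lborel)"
      by (subst nn_integral_vec2(1)) (auto simp: indicator_square mult_ac)
    also have "\<dots> = (\<integral>\<^sup>+x. (B x * indicator ?I x) * ennreal h \<partial>lborel)" using h by (simp add: nn_integral_cmult)
    also have "\<dots> = ennreal h * (\<integral>\<^sup>+x. B x * indicator ?I x \<partial>lborel)" by (simp add: nn_integral_multc nn_integral_cmult mult.commute)
    also have "(\<integral>\<^sup>+x. B x * indicator ?I x \<partial>lborel)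
        = (\<integral>\<^sup>+x. \<integral>\<^sup>+y. ennreal ((partial_deriv 2 \<phi> (vec2 x y))\<^sup>2) * indicator ?Q (vec2 x y) \<partial>lborel \<partial>lborel)"
      unfolding B_def by (intro nn_integral_cong, subst nn_integral_multc[symmetric])
        (auto simp: indicator_square mult_ac)
    also have "\<dots> = (\<integral>\<^sup>+p. ennreal ((partial_deriv 2 \<phi> p)\<^sup>2) * indicator ?Q p \<partial>lborel)"
      by (rule nn_integral_vec2(1)[symmetric]) measurable
    finally show ?thesis .
  qed
  let ?A' = "\<integral>\<^sup>+p. A (p $ 2) * indicator ?Q p \<partial>lborel" and ?B' = "\<integral>\<^sup>+p. B (p $ 1) * indicator ?Q p \<partial>lborel"
  let ?c = "2 * ennreal h"
  have "ennreal (2 * (h * h * S) - 2 * m\<^sup>2)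
      \<le> (\<integral>\<^sup>+p. (\<integral>\<^sup>+q. (?c * A (p $ 2) + ?c * B (q $ 1)) * indicator ?Q q \<partial>lborel) * indicator ?Q p \<partial>lborel)"
    unfolding lhs[symmetric]
  proof (intro nn_integral_mono)
    fix p
    show "(\<integral>\<^sup>+q. ennreal ((\<phi> p - \<phi> q)\<^sup>2 * indicator ?Q q) \<partial>lborel) * indicator ?Q p
        \<le> (\<integral>\<^sup>+q. (?c * A (p $ 2) + ?c * B (q $ 1)) * indicator ?Q q \<partial>lborel) * indicator ?Q p"
    proof (cases "p \<in> ?Q")
      case True
      have "(\<integral>\<^sup>+q. ennreal ((\<phi> p - \<phi> q)\<^sup>2 * indicator ?Q q) \<partial>lborel)
          \<le> (\<integral>\<^sup>+q. (?c * A (p $ 2) + ?c * B (q $ 1)) * indicator ?Q q \<partial>lborel)"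
        using pt[OF True] by (intro nn_integral_mono) (auto simp: indicator_def)
      thus ?thesis using True by simp
    qed simp
  qed
  also have "\<dots> = (\<integral>\<^sup>+p. (?c * A (p $ 2) * emeasure lborel ?Q + ?c * ?B') * indicator ?Q p \<partial>lborel)"
    by (simp add: distrib_right nn_integral_add nn_integral_cmult mult.assoc)
  also have "\<dots> = ?c * emeasure lborel ?Q * ?A' + ?c * ?B' * emeasure lborel ?Q"
  proof -
    have "(\<integral>\<^sup>+p. (?c * A (p $ 2) * emeasure lborel ?Q + ?c * ?B') * indicator ?Q p \<partial>lborel)
        = (\<integral>\<^sup>+p. (?c * emeasure lborel ?Q) * (A (p $ 2) * indicator ?Q p) + (?c * ?B') * indicator ?Q p \<partial>lborel)"
      by (intro nn_integral_cong) (simp add: distrib_right distrib_left mult_ac)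
    thus ?thesis by (simp add: nn_integral_add nn_integral_cmult)
  qed
  also have "\<dots> = ?c * emeasure lborel ?Q * (?A' + ?B')" by (simp add: distrib_left mult_ac)
  also have "?A' + ?B' = ennreal h * ennreal G"
  proof -
    have "ennreal G = (\<integral>\<^sup>+p. ennreal (((partial_deriv 1 \<phi> p)\<^sup>2 + (partial_deriv 2 \<phi> p)\<^sup>2) * indicator ?Q p) \<partial>lborel)"
      unfolding G_def using i3 by (intro nn_integral_eq_integral[symmetric]) auto
    also have "\<dots> = (\<integral>\<^sup>+p. ennreal ((partial_deriv 1 \<phi> p)\<^sup>2) * indicator ?Q p + ennreal ((partial_deriv 2 \<phi> p)\<^sup>2) * indicator ?Q p \<partial>lborel)"
      by (intro nn_integral_cong) (auto simp: indicator_def)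
    also have "\<dots> = (\<integral>\<^sup>+p. ennreal ((partial_deriv 1 \<phi> p)\<^sup>2) * indicator ?Q p \<partial>lborel)
        + (\<integral>\<^sup>+p. ennreal ((partial_deriv 2 \<phi> p)\<^sup>2) * indicator ?Q p \<partial>lborel)"
      by (intro nn_integral_add) measurable
    finally show ?thesis unfolding IA IB by (simp add: distrib_left)
  qed
  also have "?c * emeasure lborel ?Q * (ennreal h * ennreal G) = ennreal (2 * h * (h * h) * (h * G))"
    using h G0 by (simp add: hh[symmetric] ennreal_mult'' ennreal_mult)
  finally have "2 * (h * h * S) - 2 * m\<^sup>2 \<le> 2 * h * (h * h) * (h * G)"
    using h G0 by (subst (asm) ennreal_le_iff) auto
  hence "h * h * S \<le> m\<^sup>2 + (h * h) * (h\<^sup>2 * G)" by (simp add: power2_eq_square algebra_simps)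
  hence "S \<le> (m\<^sup>2 + (h * h) * (h\<^sup>2 * G)) / (h * h)" using h by (simp add: pos_le_divide_eq mult.commute)
  also have "\<dots> = m\<^sup>2 / h\<^sup>2 + h\<^sup>2 * G" using h by (simp add: add_divide_distrib power2_eq_square)
  finally show ?thesis unfolding S_def m_def G_def .
qed

lemma sum_indicator_partition:
  assumes "h > 0"
  shows "(\<Sum>i<N. indicator {c + real i * h..<c + real i * h + h} x :: real) = indicator {c..<c + real N * h} x"
proof (induction N)
  case (Suc N)
  have glue: "indicator {p..<q} x + indicator {q..<r} x = (indicator {p..<r} x :: real)"
    if "p \<le> q" "q \<le> r" for p q r :: real using that by (auto simp: indicator_def)
  show ?case using glue[of c "c + real N * h" "c + real N * h + h"] Suc assms
    by (simp add: algebra_simps)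
qed simp

text \<open>Summation of the inequality on squares over a grid that covers \<open>\<Omega>\<close>:
  the energy gets the factor h^2 and the averages get 1 / h^2. The choice of grid depends on
  \<open>\<epsilon>\<close> but not on the function, which is what makes the functionals finitely
  many.\<close>

lemma C1_compact_compactness:
  fixes \<Omega> :: "(real^2) set"
  assumes b: "bounded \<Omega>" "\<Omega> \<in> sets lebesgue" and \<epsilon>: "\<epsilon> > 0"
  shows "\<exists>I Q K. finite I \<and> K \<ge> 0 \<and> (\<forall>i\<in>I. Q i \<in> sets borel) \<and>
    (\<forall>\<phi>\<in>C1_compact \<Omega>. L2_inner \<Omega> \<phi> \<phi> \<le> \<epsilon> * smooth_energy \<Omega> \<phi> +
       K * (\<Sum>i\<in>(I :: (nat \<times> nat) set). (\<integral>x. \<phi> x * indicator (Q i) x \<partial>lebesgue_on \<Omega>)\<^sup>2))"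
proof -
  obtain r where r: "r > 0" "\<Omega> \<subseteq> ball 0 r" using bounded_subset_ballD[OF b(1), of 0] by blast
  \<comment> \<open>The square [-r, r) x [-r, r) is cut into N^2 tiles of side 2 r / N, and this N
    makes the side smaller than the root of \<open>\<epsilon>\<close>.\<close>
  obtain N :: nat where N: "real N > 2 * r / sqrt \<epsilon>" using reals_Archimedean2 by blast
  have N0: "real N > 0" by (rule le_less_trans[OF _ N]) (use r \<epsilon> in auto)
  define h where "h = 2 * r / real N"
  have h: "h > 0" using r N0 by (simp add: h_def)
  have "h < sqrt \<epsilon>" using N N0 \<epsilon> r unfolding h_def by (simp add: field_simps)
  hence "h\<^sup>2 < (sqrt \<epsilon>)\<^sup>2" using h by (intro power_strict_mono) auto
  hence h2: "h\<^sup>2 \<le> \<epsilon>" using \<epsilon> by simp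
  define I where "I = {..<N} \<times> {..<N}"
  define Q where "Q ij = square (- r + real (fst ij) * h) (- r + real (snd ij) * h) h" for ij :: "nat \<times> nat"
  have part: "(\<Sum>ij\<in>I. indicator (Q ij) p :: real) = indicator {- r..<- r + real N * h} (p $ 1) * indicator {- r..<- r + real N * h} (p $ 2)" for p
    unfolding I_def Q_def indicator_square sum_indicator_partition[OF h, symmetric] sum_product sum.cartesian_product
    by (simp add: split_beta')
  have Nh: "real N * h = 2 * r" using N0 by (simp add: h_def)
  have part1: "(\<Sum>ij\<in>I. indicator (Q ij) p :: real) = 1" if "p \<in> \<Omega>" for p
  proof -
    have "norm p < r" using r that by auto
    hence "\<bar>p $ i\<bar> < r" for i using component_le_norm_cart[of p i] by linarith
    thus ?thesis unfolding part Nh by (auto simp: indicator_def abs_less_iff less_imp_le)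
      (smt (verit))+
  qed
  have "L2_inner \<Omega> \<phi> \<phi> \<le> \<epsilon> * smooth_energy \<Omega> \<phi> +
       1 / h\<^sup>2 * (\<Sum>i\<in>I. (\<integral>x. \<phi> x * indicator (Q i) x \<partial>lebesgue_on \<Omega>)\<^sup>2)" if \<phi>: "\<phi> \<in> C1_compact \<Omega>" for \<phi>
  proof -
    note bm[measurable] = C1_compact_borel[OF \<phi>] and z = C1_compact_zero_outside[OF \<phi>]
    obtain C where C: "compact C" "\<And>x. x \<notin> C \<Longrightarrow> \<phi> x = 0" "\<And>x i. x \<notin> C \<Longrightarrow> partial_deriv i \<phi> x = 0"
      using C1_compact_support[OF \<phi>] by metis
    have [measurable]: "Q i \<in> sets borel" for i by (simp add: Q_def)
    let ?g = "\<lambda>p. (partial_deriv 1 \<phi> p)\<^sup>2 + (partial_deriv 2 \<phi> p)\<^sup>2"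
    have split: "(\<integral>p. f p \<partial>lborel) = (\<Sum>i\<in>I. \<integral>p. f p * indicator (Q i) p \<partial>lborel)"
      if f: "continuous_on UNIV f" "\<And>x. x \<notin> C \<Longrightarrow> f x = 0" "\<And>x. x \<notin> \<Omega> \<Longrightarrow> f x = 0" for f :: "real^2 \<Rightarrow> real"
    proof -
      have "integrable lborel (\<lambda>p. f p * indicator (Q i) p)" for i
        using integrable_mult_indicator[OF _ integrable_continuous_compact_support[OF f(1) C(1) f(2)], of "Q i"]
        by (simp add: mult.commute)
      hence "(\<Sum>i\<in>I. \<integral>p. f p * indicator (Q i) p \<partial>lborel) = (\<integral>p. (\<Sum>i\<in>I. f p * indicator (Q i) p) \<partial>lborel)"
        by (intro Bochner_Integration.integral_sum[symmetric])
      also have "\<dots> = (\<integral>p. f p \<partial>lborel)"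
      proof (rule Bochner_Integration.integral_cong[OF refl])
        fix p show "(\<Sum>i\<in>I. f p * indicator (Q i) p) = f p"
          using part1[of p] f(3)[of p] unfolding sum_distrib_left[symmetric] by (cases "p \<in> \<Omega>") simp_all
      qed
      finally show ?thesis by simp
    qed
    have "L2_inner \<Omega> \<phi> \<phi> = (\<integral>p. (\<phi> p)\<^sup>2 \<partial>lborel)"
      unfolding L2_inner_def inner_real_def power2_eq_square[symmetric]
      using z by (intro lebesgue_on_eq_lborel(2) b) auto
    also have "\<dots> = (\<Sum>i\<in>I. \<integral>p. (\<phi> p)\<^sup>2 * indicator (Q i) p \<partial>lborel)"
      using C z C1_compact_continuous[OF \<phi>] by (intro split continuous_intros) auto
    also have "\<dots> \<le> (\<Sum>i\<in>I. (\<integral>p. \<phi> p * indicator (Q i) p \<partial>lborel)\<^sup>2 / h\<^sup>2 + h\<^sup>2 * (\<integral>p. ?g p * indicator (Q i) p \<partial>lborel))"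
      unfolding Q_def by (intro sum_mono poincare_square[OF \<phi> h])
    also have "\<dots> = 1 / h\<^sup>2 * (\<Sum>i\<in>I. (\<integral>p. \<phi> p * indicator (Q i) p \<partial>lborel)\<^sup>2)
        + h\<^sup>2 * (\<Sum>i\<in>I. \<integral>p. ?g p * indicator (Q i) p \<partial>lborel)"
      by (simp add: sum.distrib sum_distrib_left sum_divide_distrib)
    also have "(\<Sum>i\<in>I. \<integral>p. ?g p * indicator (Q i) p \<partial>lborel) = (\<integral>p. ?g p \<partial>lborel)"
      using C z C1_compact_continuous_partial[OF \<phi>] by (intro split[symmetric] continuous_intros) auto
    also have "\<dots> = (\<integral>p. ?g p \<partial>lebesgue_on \<Omega>)"
      using z by (intro lebesgue_on_eq_lborel(2)[symmetric] b) auto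
    also have "\<dots> = smooth_energy \<Omega> \<phi>"
      using L2_D(2)[OF C1_compact_partial_L2[OF b \<phi>]]
      by (simp add: smooth_energy_def UNIV_2 L2_inner_def power2_eq_square[symmetric])
    finally have le: "L2_inner \<Omega> \<phi> \<phi> \<le> 1 / h\<^sup>2 * (\<Sum>i\<in>I. (\<integral>p. \<phi> p * indicator (Q i) p \<partial>lborel)\<^sup>2)
        + h\<^sup>2 * smooth_energy \<Omega> \<phi>" .
    have qe: "(\<integral>p. \<phi> p * indicator (Q i) p \<partial>lborel) = (\<integral>x. \<phi> x * indicator (Q i) x \<partial>lebesgue_on \<Omega>)" for i
      using z by (intro lebesgue_on_eq_lborel(2)[symmetric] b) auto
    have "0 \<le> smooth_energy \<Omega> \<phi>"
      unfolding smooth_energy_def by (intro sum_nonneg L2.ip_ge0 C1_compact_partial_L2 b \<phi>)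
    hence "h\<^sup>2 * smooth_energy \<Omega> \<phi> \<le> \<epsilon> * smooth_energy \<Omega> \<phi>" by (intro mult_right_mono h2)
    thus ?thesis using le unfolding qe by linarith
  qed
  thus ?thesis by (intro exI[of _ I] exI[of _ Q] exI[of _ "1 / h\<^sup>2"]) (auto simp: I_def Q_def)
qed

section \<open>The space H10\<close>

lemma L2_inner_vec:
  fixes G H :: "real^2 \<Rightarrow> real^2"
  assumes "\<And>i. (\<lambda>x. G x $ i) \<in> L2 \<Omega>" "\<And>i. (\<lambda>x. H x $ i) \<in> L2 \<Omega>"
  shows "L2_inner \<Omega> G H = (\<Sum>i\<in>UNIV. L2_inner \<Omega> (\<lambda>x. G x $ i) (\<lambda>x. H x $ i))"
  using L2_mult_integrable[OF assms]
  by (simp add: L2_inner_def inner_vec_def Bochner_Integration.integral_sum)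

lemma L2_inner_cong_AE:
  fixes u v :: "real^2 \<Rightarrow> real"
  assumes "u \<in> L2 \<Omega>" "u' \<in> L2 \<Omega>" "v \<in> L2 \<Omega>" "v' \<in> L2 \<Omega>"
    and "AE x in lebesgue_on \<Omega>. u x = u' x" "AE x in lebesgue_on \<Omega>. v x = v' x"
  shows "L2_inner \<Omega> u v = L2_inner \<Omega> u' v'"
  unfolding L2_inner_def inner_real_def
proof (rule integral_cong_AE)
  show "AE x in lebesgue_on \<Omega>. u x * v x = u' x * v' x" using assms(5,6) by eventually_elim simp
qed (use assms L2_D in measurable)

lemma L2_nrm_cong_AE:
  assumes "u \<in> L2 \<Omega>" "u' \<in> L2 \<Omega>" "AE x in lebesgue_on \<Omega>. u x = u' x"
  shows "L2.nrm \<Omega> u = L2.nrm \<Omega> u'"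
  unfolding L2.nrm_def using L2_inner_cong_AE[OF assms(1,2) assms(1,2) assms(3,3)] by simp

lemma L2_inner_zero_imp_AE:
  assumes "u \<in> L2 \<Omega>" "L2_inner \<Omega> u u = 0" shows "AE x in lebesgue_on \<Omega>. u x = 0"
  using integral_nonneg_eq_0_iff_AE[OF L2_D(2)[OF assms(1)]] assms(2)
  by (simp add: L2_inner_def power2_eq_square)

definition gradc :: "(real^2) set \<Rightarrow> 2 \<Rightarrow> (real^2 \<Rightarrow> real) \<Rightarrow> real^2 \<Rightarrow> real" where
  "gradc \<Omega> i u x = weak_grad \<Omega> u x $ i"

definition grad_inner :: "(real^2) set \<Rightarrow> (real^2 \<Rightarrow> real) \<Rightarrow> (real^2 \<Rightarrow> real) \<Rightarrow> real" where
  "grad_inner \<Omega> u v = L2_inner \<Omega> (weak_grad \<Omega> u) (weak_grad \<Omega> v)"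

locale bounded_open_domain =
  fixes \<Omega> :: "(real^2) set"
  assumes \<Omega>_open: "open \<Omega>" and \<Omega>_bounded: "bounded \<Omega>"
begin

lemma \<Omega>_lebesgue: "\<Omega> \<in> sets lebesgue" using \<Omega>_open by simp

lemmas b\<Omega> = \<Omega>_bounded \<Omega>_lebesgue

lemma test_L2: "\<phi> \<in> test_functions \<Omega> \<Longrightarrow> \<phi> \<in> L2 \<Omega>"
  and test_partial_L2: "\<phi> \<in> test_functions \<Omega> \<Longrightarrow> partial_deriv i \<phi> \<in> L2 \<Omega>"
  using C1_compact_L2[OF b\<Omega>] C1_compact_partial_L2[OF b\<Omega>] test_functions_C1 by blast+

text \<open>\<open>weak_grad\<close> is an arbitrary choice, so each computation with it goes
  through a concrete weak gradient and this comparison, which is the fundamental lemma applied to a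
  difference of components.\<close>

lemma is_weak_grad_unique:
  assumes "is_weak_grad \<Omega> u G" "is_weak_grad \<Omega> u H"
  shows "AE x in lebesgue_on \<Omega>. G x $ i = H x $ i"
proof -
  have L: "(\<lambda>x. G x $ i) \<in> L2 \<Omega>" "(\<lambda>x. H x $ i) \<in> L2 \<Omega>"
    using assms by (auto simp: is_weak_grad_def)
  have "AE x in lebesgue_on \<Omega>. G x $ i - H x $ i = 0"
  proof (rule fundamental_lemma_variations[OF \<Omega>_open])
    show "integrable (lebesgue_on \<Omega>) (\<lambda>x. G x $ i - H x $ i)"
      by (intro L2_integrable b\<Omega> L2.diff_mem L)
    fix \<phi> assume \<phi>: "\<phi> \<in> test_functions \<Omega>"
    have "(\<integral>x. G x $ i * \<phi> x \<partial>lebesgue_on \<Omega>) = (\<integral>x. H x $ i * \<phi> x \<partial>lebesgue_on \<Omega>)"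
      using assms[unfolded is_weak_grad_def, THEN conjunct2, rule_format, OF \<phi>, of i] by linarith
    thus "(\<integral>x. (G x $ i - H x $ i) * \<phi> x \<partial>lebesgue_on \<Omega>) = 0"
      using L2_mult_integrable[OF L(1) test_L2[OF \<phi>]] L2_mult_integrable[OF L(2) test_L2[OF \<phi>]]
      by (simp add: left_diff_distrib)
  qed
  thus ?thesis by simp
qed

lemma H1_I:
  assumes "u \<in> L2 \<Omega>" "is_weak_grad \<Omega> u G"
  shows "u \<in> H1 \<Omega>" "gradc \<Omega> i u \<in> L2 \<Omega>" "AE x in lebesgue_on \<Omega>. gradc \<Omega> i u x = G x $ i"
proof -
  show "u \<in> H1 \<Omega>" using assms by (auto simp: H1_def)
  have "is_weak_grad \<Omega> u (weak_grad \<Omega> u)" unfolding weak_grad_def using someI[of "is_weak_grad \<Omega> u" G] assms(2) .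
  thus "gradc \<Omega> i u \<in> L2 \<Omega>" "AE x in lebesgue_on \<Omega>. gradc \<Omega> i u x = G x $ i"
    using is_weak_grad_unique[OF _ assms(2)] by (auto simp: is_weak_grad_def gradc_def[abs_def])
qed

lemma H1_D:
  assumes "u \<in> H1 \<Omega>"
  shows "u \<in> L2 \<Omega>" "gradc \<Omega> i u \<in> L2 \<Omega>" "is_weak_grad \<Omega> u (weak_grad \<Omega> u)"
proof -
  obtain G where "u \<in> L2 \<Omega>" "is_weak_grad \<Omega> u G" using assms by (auto simp: H1_def)
  thus "u \<in> L2 \<Omega>" "gradc \<Omega> i u \<in> L2 \<Omega>" "is_weak_grad \<Omega> u (weak_grad \<Omega> u)"
    using H1_I(2) someI[of "is_weak_grad \<Omega> u" G] by (auto simp: weak_grad_def)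
qed

lemma grad_inner_eq:
  assumes "u \<in> H1 \<Omega>" "v \<in> H1 \<Omega>"
  shows "grad_inner \<Omega> u v = (\<Sum>i\<in>UNIV. L2_inner \<Omega> (gradc \<Omega> i u) (gradc \<Omega> i v))"
  unfolding grad_inner_def using H1_D(2)[OF assms(1)] H1_D(2)[OF assms(2)]
  by (subst L2_inner_vec) (auto simp: gradc_def[abs_def])

text \<open>The product \<open>F (\<phi>) \<psi>\<close> is again C^1 with compact support, so each
  of its partial derivatives has integral zero. With \<open>F\<close> the identity this identifies
  weak gradients of test functions; with \<open>F\<close> the flux it handles the convective
  term.\<close>

lemma C1_integration_by_parts:
  assumes \<phi>: "\<phi> \<in> C1_compact \<Omega>" and \<psi>: "\<psi> \<in> C1_compact \<Omega>"
    and F: "\<And>s. (F has_real_derivative F' s) (at s)" "continuous_on UNIV F'"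
  shows "(\<integral>x. F (\<phi> x) * partial_deriv i \<psi> x \<partial>lebesgue_on \<Omega>)
    = - (\<integral>x. F' (\<phi> x) * partial_deriv i \<phi> x * \<psi> x \<partial>lebesgue_on \<Omega>)"
proof -
  note C = C1_compact_mult_compose[OF \<phi> \<psi> F]
  have Fc: "continuous_on UNIV F"
    using F(1) by (auto intro!: DERIV_continuous simp: continuous_on_eq_continuous_at)
  have c: "continuous_on UNIV (\<lambda>x. F (\<phi> x))" "continuous_on UNIV (\<lambda>x. F' (\<phi> x))"
    using C1_compact_continuous[OF \<phi>, of UNIV]
    by (auto intro: continuous_on_compose2[OF Fc] continuous_on_compose2[OF F(2)])
  obtain K where K: "compact K" "K \<subseteq> \<Omega>" "\<And>x. x \<notin> K \<Longrightarrow> \<psi> x = 0" "\<And>x i. x \<notin> K \<Longrightarrow> partial_deriv i \<psi> x = 0"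
    using C1_compact_support[OF \<psi>] by metis
  have eq: "integrable lborel f \<and> (\<integral>x. f x \<partial>lebesgue_on \<Omega>) = (\<integral>x. f x \<partial>lborel)"
    if "continuous_on UNIV f" "\<And>x. x \<notin> K \<Longrightarrow> f x = 0" for f :: "real^2 \<Rightarrow> real"
    using integrable_continuous_compact_support[OF that(1) K(1) that(2)] that K(2)
    by (auto intro!: lebesgue_on_eq_lborel(2) b\<Omega> borel_measurable_continuous_onI)
  have 1: "integrable lborel (\<lambda>x. F (\<phi> x) * partial_deriv i \<psi> x) \<and>
      (\<integral>x. F (\<phi> x) * partial_deriv i \<psi> x \<partial>lebesgue_on \<Omega>) = (\<integral>x. F (\<phi> x) * partial_deriv i \<psi> x \<partial>lborel)"
    using K by (intro eq continuous_intros c C1_compact_continuous_partial[OF \<psi>]) auto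
  have 2: "integrable lborel (\<lambda>x. F' (\<phi> x) * partial_deriv i \<phi> x * \<psi> x) \<and>
      (\<integral>x. F' (\<phi> x) * partial_deriv i \<phi> x * \<psi> x \<partial>lebesgue_on \<Omega>) = (\<integral>x. F' (\<phi> x) * partial_deriv i \<phi> x * \<psi> x \<partial>lborel)"
    using K by (intro eq continuous_intros c C1_compact_continuous_partial[OF \<phi>] C1_compact_continuous[OF \<psi>]) auto
  have "(\<integral>x. F (\<phi> x) * partial_deriv i \<psi> x + F' (\<phi> x) * partial_deriv i \<phi> x * \<psi> x \<partial>lborel) = 0"
    using integral_partial_deriv_zero[OF C(1), of i] unfolding C(2)[abs_def] .
  thus ?thesis using 1 2 by simp
qed

lemma test_weak_grad:
  assumes \<phi>: "\<phi> \<in> test_functions \<Omega>"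
  shows "is_weak_grad \<Omega> \<phi> (\<lambda>x. \<chi> i. partial_deriv i \<phi> x)"
  unfolding is_weak_grad_def
proof (intro conjI allI ballI)
  fix i \<psi> assume \<psi>: "\<psi> \<in> test_functions \<Omega>"
  have "(\<integral>x. \<phi> x * partial_deriv i \<psi> x \<partial>lebesgue_on \<Omega>) = - (\<integral>x. 1 * partial_deriv i \<phi> x * \<psi> x \<partial>lebesgue_on \<Omega>)"
    by (rule C1_integration_by_parts[OF test_functions_C1[OF \<phi>] test_functions_C1[OF \<psi>], where F = "\<lambda>s. s"])
       auto
  thus "(\<integral>x. \<phi> x * partial_deriv i \<psi> x \<partial>lebesgue_on \<Omega>) = - (\<integral>x. (\<chi> i. partial_deriv i \<phi> x) $ i * \<psi> x \<partial>lebesgue_on \<Omega>)"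
    by simp
qed (use test_partial_L2[OF \<phi>] in simp)

lemma is_weak_grad_add:
  assumes u: "u \<in> L2 \<Omega>" "is_weak_grad \<Omega> u G" and v: "v \<in> L2 \<Omega>" "is_weak_grad \<Omega> v H"
  shows "is_weak_grad \<Omega> (\<lambda>x. u x + v x) (\<lambda>x. G x + H x)"
  unfolding is_weak_grad_def
proof (intro conjI allI ballI)
  fix i
  have L: "(\<lambda>x. G x $ i) \<in> L2 \<Omega>" "(\<lambda>x. H x $ i) \<in> L2 \<Omega>"
    using u v by (auto simp: is_weak_grad_def)
  show "(\<lambda>x. (G x + H x) $ i) \<in> L2 \<Omega>" using L2.add_mem[OF L] by simp
  fix \<phi> assume \<phi>: "\<phi> \<in> test_functions \<Omega>"
  show "(\<integral>x. (u x + v x) * partial_deriv i \<phi> x \<partial>lebesgue_on \<Omega>) = - (\<integral>x. (G x + H x) $ i * \<phi> x \<partial>lebesgue_on \<Omega>)"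
    using u v \<phi> L L2_mult_integrable test_L2[OF \<phi>] test_partial_L2[OF \<phi>]
    by (simp add: distrib_right is_weak_grad_def)
qed

lemma is_weak_grad_scale:
  assumes u: "u \<in> L2 \<Omega>" "is_weak_grad \<Omega> u G"
  shows "is_weak_grad \<Omega> (\<lambda>x. c * u x) (\<lambda>x. c *\<^sub>R G x)"
  using u L2.scale_mem[of _ \<Omega> c] by (simp add: is_weak_grad_def mult.assoc)

lemma is_weak_grad_diff:
  assumes u: "u \<in> L2 \<Omega>" "is_weak_grad \<Omega> u G" and v: "v \<in> L2 \<Omega>" "is_weak_grad \<Omega> v H"
  shows "is_weak_grad \<Omega> (\<lambda>x. u x - v x) (\<lambda>x. G x - H x)"
  using is_weak_grad_add[OF u L2.scale_mem[OF v(1), of "-1"] is_weak_grad_scale[OF v, of "-1"]] by simp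

lemma H10_H1: "u \<in> H10 \<Omega> \<Longrightarrow> u \<in> H1 \<Omega>" by (simp add: H10_def)

lemma H10_L2: "u \<in> H10 \<Omega> \<Longrightarrow> u \<in> L2 \<Omega>"
  and H10_gradc_L2: "u \<in> H10 \<Omega> \<Longrightarrow> gradc \<Omega> i u \<in> L2 \<Omega>"
  using H1_D H10_H1 by blast+

text \<open>Replaces the chosen gradient hidden in \<open>H1_norm\<close> by any weak gradient
  \<open>G\<close>, so that convergence in \<open>H10\<close> can be read off from componentwise L^2
  distances.\<close>

lemma H1_norm_diff_eq:
  assumes \<phi>: "\<phi> \<in> test_functions \<Omega>" and u: "u \<in> L2 \<Omega>" "is_weak_grad \<Omega> u G"
  shows "(H1_norm \<Omega> (\<lambda>x. \<phi> x - u x))\<^sup>2 =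
    (L2.nrm \<Omega> (\<lambda>x. \<phi> x - u x))\<^sup>2 + (\<Sum>i\<in>UNIV. (L2.nrm \<Omega> (\<lambda>x. partial_deriv i \<phi> x - G x $ i))\<^sup>2)"
    and "H1_norm \<Omega> (\<lambda>x. \<phi> x - u x) \<ge> 0"
proof -
  have GL: "(\<lambda>x. G x $ i) \<in> L2 \<Omega>" for i using u(2) by (auto simp: is_weak_grad_def)
  have d: "(\<lambda>x. \<phi> x - u x) \<in> L2 \<Omega>" using L2.diff_mem[OF test_L2[OF \<phi>] u(1)] .
  note w = H1_I[OF d is_weak_grad_diff[OF test_L2[OF \<phi>] test_weak_grad[OF \<phi>] u]]
  have dG: "(\<lambda>x. partial_deriv i \<phi> x - G x $ i) \<in> L2 \<Omega>" for i
    using L2.diff_mem[OF test_partial_L2[OF \<phi>] GL] .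
  have "grad_inner \<Omega> (\<lambda>x. \<phi> x - u x) (\<lambda>x. \<phi> x - u x)
      = (\<Sum>i\<in>UNIV. L2_inner \<Omega> (\<lambda>x. partial_deriv i \<phi> x - G x $ i) (\<lambda>x. partial_deriv i \<phi> x - G x $ i))"
    unfolding grad_inner_eq[OF w(1) w(1)] using w(3)
    by (intro sum.cong refl L2_inner_cong_AE w(2) dG) simp_all
  also have "\<dots> = (\<Sum>i\<in>UNIV. (L2.nrm \<Omega> (\<lambda>x. partial_deriv i \<phi> x - G x $ i))\<^sup>2)"
    by (simp add: L2.nrm_power2[OF dG])
  finally have g: "grad_inner \<Omega> (\<lambda>x. \<phi> x - u x) (\<lambda>x. \<phi> x - u x)
      = (\<Sum>i\<in>UNIV. (L2.nrm \<Omega> (\<lambda>x. partial_deriv i \<phi> x - G x $ i))\<^sup>2)" .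
  have p: "0 \<le> L2_inner \<Omega> (\<lambda>x. \<phi> x - u x) (\<lambda>x. \<phi> x - u x) + grad_inner \<Omega> (\<lambda>x. \<phi> x - u x) (\<lambda>x. \<phi> x - u x)"
    unfolding g by (intro add_nonneg_nonneg L2.ip_ge0 d sum_nonneg) simp
  show "(H1_norm \<Omega> (\<lambda>x. \<phi> x - u x))\<^sup>2 =
    (L2.nrm \<Omega> (\<lambda>x. \<phi> x - u x))\<^sup>2 + (\<Sum>i\<in>UNIV. (L2.nrm \<Omega> (\<lambda>x. partial_deriv i \<phi> x - G x $ i))\<^sup>2)"
    unfolding g[symmetric] L2.nrm_power2[OF d] H1_norm_def grad_inner_def[symmetric] using p by simp
  show "H1_norm \<Omega> (\<lambda>x. \<phi> x - u x) \<ge> 0"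
    using p by (simp add: H1_norm_def grad_inner_def)
qed

lemma H10_approx:
  assumes u: "u \<in> H10 \<Omega>"
  shows "\<exists>\<phi>::nat \<Rightarrow> real^2 \<Rightarrow> real. (\<forall>n. \<phi> n \<in> test_functions \<Omega>) \<and>
    (\<lambda>n. L2.nrm \<Omega> (\<lambda>x. \<phi> n x - u x)) \<longlonglongrightarrow> 0 \<and>
    (\<forall>i. (\<lambda>n. L2.nrm \<Omega> (\<lambda>x. partial_deriv i (\<phi> n) x - gradc \<Omega> i u x)) \<longlonglongrightarrow> 0)"
proof -
  obtain \<phi> :: "nat \<Rightarrow> real^2 \<Rightarrow> real" where \<phi>: "\<And>n. \<phi> n \<in> test_functions \<Omega>"
    and lim: "(\<lambda>n. H1_norm \<Omega> (\<lambda>x. \<phi> n x - u x)) \<longlonglongrightarrow> 0"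
    using u by (auto simp: H10_def)
  note e = H1_norm_diff_eq[OF \<phi> H10_L2[OF u] H1_D(3)[OF H10_H1[OF u]]]
  note g = H10_gradc_L2[OF u]
  have le0: "L2.nrm \<Omega> (\<lambda>x. \<phi> n x - u x) \<le> H1_norm \<Omega> (\<lambda>x. \<phi> n x - u x)" for n
    by (rule power2_le_imp_le[OF _ e(2)]) (simp add: e(1) sum_nonneg)
  have lei: "L2.nrm \<Omega> (\<lambda>x. partial_deriv i (\<phi> n) x - gradc \<Omega> i u x) \<le> H1_norm \<Omega> (\<lambda>x. \<phi> n x - u x)" for n i
  proof (rule power2_le_imp_le[OF _ e(2)])
    have "(L2.nrm \<Omega> (\<lambda>x. partial_deriv i (\<phi> n) x - gradc \<Omega> i u x))\<^sup>2
        \<le> (\<Sum>i\<in>UNIV. (L2.nrm \<Omega> (\<lambda>x. partial_deriv i (\<phi> n) x - gradc \<Omega> i u x))\<^sup>2)"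
      by (intro member_le_sum) auto
    thus "(L2.nrm \<Omega> (\<lambda>x. partial_deriv i (\<phi> n) x - gradc \<Omega> i u x))\<^sup>2 \<le> (H1_norm \<Omega> (\<lambda>x. \<phi> n x - u x))\<^sup>2"
      unfolding e(1) gradc_def by (simp add: add_increasing)
  qed
  have "(\<lambda>n. L2.nrm \<Omega> (\<lambda>x. \<phi> n x - u x)) \<longlonglongrightarrow> 0"
    by (rule tendsto_sandwich[OF _ _ tendsto_const lim])
       (intro always_eventually allI le0 L2.nrm_ge0 L2.diff_mem[OF test_L2[OF \<phi>] H10_L2[OF u]])+
  moreover have "(\<lambda>n. L2.nrm \<Omega> (\<lambda>x. partial_deriv i (\<phi> n) x - gradc \<Omega> i u x)) \<longlonglongrightarrow> 0" for i
    by (rule tendsto_sandwich[OF _ _ tendsto_const lim])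
       (intro always_eventually allI lei L2.nrm_ge0 L2.diff_mem[OF test_partial_L2[OF \<phi>] g])+
  ultimately show ?thesis using \<phi> by blast
qed

text \<open>The defining identity of a weak gradient consists of L^2 pairings with fixed functions,
  so it survives L^2 limits: the limits of the partial derivatives are automatically the weak
  gradient. In this way closedness of \<open>H10\<close> is reduced to convergence of scalar
  functions.\<close>

lemma H10_I:
  assumes \<phi>: "\<And>n::nat. \<phi> n \<in> test_functions \<Omega>" and u: "u \<in> L2 \<Omega>" and G: "\<And>i. G i \<in> L2 \<Omega>"
    and lim0: "(\<lambda>n. L2.nrm \<Omega> (\<lambda>x. \<phi> n x - u x)) \<longlonglongrightarrow> 0"
    and lim1: "\<And>i. (\<lambda>n. L2.nrm \<Omega> (\<lambda>x. partial_deriv i (\<phi> n) x - G i x)) \<longlonglongrightarrow> 0"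
  shows "u \<in> H10 \<Omega>" "AE x in lebesgue_on \<Omega>. gradc \<Omega> i u x = G i x"
proof -
  define H :: "real^2 \<Rightarrow> real^2" where "H x = (\<chi> i. G i x)" for x
  have wg: "is_weak_grad \<Omega> u H"
    unfolding is_weak_grad_def
  proof (intro conjI allI ballI)
    show "(\<lambda>x. H x $ i) \<in> L2 \<Omega>" for i using G by (simp add: H_def)
    fix i \<psi> assume \<psi>: "\<psi> \<in> test_functions \<Omega>"
    have c: "(\<lambda>n. L2.nrm \<Omega> (\<lambda>x. v x - v x)) \<longlonglongrightarrow> 0" for v :: "real^2 \<Rightarrow> real" by (simp add: L2.nrm_zero)
    have "(\<lambda>n. L2_inner \<Omega> (\<phi> n) (partial_deriv i \<psi>)) \<longlonglongrightarrow> L2_inner \<Omega> u (partial_deriv i \<psi>)"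
      by (rule L2.ip_tendsto[OF test_L2[OF \<phi>] u lim0 _ _ c]) (rule test_partial_L2[OF \<psi>])+
    moreover have "L2_inner \<Omega> (\<phi> n) (partial_deriv i \<psi>) = - L2_inner \<Omega> (partial_deriv i (\<phi> n)) \<psi>" for n
      using test_weak_grad[OF \<phi>] \<psi> by (simp add: is_weak_grad_def L2_inner_def)
    moreover have "(\<lambda>n. - L2_inner \<Omega> (partial_deriv i (\<phi> n)) \<psi>) \<longlonglongrightarrow> - L2_inner \<Omega> (G i) \<psi>"
      by (intro tendsto_minus L2.ip_tendsto[OF test_partial_L2[OF \<phi>] G lim1 _ _ c]) (rule test_L2[OF \<psi>])+
    ultimately have "L2_inner \<Omega> u (partial_deriv i \<psi>) = - L2_inner \<Omega> (G i) \<psi>"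
      using LIMSEQ_unique by fastforce
    thus "(\<integral>x. u x * partial_deriv i \<psi> x \<partial>lebesgue_on \<Omega>) = - (\<integral>x. H x $ i * \<psi> x \<partial>lebesgue_on \<Omega>)"
      by (simp add: L2_inner_def H_def)
  qed
  note w = H1_I[OF u wg]
  show "AE x in lebesgue_on \<Omega>. gradc \<Omega> i u x = G i x" using w(3)[of i] by (simp add: H_def)
  have "(\<lambda>n. (H1_norm \<Omega> (\<lambda>x. \<phi> n x - u x))\<^sup>2) \<longlonglongrightarrow> 0\<^sup>2 + (\<Sum>i\<in>(UNIV::2 set). 0\<^sup>2)"
    unfolding H1_norm_diff_eq(1)[OF \<phi> u wg] using lim1 unfolding H_def
    by (intro tendsto_intros lim0) simp
  hence "(\<lambda>n. sqrt ((H1_norm \<Omega> (\<lambda>x. \<phi> n x - u x))\<^sup>2)) \<longlonglongrightarrow> sqrt 0" by (intro tendsto_real_sqrt) simp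
  hence "(\<lambda>n. H1_norm \<Omega> (\<lambda>x. \<phi> n x - u x)) \<longlonglongrightarrow> 0"
    using H1_norm_diff_eq(2)[OF \<phi> u wg] by simp
  thus "u \<in> H10 \<Omega>" using w(1) \<phi> by (auto simp: H10_def)
qed

lemma test_H10:
  assumes \<phi>: "\<phi> \<in> test_functions \<Omega>"
  shows "\<phi> \<in> H10 \<Omega>" "AE x in lebesgue_on \<Omega>. gradc \<Omega> i \<phi> x = partial_deriv i \<phi> x"
  by (rule H10_I[where \<phi> = "\<lambda>_. \<phi>" and G = "\<lambda>i. partial_deriv i \<phi>"];
      use \<phi> test_L2 test_partial_L2 in \<open>simp add: L2.nrm_zero\<close>)+

text \<open>Linear combinations of the approximating test functions approximate. Two coefficients at
  once cover sums, differences and multiples.\<close>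

lemma H10_linear:
  assumes u: "u \<in> H10 \<Omega>" and v: "v \<in> H10 \<Omega>"
  shows "(\<lambda>x. a * u x + b * v x) \<in> H10 \<Omega>"
    and "AE x in lebesgue_on \<Omega>. gradc \<Omega> i (\<lambda>x. a * u x + b * v x) x = a * gradc \<Omega> i u x + b * gradc \<Omega> i v x"
proof -
  obtain \<phi> :: "nat \<Rightarrow> real^2 \<Rightarrow> real" where \<phi>: "\<And>n. \<phi> n \<in> test_functions \<Omega>"
    "(\<lambda>n. L2.nrm \<Omega> (\<lambda>x. \<phi> n x - u x)) \<longlonglongrightarrow> 0"
    "\<And>i. (\<lambda>n. L2.nrm \<Omega> (\<lambda>x. partial_deriv i (\<phi> n) x - gradc \<Omega> i u x)) \<longlonglongrightarrow> 0"
    using H10_approx[OF u] by blast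
  obtain \<psi> :: "nat \<Rightarrow> real^2 \<Rightarrow> real" where \<psi>: "\<And>n. \<psi> n \<in> test_functions \<Omega>"
    "(\<lambda>n. L2.nrm \<Omega> (\<lambda>x. \<psi> n x - v x)) \<longlonglongrightarrow> 0"
    "\<And>i. (\<lambda>n. L2.nrm \<Omega> (\<lambda>x. partial_deriv i (\<psi> n) x - gradc \<Omega> i v x)) \<longlonglongrightarrow> 0"
    using H10_approx[OF v] by blast
  have lim: "(\<lambda>n. L2.nrm \<Omega> (\<lambda>x. (a * p n x + b * q n x) - (a * f x + b * g x))) \<longlonglongrightarrow> 0"
    if "\<And>n. p n \<in> L2 \<Omega>" "\<And>n. q n \<in> L2 \<Omega>" "f \<in> L2 \<Omega>" "g \<in> L2 \<Omega>"
      "(\<lambda>n. L2.nrm \<Omega> (\<lambda>x. p n x - f x)) \<longlonglongrightarrow> 0" "(\<lambda>n. L2.nrm \<Omega> (\<lambda>x. q n x - g x)) \<longlonglongrightarrow> 0"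
    for p q :: "nat \<Rightarrow> real^2 \<Rightarrow> real" and f g
  proof (rule tendsto_sandwich[OF _ _ tendsto_const])
    show "(\<lambda>n. \<bar>a\<bar> * L2.nrm \<Omega> (\<lambda>x. p n x - f x) + \<bar>b\<bar> * L2.nrm \<Omega> (\<lambda>x. q n x - g x)) \<longlonglongrightarrow> 0"
      using tendsto_add[OF tendsto_mult_right_zero[OF that(5)] tendsto_mult_right_zero[OF that(6)]] by simp
    have m: "(\<lambda>x. p n x - f x) \<in> L2 \<Omega>" "(\<lambda>x. q n x - g x) \<in> L2 \<Omega>" for n using that by (auto intro: L2.diff_mem)
    have e: "(\<lambda>x. (a * p n x + b * q n x) - (a * f x + b * g x)) = (\<lambda>x. a * (p n x - f x) + b * (q n x - g x))" for n
      by (simp add: fun_eq_iff algebra_simps)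
    show "\<forall>\<^sub>F n in sequentially. L2.nrm \<Omega> (\<lambda>x. (a * p n x + b * q n x) - (a * f x + b * g x))
        \<le> \<bar>a\<bar> * L2.nrm \<Omega> (\<lambda>x. p n x - f x) + \<bar>b\<bar> * L2.nrm \<Omega> (\<lambda>x. q n x - g x)"
      unfolding e L2.nrm_scale[OF m(1), symmetric] L2.nrm_scale[OF m(2), symmetric]
      by (intro always_eventually allI L2.nrm_triangle L2.scale_mem m)
    show "\<forall>\<^sub>F n in sequentially. 0 \<le> L2.nrm \<Omega> (\<lambda>x. (a * p n x + b * q n x) - (a * f x + b * g x))"
      unfolding e by (intro always_eventually allI L2.nrm_ge0 L2.add_mem L2.scale_mem m)
  qed
  have pd: "partial_deriv i (\<lambda>x. a * \<phi> n x + b * \<psi> n x) x = a * partial_deriv i (\<phi> n) x + b * partial_deriv i (\<psi> n) x" for i n x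
  proof -
    have d: "\<phi> n differentiable at x" "\<psi> n differentiable at x"
      using \<phi>(1) \<psi>(1) C1_compact_differentiable[OF test_functions_C1] by blast+
    have "partial_deriv i (\<lambda>x. c * h x) x = c * partial_deriv i h x" if "h differentiable at x" for c h
      using partial_deriv_mult[OF _ that, of "\<lambda>_. c" i] by (simp add: partial_deriv_const)
    thus ?thesis using d by (subst partial_deriv_add) auto
  qed
  note L = test_L2[OF \<phi>(1)] test_L2[OF \<psi>(1)] H10_L2[OF u] H10_L2[OF v]
  note L' = test_partial_L2[OF \<phi>(1)] test_partial_L2[OF \<psi>(1)] H10_gradc_L2[OF u] H10_gradc_L2[OF v]
  have t: "(\<lambda>x. a * \<phi> n x + b * \<psi> n x) \<in> test_functions \<Omega>" for n
    by (intro test_functions_add test_functions_cmult \<phi> \<psi>)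
  have l0: "(\<lambda>n. L2.nrm \<Omega> (\<lambda>x. (a * \<phi> n x + b * \<psi> n x) - (a * u x + b * v x))) \<longlonglongrightarrow> 0"
    by (rule lim[OF L \<phi>(2) \<psi>(2)])
  have l1: "(\<lambda>n. L2.nrm \<Omega> (\<lambda>x. partial_deriv i (\<lambda>x. a * \<phi> n x + b * \<psi> n x) x
      - (a * gradc \<Omega> i u x + b * gradc \<Omega> i v x))) \<longlonglongrightarrow> 0" for i
    unfolding pd by (rule lim[OF L' \<phi>(3) \<psi>(3)])
  have m: "(\<lambda>x. a * u x + b * v x) \<in> L2 \<Omega>" "(\<lambda>x. a * gradc \<Omega> i u x + b * gradc \<Omega> i v x) \<in> L2 \<Omega>" for i
    using L(3,4) L'(3,4) by (auto intro!: L2.add_mem L2.scale_mem)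
  show "(\<lambda>x. a * u x + b * v x) \<in> H10 \<Omega>"
    "AE x in lebesgue_on \<Omega>. gradc \<Omega> i (\<lambda>x. a * u x + b * v x) x = a * gradc \<Omega> i u x + b * gradc \<Omega> i v x"
    using H10_I[where \<phi> = "\<lambda>n x. a * \<phi> n x + b * \<psi> n x" and G = "\<lambda>i x. a * gradc \<Omega> i u x + b * gradc \<Omega> i v x",
        OF t m l0 l1] by blast+
qed

lemma gradc_diff:
  assumes "u \<in> H10 \<Omega>" "v \<in> H10 \<Omega>"
  shows "AE x in lebesgue_on \<Omega>. gradc \<Omega> i (\<lambda>x. u x - v x) x = gradc \<Omega> i u x - gradc \<Omega> i v x"
  using H10_linear(2)[OF assms, of i 1 "-1"] by simp

lemma gradc_add:
  assumes "u \<in> H10 \<Omega>" "v \<in> H10 \<Omega>"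
  shows "AE x in lebesgue_on \<Omega>. gradc \<Omega> i (\<lambda>x. u x + v x) x = gradc \<Omega> i u x + gradc \<Omega> i v x"
  using H10_linear(2)[OF assms, of i 1 1] by simp

lemma gradc_scale:
  assumes "u \<in> H10 \<Omega>"
  shows "AE x in lebesgue_on \<Omega>. gradc \<Omega> i (\<lambda>x. c * u x) x = c * gradc \<Omega> i u x"
  using H10_linear(2)[OF assms assms, of i c 0] by simp

section \<open>Hilbert structure and Sobolev embedding of \<open>H10\<close>\<close>

lemma H10_semi_inner: "semi_inner_space (H10 \<Omega>) (grad_inner \<Omega>)"
proof
  show "(\<lambda>_. 0) \<in> H10 \<Omega>" using test_H10(1)[OF test_functions_zero] .
  show add: "(\<lambda>x. u x + v x) \<in> H10 \<Omega>" if "u \<in> H10 \<Omega>" "v \<in> H10 \<Omega>" for u v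
    using H10_linear(1)[OF that, of 1 1] by simp
  show scale: "(\<lambda>x. c * u x) \<in> H10 \<Omega>" if "u \<in> H10 \<Omega>" for u c
    using H10_linear(1)[OF that that, of c 0] by simp
  show "grad_inner \<Omega> (\<lambda>x. u x + v x) w = grad_inner \<Omega> u w + grad_inner \<Omega> v w"
    if "u \<in> H10 \<Omega>" "v \<in> H10 \<Omega>" "w \<in> H10 \<Omega>" for u v w
  proof -
    note L = that[THEN H10_gradc_L2] H10_gradc_L2[OF add[OF that(1,2)]]
    have "L2_inner \<Omega> (gradc \<Omega> i (\<lambda>x. u x + v x)) (gradc \<Omega> i w)
        = L2_inner \<Omega> (\<lambda>x. gradc \<Omega> i u x + gradc \<Omega> i v x) (gradc \<Omega> i w)" for i
      by (intro L2_inner_cong_AE gradc_add that L L2.add_mem) simp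
    thus ?thesis
      using that L by (simp add: grad_inner_eq H10_H1 add L2.ip_add sum.distrib)
  qed
  show "grad_inner \<Omega> (\<lambda>x. c * u x) w = c * grad_inner \<Omega> u w"
    if "u \<in> H10 \<Omega>" "w \<in> H10 \<Omega>" for u w c
  proof -
    note L = that[THEN H10_gradc_L2] H10_gradc_L2[OF scale[OF that(1)]]
    have "L2_inner \<Omega> (gradc \<Omega> i (\<lambda>x. c * u x)) (gradc \<Omega> i w)
        = L2_inner \<Omega> (\<lambda>x. c * gradc \<Omega> i u x) (gradc \<Omega> i w)" for i
      by (intro L2_inner_cong_AE gradc_scale that L L2.scale_mem) simp
    thus ?thesis
      using that L by (simp add: grad_inner_eq H10_H1 scale L2.ip_scale sum_distrib_left)
  qed
  show "grad_inner \<Omega> u v = grad_inner \<Omega> v u" for u v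
    by (simp add: grad_inner_def L2_inner_def inner_commute)
  show "0 \<le> grad_inner \<Omega> u u" for u
    by (simp add: grad_inner_def L2_inner_def)
qed

lemma smooth_energy_tendsto:
  assumes u: "u \<in> H10 \<Omega>" and \<phi>: "\<And>n::nat. \<phi> n \<in> test_functions \<Omega>"
    and lim: "\<And>i. (\<lambda>n. L2.nrm \<Omega> (\<lambda>x. partial_deriv i (\<phi> n) x - gradc \<Omega> i u x)) \<longlonglongrightarrow> 0"
  shows "(\<lambda>n. smooth_energy \<Omega> (\<phi> n)) \<longlonglongrightarrow> grad_inner \<Omega> u u"
  unfolding smooth_energy_def grad_inner_eq[OF H10_H1[OF u] H10_H1[OF u]]
  by (intro tendsto_sum L2.ip_tendsto[OF test_partial_L2[OF \<phi>] H10_gradc_L2[OF u] lim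
        test_partial_L2[OF \<phi>] H10_gradc_L2[OF u] lim])

text \<open>A subsequence of the approximating test functions converges almost everywhere and their
  energies converge to that of \<open>u\<close>, so Fatou carries over the smooth inequality.
  Integrability of high powers is a conclusion, not an assumption.\<close>

lemma H10_sobolev:
  assumes u: "u \<in> H10 \<Omega>"
  shows "integrable (lebesgue_on \<Omega>) (\<lambda>x. u x ^ (2 * k))"
    and "(\<integral>x. u x ^ (2 * k) \<partial>lebesgue_on \<Omega>) \<le> (fact k)\<^sup>2 * measure lebesgue \<Omega> * grad_inner \<Omega> u u ^ k"
proof -
  interpret H: semi_inner_space "H10 \<Omega>" "grad_inner \<Omega>" by (rule H10_semi_inner)
  obtain \<phi> :: "nat \<Rightarrow> real^2 \<Rightarrow> real" where \<phi>: "\<And>n. \<phi> n \<in> test_functions \<Omega>"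
    "(\<lambda>n. L2.nrm \<Omega> (\<lambda>x. \<phi> n x - u x)) \<longlonglongrightarrow> 0"
    "\<And>i. (\<lambda>n. L2.nrm \<Omega> (\<lambda>x. partial_deriv i (\<phi> n) x - gradc \<Omega> i u x)) \<longlonglongrightarrow> 0"
    using H10_approx[OF u] by blast
  obtain r :: "nat \<Rightarrow> nat" where r: "strict_mono r"
    "AE x in lebesgue_on \<Omega>. (\<lambda>n. \<phi> (r n) x) \<longlonglongrightarrow> u x"
    using L2_AE_subseq[OF test_L2[OF \<phi>(1)] H10_L2[OF u] \<phi>(2)] by blast
  define c where "c = (fact k)\<^sup>2 * measure lebesgue \<Omega>"
  define E where "E = grad_inner \<Omega> u u"
  have c0: "c \<ge> 0" and E0: "E \<ge> 0" using H.ip_ge0[OF u] by (auto simp: c_def E_def)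
  have "(\<lambda>n. smooth_energy \<Omega> (\<phi> (r n))) \<longlonglongrightarrow> E"
    using LIMSEQ_subseq_LIMSEQ[OF smooth_energy_tendsto[OF u \<phi>(1) \<phi>(3)] r(1)] by (simp add: o_def E_def)
  hence lim: "(\<lambda>n. c * smooth_energy \<Omega> (\<phi> (r n)) ^ k) \<longlonglongrightarrow> c * E ^ k" by (intro tendsto_intros)
  have um: "u \<in> borel_measurable (lebesgue_on \<Omega>)" using L2_D(1)[OF H10_L2[OF u]] .
  \<comment> \<open>The energies of the approximations may exceed the limit, hence the slack
    \<open>e\<close>, which is removed afterwards.\<close>
  have "(\<integral>\<^sup>+x. ennreal (u x ^ (2 * k)) \<partial>lebesgue_on \<Omega>) \<le> ennreal (c * E ^ k) + ennreal e" if e: "e > 0" for e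
  proof (rule fatou_bound[where f = "\<lambda>n x. \<phi> (r n) x ^ (2 * k)"])
    show "(\<lambda>x. \<phi> (r n) x ^ (2 * k)) \<in> borel_measurable (lebesgue_on \<Omega>)" for n
      using L2_D(1)[OF test_L2[OF \<phi>(1)]] by measurable
    show "AE x in lebesgue_on \<Omega>. (\<lambda>n. \<phi> (r n) x ^ (2 * k)) \<longlonglongrightarrow> u x ^ (2 * k)"
      using r(2) by eventually_elim (intro tendsto_intros)
    have "\<forall>\<^sub>F n in sequentially. c * smooth_energy \<Omega> (\<phi> (r n)) ^ k < c * E ^ k + e"
      using lim e by (intro order_tendstoD) auto
    thus "\<forall>\<^sub>F n in sequentially. (\<integral>\<^sup>+x. ennreal (\<phi> (r n) x ^ (2 * k)) \<partial>lebesgue_on \<Omega>) \<le> ennreal (c * E ^ k) + ennreal e"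
    proof eventually_elim
      case (elim n)
      note C = test_functions_C1[OF \<phi>(1)[of "r n"]]
      have i: "integrable (lebesgue_on \<Omega>) (\<lambda>x. \<phi> (r n) x ^ (2 * k))"
        using L2_D(2)[OF C1_compact_power_L2[OF b\<Omega> C, of k]] by (simp add: power_mult[symmetric] mult.commute)
      have "(\<integral>\<^sup>+x. ennreal (\<phi> (r n) x ^ (2 * k)) \<partial>lebesgue_on \<Omega>) = ennreal (\<integral>x. \<phi> (r n) x ^ (2 * k) \<partial>lebesgue_on \<Omega>)"
        by (rule nn_integral_eq_integral[OF i]) (simp add: power_mult)
      also have "\<dots> \<le> ennreal (c * E ^ k + e)"
        using C1_compact_sobolev[OF b\<Omega> C, of k] elim by (intro ennreal_leI) (simp add: c_def)
      also have "\<dots> = ennreal (c * E ^ k) + ennreal e" using c0 E0 e by (intro ennreal_plus) auto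
      finally show ?case .
    qed
  qed
  hence le: "(\<integral>\<^sup>+x. ennreal (u x ^ (2 * k)) \<partial>lebesgue_on \<Omega>) \<le> ennreal (c * E ^ k)"
    by (rule ennreal_le_epsilon)
  have nn: "0 \<le> u x ^ (2 * k)" for x by (simp add: power_mult)
  show i: "integrable (lebesgue_on \<Omega>) (\<lambda>x. u x ^ (2 * k))"
    by (rule integrableI_nonneg) (use um nn le in \<open>auto intro: le_less_trans\<close>)
  have "(\<integral>x. u x ^ (2 * k) \<partial>lebesgue_on \<Omega>) \<le> c * E ^ k"
    using le nn c0 E0 by (subst (asm) nn_integral_eq_integral[OF i]) auto
  thus "(\<integral>x. u x ^ (2 * k) \<partial>lebesgue_on \<Omega>) \<le> (fact k)\<^sup>2 * measure lebesgue \<Omega> * grad_inner \<Omega> u u ^ k"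
    by (simp add: c_def E_def)
qed

lemma H10_poincare: "u \<in> H10 \<Omega> \<Longrightarrow> L2_inner \<Omega> u u \<le> measure lebesgue \<Omega> * grad_inner \<Omega> u u"
  using H10_sobolev(2)[of u 1] by (simp add: L2_inner_def power2_eq_square)

text \<open>By the Poincare inequality a Cauchy sequence in the Dirichlet seminorm is Cauchy in L^2,
  and so are its gradient components. The limits belong to \<open>H10\<close> because test functions
  approximating the individual terms approximate the limit along a diagonal.\<close>

lemma H10_semi_hilbert: "semi_hilbert_space (H10 \<Omega>) (grad_inner \<Omega>)"
proof -
  interpret H: semi_inner_space "H10 \<Omega>" "grad_inner \<Omega>" by (rule H10_semi_inner)
  show ?thesis
  proof
    fix X :: "nat \<Rightarrow> real^2 \<Rightarrow> real"
    assume X: "\<And>n. X n \<in> H10 \<Omega>"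
      and cauchy: "\<And>e. e > 0 \<Longrightarrow> \<exists>N. \<forall>m\<ge>N. \<forall>n\<ge>N. H.nrm (\<lambda>x. X m x - X n x) < e"
    note XL = H10_L2[OF X] and XG = H10_gradc_L2[OF X]
    have nrm_comp: "L2.nrm \<Omega> (gradc \<Omega> i w) \<le> H.nrm w" if w: "w \<in> H10 \<Omega>" for i w
    proof (rule power2_le_imp_le[OF _ H.nrm_ge0[OF w]])
      show "(L2.nrm \<Omega> (gradc \<Omega> i w))\<^sup>2 \<le> (H.nrm w)\<^sup>2"
        unfolding H.nrm_power2[OF w] L2.nrm_power2[OF H10_gradc_L2[OF w]] grad_inner_eq[OF H10_H1[OF w] H10_H1[OF w]]
        using H10_gradc_L2[OF w] by (intro member_le_sum L2.ip_ge0) auto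
    qed
    have comp: "L2.nrm \<Omega> (\<lambda>x. gradc \<Omega> i u x - gradc \<Omega> i v x) \<le> H.nrm (\<lambda>x. u x - v x)"
      if "u \<in> H10 \<Omega>" "v \<in> H10 \<Omega>" for i u v
      using nrm_comp[OF H.diff_mem[OF that], of i]
        L2_nrm_cong_AE[OF H10_gradc_L2[OF H.diff_mem[OF that]] L2.diff_mem[OF that[THEN H10_gradc_L2]] gradc_diff[OF that]]
      by simp
    have poin: "L2.nrm \<Omega> w \<le> sqrt (measure lebesgue \<Omega>) * H.nrm w" if "w \<in> H10 \<Omega>" for w
      unfolding L2.nrm_def H.nrm_def real_sqrt_mult[symmetric] by (intro real_sqrt_le_mono H10_poincare that)
    \<comment> \<open>The added 1 keeps e / s meaningful when \<open>\<Omega>\<close> has measure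
      zero.\<close>
    define s where "s = sqrt (measure lebesgue \<Omega>) + 1"
    have s: "s > 0" unfolding s_def by (simp add: add_nonneg_pos)
    have "\<exists>u\<in>L2 \<Omega>. (\<lambda>n. L2.nrm \<Omega> (\<lambda>x. X n x - u x)) \<longlonglongrightarrow> 0"
    proof (rule L2_complete[OF b\<Omega> XL])
      fix e :: real assume e: "e > 0"
      obtain N where N: "\<forall>m\<ge>N. \<forall>n\<ge>N. H.nrm (\<lambda>x. X m x - X n x) < e / s"
        using cauchy[of "e / s"] e s by auto
      have "L2.nrm \<Omega> (\<lambda>x. X m x - X n x) < e" if "m \<ge> N" "n \<ge> N" for m n
      proof -
        have "L2.nrm \<Omega> (\<lambda>x. X m x - X n x) \<le> sqrt (measure lebesgue \<Omega>) * H.nrm (\<lambda>x. X m x - X n x)"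
          by (intro poin H.diff_mem X)
        also have "\<dots> \<le> s * H.nrm (\<lambda>x. X m x - X n x)"
          unfolding s_def by (intro mult_right_mono H.nrm_ge0 H.diff_mem X) simp
        also have "\<dots> < s * (e / s)" using N that s by (intro mult_strict_left_mono) auto
        finally show ?thesis using s by simp
      qed
      thus "\<exists>N. \<forall>m\<ge>N. \<forall>n\<ge>N. L2.nrm \<Omega> (\<lambda>x. X m x - X n x) < e" by blast
    qed
    then obtain u where u: "u \<in> L2 \<Omega>" "(\<lambda>n. L2.nrm \<Omega> (\<lambda>x. X n x - u x)) \<longlonglongrightarrow> 0" by blast
    have "\<exists>g\<in>L2 \<Omega>. (\<lambda>n. L2.nrm \<Omega> (\<lambda>x. gradc \<Omega> i (X n) x - g x)) \<longlonglongrightarrow> 0" for i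
    proof (rule L2_complete[OF b\<Omega> XG])
      fix e :: real assume "e > 0"
      then obtain N where "\<forall>m\<ge>N. \<forall>n\<ge>N. H.nrm (\<lambda>x. X m x - X n x) < e" using cauchy by blast
      thus "\<exists>N. \<forall>m\<ge>N. \<forall>n\<ge>N. L2.nrm \<Omega> (\<lambda>x. gradc \<Omega> i (X m) x - gradc \<Omega> i (X n) x) < e"
        by (intro exI[of _ N] allI impI le_less_trans[OF comp[OF X X]]) simp
    qed
    hence "\<forall>i. \<exists>g. g \<in> L2 \<Omega> \<and> (\<lambda>n. L2.nrm \<Omega> (\<lambda>x. gradc \<Omega> i (X n) x - g x)) \<longlonglongrightarrow> 0" by blast
    from choice[OF this] obtain G where G: "\<And>i. G i \<in> L2 \<Omega>"
      "\<And>i. (\<lambda>n. L2.nrm \<Omega> (\<lambda>x. gradc \<Omega> i (X n) x - G i x)) \<longlonglongrightarrow> 0" by blast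
    \<comment> \<open>Diagonal choice: the n-th test function lies within 1 / (n + 1) of the n-th
      term, in L^2 and in both derivatives simultaneously.\<close>
    have "\<exists>\<phi>. \<phi> \<in> test_functions \<Omega> \<and> L2.nrm \<Omega> (\<lambda>x. \<phi> x - X n x) < 1 / real (Suc n) \<and>
        (\<forall>i. L2.nrm \<Omega> (\<lambda>x. partial_deriv i \<phi> x - gradc \<Omega> i (X n) x) < 1 / real (Suc n))" for n
    proof -
      obtain \<phi> :: "nat \<Rightarrow> real^2 \<Rightarrow> real" where \<phi>: "\<And>k. \<phi> k \<in> test_functions \<Omega>"
        "(\<lambda>k. L2.nrm \<Omega> (\<lambda>x. \<phi> k x - X n x)) \<longlonglongrightarrow> 0"
        "\<And>i. (\<lambda>k. L2.nrm \<Omega> (\<lambda>x. partial_deriv i (\<phi> k) x - gradc \<Omega> i (X n) x)) \<longlonglongrightarrow> 0"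
        using H10_approx[OF X] by blast
      have p: "0 < 1 / real (Suc n)" by simp
      have "\<forall>\<^sub>F k in sequentially. L2.nrm \<Omega> (\<lambda>x. \<phi> k x - X n x) < 1 / real (Suc n) \<and>
          (\<forall>i. L2.nrm \<Omega> (\<lambda>x. partial_deriv i (\<phi> k) x - gradc \<Omega> i (X n) x) < 1 / real (Suc n))"
        using order_tendstoD(2)[OF \<phi>(2) p] order_tendstoD(2)[OF \<phi>(3) p]
        by (intro eventually_conj eventually_all_finite) auto
      thus ?thesis using \<phi>(1) eventually_happens'[OF sequentially_bot] by blast
    qed
    hence "\<forall>n. \<exists>\<phi>. \<phi> \<in> test_functions \<Omega> \<and> L2.nrm \<Omega> (\<lambda>x. \<phi> x - X n x) < 1 / real (Suc n) \<and>
        (\<forall>i. L2.nrm \<Omega> (\<lambda>x. partial_deriv i \<phi> x - gradc \<Omega> i (X n) x) < 1 / real (Suc n))" by blast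
    from choice[OF this] obtain \<phi> where \<phi>: "\<And>n. \<phi> n \<in> test_functions \<Omega>"
      "\<And>n. L2.nrm \<Omega> (\<lambda>x. \<phi> n x - X n x) < 1 / real (Suc n)"
      "\<And>n i. L2.nrm \<Omega> (\<lambda>x. partial_deriv i (\<phi> n) x - gradc \<Omega> i (X n) x) < 1 / real (Suc n)" by blast
    have inv0: "(\<lambda>n. 1 / real (Suc n)) \<longlonglongrightarrow> 0" by (rule LIMSEQ_Suc[OF lim_1_over_n])
    have diag: "(\<lambda>n. L2.nrm \<Omega> (\<lambda>x. p n x - f x)) \<longlonglongrightarrow> 0"
      if "\<And>n. p n \<in> L2 \<Omega>" "\<And>n. q n \<in> L2 \<Omega>" "f \<in> L2 \<Omega>" "\<And>n. L2.nrm \<Omega> (\<lambda>x. p n x - q n x) < 1 / real (Suc n)"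
        "(\<lambda>n. L2.nrm \<Omega> (\<lambda>x. q n x - f x)) \<longlonglongrightarrow> 0" for p q :: "nat \<Rightarrow> real^2 \<Rightarrow> real" and f
    proof (rule tendsto_sandwich[OF _ _ tendsto_const])
      show "(\<lambda>n. 1 / real (Suc n) + L2.nrm \<Omega> (\<lambda>x. q n x - f x)) \<longlonglongrightarrow> 0"
        using tendsto_add[OF inv0 that(5)] by simp
      show "\<forall>\<^sub>F n in sequentially. L2.nrm \<Omega> (\<lambda>x. p n x - f x) \<le> 1 / real (Suc n) + L2.nrm \<Omega> (\<lambda>x. q n x - f x)"
      proof (intro always_eventually allI)
        fix n show "L2.nrm \<Omega> (\<lambda>x. p n x - f x) \<le> 1 / real (Suc n) + L2.nrm \<Omega> (\<lambda>x. q n x - f x)"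
          using L2.nrm_diff_triangle[OF that(1)[of n] that(2)[of n] that(3)] that(4)[of n] by linarith
      qed
      show "\<forall>\<^sub>F n in sequentially. 0 \<le> L2.nrm \<Omega> (\<lambda>x. p n x - f x)"
        by (intro always_eventually allI L2.nrm_ge0 L2.diff_mem that)
    qed
    have u10: "u \<in> H10 \<Omega>" and ug: "\<And>i. AE x in lebesgue_on \<Omega>. gradc \<Omega> i u x = G i x"
      using H10_I[OF \<phi>(1) u(1) G(1) diag[OF test_L2[OF \<phi>(1)] XL u(1) \<phi>(2) u(2)]
          diag[OF test_partial_L2[OF \<phi>(1)] XG G(1) \<phi>(3) G(2)]] by blast+
    have dm: "(\<lambda>x. X n x - u x) \<in> H10 \<Omega>" for n using H.diff_mem[OF X u10] .
    have eqG: "L2_inner \<Omega> (gradc \<Omega> i (\<lambda>x. X n x - u x)) (gradc \<Omega> i (\<lambda>x. X n x - u x))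
        = (L2.nrm \<Omega> (\<lambda>x. gradc \<Omega> i (X n) x - G i x))\<^sup>2" for n i
    proof -
      have m: "(\<lambda>x. gradc \<Omega> i (X n) x - G i x) \<in> L2 \<Omega>" using L2.diff_mem[OF XG G(1)] .
      have "AE x in lebesgue_on \<Omega>. gradc \<Omega> i (\<lambda>x. X n x - u x) x = gradc \<Omega> i (X n) x - G i x"
        using gradc_diff[OF X u10, of i n] ug[of i] by eventually_elim simp
      thus ?thesis unfolding L2.nrm_power2[OF m] using H10_gradc_L2[OF dm] m by (intro L2_inner_cong_AE)
    qed
    have "(\<lambda>n. \<Sum>i\<in>(UNIV::2 set). (L2.nrm \<Omega> (\<lambda>x. gradc \<Omega> i (X n) x - G i x))\<^sup>2) \<longlonglongrightarrow> (\<Sum>i\<in>(UNIV::2 set). 0\<^sup>2)"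
      by (intro tendsto_intros G(2))
    hence "(\<lambda>n. sqrt (grad_inner \<Omega> (\<lambda>x. X n x - u x) (\<lambda>x. X n x - u x))) \<longlonglongrightarrow> sqrt 0"
      unfolding grad_inner_eq[OF H10_H1[OF dm] H10_H1[OF dm]] eqG by (intro tendsto_real_sqrt) simp
    hence "(\<lambda>n. H.nrm (\<lambda>x. X n x - u x)) \<longlonglongrightarrow> 0" by (simp add: H.nrm_def)
    thus "\<exists>u\<in>H10 \<Omega>. (\<lambda>n. H.nrm (\<lambda>x. X n x - u x)) \<longlonglongrightarrow> 0" using u10 by blast
  qed
qed

end

sublocale bounded_open_domain \<subseteq> H: semi_hilbert_space "H10 \<Omega>" "grad_inner \<Omega>"
  by (rule H10_semi_hilbert)

section \<open>Compactness and the first eigenvalue\<close>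

context bounded_open_domain
begin

text \<open>The grid inequality in the limit of test functions. The functionals are pairings with
  indicators of the squares, bounded by Cauchy-Schwarz and Poincare; the form matches the hypothesis
  of \<open>rayleigh_minimizer\<close>.\<close>

lemma H10_compactness:
  assumes \<epsilon>: "\<epsilon> > 0"
  shows "\<exists>S K. finite S \<and>
        (\<forall>l\<in>S. \<forall>u\<in>H10 \<Omega>. \<forall>v\<in>H10 \<Omega>. l (\<lambda>x. u x - v x) = l u - l v) \<and>
        (\<forall>l\<in>S. \<exists>D. \<forall>v\<in>H10 \<Omega>. \<bar>l v\<bar> \<le> D * H.nrm v) \<and>
        (\<forall>v\<in>H10 \<Omega>. L2_inner \<Omega> v v \<le> \<epsilon> * grad_inner \<Omega> v v + K * (\<Sum>l\<in>S. (l v)\<^sup>2))"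
proof -
  obtain I :: "(nat \<times> nat) set" and Q K where I: "finite I" and K: "K \<ge> 0" and Q: "\<And>i. i \<in> I \<Longrightarrow> Q i \<in> sets borel"
    and ineq: "\<And>\<phi>. \<phi> \<in> C1_compact \<Omega> \<Longrightarrow> L2_inner \<Omega> \<phi> \<phi> \<le> \<epsilon> * smooth_energy \<Omega> \<phi> +
       K * (\<Sum>i\<in>I. (\<integral>x. \<phi> x * indicator (Q i) x \<partial>lebesgue_on \<Omega>)\<^sup>2)"
    using C1_compact_compactness[OF b\<Omega> \<epsilon>] by blast
  define l where "l i v = L2_inner \<Omega> v (indicator (Q i))" for i and v :: "real^2 \<Rightarrow> real"
  have QL: "indicator (Q i) \<in> L2 \<Omega>" if "i \<in> I" for i
    using Q[OF that] by (intro L2_bounded[OF b\<Omega>, of _ 1] borel_measurable_lebesgue_on) auto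
  have main: "L2_inner \<Omega> v v \<le> \<epsilon> * grad_inner \<Omega> v v + K * (\<Sum>i\<in>I. (l i v)\<^sup>2)" if v: "v \<in> H10 \<Omega>" for v
  proof -
    obtain \<phi> :: "nat \<Rightarrow> real^2 \<Rightarrow> real" where \<phi>: "\<And>n. \<phi> n \<in> test_functions \<Omega>"
      "(\<lambda>n. L2.nrm \<Omega> (\<lambda>x. \<phi> n x - v x)) \<longlonglongrightarrow> 0"
      "\<And>i. (\<lambda>n. L2.nrm \<Omega> (\<lambda>x. partial_deriv i (\<phi> n) x - gradc \<Omega> i v x)) \<longlonglongrightarrow> 0"
      using H10_approx[OF v] by blast
    show ?thesis
    proof (rule LIMSEQ_le)
      show "(\<lambda>n. L2_inner \<Omega> (\<phi> n) (\<phi> n)) \<longlonglongrightarrow> L2_inner \<Omega> v v"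
        by (intro L2.ip_tendsto test_L2 \<phi> H10_L2 v)
      have "(\<lambda>n. l i (\<phi> n)) \<longlonglongrightarrow> l i v" if "i \<in> I" for i
        unfolding l_def
        by (rule L2.ip_tendsto[OF test_L2[OF \<phi>(1)] H10_L2[OF v] \<phi>(2) QL[OF that] QL[OF that]])
           (simp add: L2.nrm_zero)
      thus "(\<lambda>n. \<epsilon> * smooth_energy \<Omega> (\<phi> n) + K * (\<Sum>i\<in>I. (l i (\<phi> n))\<^sup>2))
          \<longlonglongrightarrow> \<epsilon> * grad_inner \<Omega> v v + K * (\<Sum>i\<in>I. (l i v)\<^sup>2)"
        by (intro tendsto_intros smooth_energy_tendsto v \<phi>)
      show "\<exists>N. \<forall>n\<ge>N. L2_inner \<Omega> (\<phi> n) (\<phi> n) \<le> \<epsilon> * smooth_energy \<Omega> (\<phi> n) + K * (\<Sum>i\<in>I. (l i (\<phi> n))\<^sup>2)"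
        using ineq[OF test_functions_C1[OF \<phi>(1)]] by (auto simp: l_def L2_inner_def)
    qed
  qed
  \<comment> \<open>The functionals are collected as a set, in which different indices may coincide.
    Each summand is bounded by the sum over the set, at the price of the factor
    \<open>card I\<close>.\<close>
  have "L2_inner \<Omega> v v \<le> \<epsilon> * grad_inner \<Omega> v v + (K * real (card I)) * (\<Sum>k\<in>l ` I. (k v)\<^sup>2)" if v: "v \<in> H10 \<Omega>" for v
  proof -
    have "(\<Sum>i\<in>I. (l i v)\<^sup>2) \<le> (\<Sum>i\<in>I. \<Sum>k\<in>l ` I. (k v)\<^sup>2)"
      using I by (intro sum_mono member_le_sum[of "l _" "l ` I" "\<lambda>k. (k v)\<^sup>2"]) auto
    hence "K * (\<Sum>i\<in>I. (l i v)\<^sup>2) \<le> K * (\<Sum>i\<in>I. \<Sum>k\<in>l ` I. (k v)\<^sup>2)" using K by (rule mult_left_mono)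
    thus ?thesis using main[OF v] by (simp add: mult.assoc)
  qed
  moreover have "l i (\<lambda>x. u x - v x) = l i u - l i v" if "i \<in> I" "u \<in> H10 \<Omega>" "v \<in> H10 \<Omega>" for i u v
    unfolding l_def using that by (intro L2.ip_diff H10_L2 QL)
  moreover have "\<exists>D. \<forall>v\<in>H10 \<Omega>. \<bar>l i v\<bar> \<le> D * H.nrm v" if i: "i \<in> I" for i
  proof (intro exI ballI)
    fix v assume v: "v \<in> H10 \<Omega>"
    have "\<bar>l i v\<bar> \<le> L2.nrm \<Omega> v * L2.nrm \<Omega> (indicator (Q i))"
      unfolding l_def by (intro L2.ip_le H10_L2 v QL i)
    also have "L2.nrm \<Omega> v \<le> sqrt (measure lebesgue \<Omega>) * H.nrm v"
      unfolding L2.nrm_def H.nrm_def real_sqrt_mult[symmetric] by (intro real_sqrt_le_mono H10_poincare v)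
    finally show "\<bar>l i v\<bar> \<le> (sqrt (measure lebesgue \<Omega>) * L2.nrm \<Omega> (indicator (Q i))) * H.nrm v"
      using L2.nrm_ge0[OF QL[OF i]] by (simp add: mult_right_mono mult_ac)
  qed
  ultimately show ?thesis using I by (intro exI[of _ "l ` I"] exI[of _ "K * real (card I)"]) auto
qed

lemma H10_L2_semi_inner: "semi_inner_space (H10 \<Omega>) (L2_inner \<Omega>)"
proof
  show "L2_inner \<Omega> u v = L2_inner \<Omega> v u" for u v :: "real^2 \<Rightarrow> real" by (simp add: L2_inner_def mult.commute)
qed (auto intro: H.mem_intros simp: L2.ip_simps L2.ip_ge0 H10_L2)

text \<open>If all test functions had norm zero, Cauchy-Schwarz would make the constant 1 orthogonal
  to them, so 1 would vanish almost everywhere on a nonempty open set. It makes the Rayleigh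
  quotient nontrivial.\<close>

lemma exists_nonzero_test_function:
  assumes "\<Omega> \<noteq> {}" shows "\<exists>\<phi>\<in>test_functions \<Omega>. L2_inner \<Omega> \<phi> \<phi> > 0"
proof (rule ccontr)
  assume "\<not> ?thesis"
  hence z: "L2_inner \<Omega> \<phi> \<phi> = 0" if "\<phi> \<in> test_functions \<Omega>" for \<phi>
    using L2.ip_ge0[OF test_L2[OF that]] that by force
  have "AE x in lebesgue_on \<Omega>. (1::real) = 0"
  proof (rule fundamental_lemma_variations[OF \<Omega>_open])
    show "integrable (lebesgue_on \<Omega>) (\<lambda>x. 1::real)" by (rule L2_integrable[OF b\<Omega> L2_const[OF b\<Omega>]])
    fix \<phi> assume \<phi>: "\<phi> \<in> test_functions \<Omega>"
    have "\<bar>L2_inner \<Omega> (\<lambda>_. 1) \<phi>\<bar> \<le> L2.nrm \<Omega> (\<lambda>_. 1) * L2.nrm \<Omega> \<phi>"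
      by (intro L2.ip_le L2_const b\<Omega> test_L2 \<phi>)
    thus "(\<integral>x. 1 * \<phi> x \<partial>lebesgue_on \<Omega>) = 0" using z[OF \<phi>] by (simp add: L2.nrm_def L2_inner_def)
  qed
  hence "AE x in lebesgue. x \<notin> \<Omega>" using \<Omega>_lebesgue by (simp add: AE_restrict_space_iff)
  hence "negligible \<Omega>" using \<Omega>_lebesgue by (simp add: negligible_iff_null_sets AE_iff_null_sets[OF \<Omega>_lebesgue])
  thus False using open_not_negligible[OF \<Omega>_open assms] by simp
qed

text \<open>\<open>LEAST\<close> carries information only if a least eigenvalue exists. The
  minimiser shows that the infimum of the Rayleigh quotient is an eigenvalue, and testing any
  eigenfunction with itself shows that no eigenvalue is smaller.\<close>

theorem first_dirichlet_eigenvalue_rayleigh: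
  assumes "\<Omega> \<noteq> {}"
  shows "first_dirichlet_eigenvalue \<Omega> > 0"
    and "v \<in> H10 \<Omega> \<Longrightarrow> first_dirichlet_eigenvalue \<Omega> * L2_inner \<Omega> v v \<le> grad_inner \<Omega> v v"
proof -
  obtain \<phi> where \<phi>: "\<phi> \<in> test_functions \<Omega>" "L2_inner \<Omega> \<phi> \<phi> > 0"
    using exists_nonzero_test_function[OF assms] by blast
  obtain m u where m: "m > 0" and u: "u \<in> H10 \<Omega>" "L2_inner \<Omega> u u = 1"
    and low: "\<And>v. v \<in> H10 \<Omega> \<Longrightarrow> m * L2_inner \<Omega> v v \<le> grad_inner \<Omega> v v"
    and eig: "\<And>v. v \<in> H10 \<Omega> \<Longrightarrow> grad_inner \<Omega> u v = m * L2_inner \<Omega> u v"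
    using H.rayleigh_minimizer[OF H10_L2_semi_inner H10_poincare test_H10(1)[OF \<phi>(1)] \<phi>(2) H10_compactness]
    by blast
  have "first_dirichlet_eigenvalue \<Omega> = m"
    unfolding first_dirichlet_eigenvalue_def
  proof (rule Least_equality)
    have "\<not> (AE x in lebesgue_on \<Omega>. u x = 0)"
    proof
      assume "AE x in lebesgue_on \<Omega>. u x = 0"
      hence "L2_inner \<Omega> u u = L2_inner \<Omega> (\<lambda>_. 0) (\<lambda>_. 0 :: real)"
        by (intro L2_inner_cong_AE H10_L2 u L2.zero_mem)
      thus False using u(2) by (simp add: L2_inner_def)
    qed
    thus "dirichlet_eigenvalue \<Omega> m"
      unfolding dirichlet_eigenvalue_def using u(1) eig by (auto simp: grad_inner_def)
  next
    fix \<mu> assume "dirichlet_eigenvalue \<Omega> \<mu>"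
    then obtain w where w: "w \<in> H10 \<Omega>" "\<not> (AE x in lebesgue_on \<Omega>. w x = 0)"
      "grad_inner \<Omega> w w = \<mu> * L2_inner \<Omega> w w"
      unfolding dirichlet_eigenvalue_def grad_inner_def by blast
    have "L2_inner \<Omega> w w \<noteq> 0" using L2_inner_zero_imp_AE[OF H10_L2[OF w(1)]] w(2) by blast
    hence "L2_inner \<Omega> w w > 0" using L2.ip_ge0[OF H10_L2[OF w(1)]] by simp
    thus "m \<le> \<mu>" using low[OF w(1)] w(3) by simp
  qed
  thus "first_dirichlet_eigenvalue \<Omega> > 0"
    "v \<in> H10 \<Omega> \<Longrightarrow> first_dirichlet_eigenvalue \<Omega> * L2_inner \<Omega> v v \<le> grad_inner \<Omega> v v"
    using m low by auto
qed

end

section \<open>The nonlinear terms\<close>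

lemma conv_power_abs: assumes "\<delta> \<ge> 1" shows "\<bar>conv_power \<delta> s\<bar> = \<bar>s\<bar> powr \<delta>"
proof (cases "\<delta> \<in> \<int>")
  case True
  then obtain k where k: "\<delta> = of_int k" by (auto elim: Ints_cases)
  hence n: "\<delta> = real (nat k)" "nat k > 0" using assms by auto
  show ?thesis unfolding n(1)
    using n(2) by (cases "s = 0") (simp_all add: conv_power_def power_abs powr_realpow del: of_nat_nat)
qed (simp add: conv_power_def)

lemma powr_le_one_plus_power:
  assumes "0 \<le> a" "a \<le> real N" shows "\<bar>s\<bar> powr a \<le> 1 + \<bar>s\<bar> ^ N"
proof (cases "\<bar>s\<bar> \<le> 1")
  case True
  hence "\<bar>s\<bar> powr a \<le> 1" using assms(1) by (simp add: powr_le1)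
  thus ?thesis by (simp add: add_increasing2)
next
  case False
  hence "\<bar>s\<bar> powr a \<le> \<bar>s\<bar> powr real N" using assms by (intro powr_mono) auto
  also have "\<dots> = \<bar>s\<bar> ^ N" using False by (intro powr_realpow) auto
  finally show ?thesis by simp
qed

text \<open>Away from 0 this is the usual rule on each side. At 0 the difference quotient is
  dominated by the power \<delta> - 1 of |h|, which tends to 0 because \<delta> exceeds 1.\<close>

lemma abs_powr_deriv:
  assumes "\<delta> > (1::real)"
  shows "((\<lambda>s. \<bar>s\<bar> powr \<delta>) has_real_derivative \<delta> * \<bar>s\<bar> powr (\<delta> - 1) * sgn s) (at s)"
proof (cases s "0::real" rule: linorder_cases)
  case greater
  have "((\<lambda>s. s powr \<delta>) has_real_derivative \<delta> * s powr (\<delta> - 1)) (at s)"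
    using greater by (auto intro!: derivative_eq_intros)
  hence "((\<lambda>s. \<bar>s\<bar> powr \<delta>) has_real_derivative \<delta> * s powr (\<delta> - 1)) (at s)"
    by (rule has_field_derivative_transform_within_open[where S = "{0<..}"]) (use greater in auto)
  thus ?thesis using greater by simp
next
  case less
  have "((\<lambda>s. (- s) powr \<delta>) has_real_derivative - (\<delta> * (- s) powr (\<delta> - 1))) (at s)"
    using less by (auto intro!: derivative_eq_intros)
  hence "((\<lambda>s. \<bar>s\<bar> powr \<delta>) has_real_derivative - (\<delta> * (- s) powr (\<delta> - 1))) (at s)"
    by (rule has_field_derivative_transform_within_open[where S = "{..<0}"]) (use less in auto)
  thus ?thesis using less by simp
next
  case equal
  have "((\<lambda>h. \<bar>h::real\<bar> powr (\<delta> - 1)) \<longlongrightarrow> 0) (at 0)"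
    using assms by (intro tendsto_zero_powrI[where b = "\<delta> - 1"] tendsto_rabs_zero tendsto_ident_at tendsto_const) auto
  hence "((\<lambda>h. \<bar>h::real\<bar> powr \<delta> / h) \<longlongrightarrow> 0) (at 0)"
  proof (rule Lim_null_comparison[rotated])
    have "norm (\<bar>h\<bar> powr \<delta> / h) \<le> \<bar>h\<bar> powr (\<delta> - 1)" for h :: real
      by (cases "h = 0") (auto simp: powr_diff)
    thus "\<forall>\<^sub>F h in at 0. norm (\<bar>h::real\<bar> powr \<delta> / h) \<le> \<bar>h\<bar> powr (\<delta> - 1)" by simp
  qed
  thus ?thesis using equal by (simp add: has_field_derivative_iff)
qed

text \<open>Euler's relation for homogeneous functions, s d = \<delta> times the power, holds in the
  integer and in the absolute-value branch alike. Together with the polynomial bound it spares all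
  later arguments the case distinction.\<close>

lemma conv_power_deriv:
  assumes "\<delta> \<ge> 1" "\<delta> \<le> real N"
  shows "\<exists>d. (conv_power \<delta> has_real_derivative d) (at s) \<and> s * d = \<delta> * conv_power \<delta> s \<and> \<bar>d\<bar> \<le> \<delta> * (1 + \<bar>s\<bar> ^ N)"
proof (cases "\<delta> \<in> \<int>")
  case True
  then obtain k where "\<delta> = of_int k" by (auto elim: Ints_cases)
  then obtain n where n: "\<delta> = real n" "n > 0" "nat \<lfloor>\<delta>\<rfloor> = n"
    using assms by (intro that[of "nat k"]) auto
  have e: "conv_power \<delta> = (\<lambda>s. s ^ n)" using True n by (simp add: conv_power_def fun_eq_iff)
  have "\<bar>s\<bar> ^ (n - 1) \<le> 1 + \<bar>s\<bar> ^ N"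
  proof (cases "\<bar>s\<bar> \<le> 1")
    case True thus ?thesis by (intro order_trans[OF power_le_one]) auto
  next
    case False
    hence "\<bar>s\<bar> ^ (n - 1) \<le> \<bar>s\<bar> ^ N" using assms n by (intro power_increasing) auto
    thus ?thesis by simp
  qed
  hence "\<bar>real n * s ^ (n - 1)\<bar> \<le> \<delta> * (1 + \<bar>s\<bar> ^ N)" by (simp add: abs_mult power_abs n)
  moreover have "s * (real n * s ^ (n - 1)) = \<delta> * s ^ n" using n by (cases n) auto
  moreover have "((\<lambda>s. s ^ n) has_real_derivative real n * s ^ (n - 1)) (at s)"
    by (auto intro!: derivative_eq_intros)
  ultimately show ?thesis unfolding e by blast
next
  case False
  hence d1: "\<delta> > 1" using assms by (metis Ints_1 less_le)
  have e: "conv_power \<delta> = (\<lambda>s. \<bar>s\<bar> powr \<delta>)" using False by (simp add: conv_power_def fun_eq_iff)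
  define d where "d = \<delta> * \<bar>s\<bar> powr (\<delta> - 1) * sgn s"
  have "s * d = \<delta> * \<bar>s\<bar> powr \<delta>"
    by (cases "s = 0") (auto simp: d_def powr_diff sgn_if)
  moreover have "\<bar>d\<bar> \<le> \<delta> * (1 + \<bar>s\<bar> ^ N)"
  proof -
    have "\<bar>d\<bar> \<le> \<delta> * \<bar>s\<bar> powr (\<delta> - 1)" using d1 by (auto simp: d_def abs_mult sgn_if)
    also have "\<dots> \<le> \<delta> * (1 + \<bar>s\<bar> ^ N)"
      using d1 assms by (intro mult_left_mono powr_le_one_plus_power) auto
    finally show ?thesis .
  qed
  ultimately show ?thesis unfolding e using abs_powr_deriv[OF d1, of s] unfolding d_def by blast
qed

text \<open>Up to the factor \<delta> + 1 a primitive of the power, so that the convective term is a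
  derivative of the flux.\<close>

definition flux :: "real \<Rightarrow> real \<Rightarrow> real" where
  "flux \<delta> s = s * conv_power \<delta> s"

definition reaction :: "real \<Rightarrow> real \<Rightarrow> real \<Rightarrow> real" where
  "reaction \<delta> \<gamma> s = s * (1 - conv_power \<delta> s) * (conv_power \<delta> s - \<gamma>)"

lemma reaction_eq: "reaction \<delta> \<gamma> s = (1 + \<gamma>) * flux \<delta> s - \<gamma> * s - s * (conv_power \<delta> s)\<^sup>2"
  by (simp add: reaction_def flux_def power2_eq_square algebra_simps)

text \<open>Product rule followed by Euler's relation. The second function is the odd monomial of
  degree 2 \<delta> + 1, the leading part of the reaction term.\<close>

lemma flux_deriv:
  assumes "\<delta> \<ge> 1"
  shows "(flux \<delta> has_real_derivative (\<delta> + 1) * conv_power \<delta> s) (at s)"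
    and "((\<lambda>s. s * (conv_power \<delta> s)\<^sup>2) has_real_derivative (2 * \<delta> + 1) * (conv_power \<delta> s)\<^sup>2) (at s)"
proof -
  obtain N where "\<delta> \<le> real N" using real_arch_simple by blast
  then obtain d where d: "(conv_power \<delta> has_real_derivative d) (at s)" "s * d = \<delta> * conv_power \<delta> s"
    using conv_power_deriv[OF assms] by blast
  have "(flux \<delta> has_real_derivative 1 * conv_power \<delta> s + d * s) (at s)"
    unfolding flux_def[abs_def] by (intro DERIV_mult DERIV_ident d)
  thus "(flux \<delta> has_real_derivative (\<delta> + 1) * conv_power \<delta> s) (at s)"
    using d(2) by (simp add: algebra_simps)
  have "((\<lambda>s. flux \<delta> s * conv_power \<delta> s) has_real_derivative
      (1 * conv_power \<delta> s + d * s) * conv_power \<delta> s + d * flux \<delta> s) (at s)"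
    using \<open>(flux \<delta> has_real_derivative 1 * conv_power \<delta> s + d * s) (at s)\<close> d(1) by (rule DERIV_mult)
  moreover have "(\<lambda>s. flux \<delta> s * conv_power \<delta> s) = (\<lambda>s. s * (conv_power \<delta> s)\<^sup>2)"
    by (simp add: flux_def power2_eq_square fun_eq_iff)
  moreover have "(1 * conv_power \<delta> s + d * s) * conv_power \<delta> s + d * flux \<delta> s = (2 * \<delta> + 1) * (conv_power \<delta> s)\<^sup>2"
  proof -
    have "(1 * conv_power \<delta> s + d * s) * conv_power \<delta> s + d * flux \<delta> s
        = (conv_power \<delta> s)\<^sup>2 + 2 * (s * d) * conv_power \<delta> s"
      by (simp add: flux_def power2_eq_square algebra_simps)
    thus ?thesis unfolding d(2) by (simp add: power2_eq_square algebra_simps)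
  qed
  ultimately show "((\<lambda>s. s * (conv_power \<delta> s)\<^sup>2) has_real_derivative (2 * \<delta> + 1) * (conv_power \<delta> s)\<^sup>2) (at s)"
    by simp
qed

lemma continuous_conv_power: assumes "\<delta> \<ge> 1" shows "continuous_on A (conv_power \<delta>)"
proof -
  obtain N where "\<delta> \<le> real N" using real_arch_simple by blast
  hence "isCont (conv_power \<delta>) s" for s using conv_power_deriv[OF assms, of N s] DERIV_isCont by blast
  thus ?thesis by (simp add: continuous_at_imp_continuous_on)
qed

text \<open>The intermediate point is located by modulus only, in either order of the arguments,
  because all derivative bounds depend on the modulus.\<close>

lemma mean_value_abs:
  fixes f :: "real \<Rightarrow> real"
  assumes "\<And>s. (f has_real_derivative f' s) (at s)"
  shows "\<exists>z. \<bar>z\<bar> \<le> max \<bar>a\<bar> \<bar>b\<bar> \<and> f a - f b = (a - b) * f' z"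
proof (cases a b rule: linorder_cases)
  case less
  from MVT2[OF less assms] obtain z where "a < z" "z < b" "f b - f a = (b - a) * f' z" by blast
  thus ?thesis by (intro exI[of _ z]) (auto simp: algebra_simps)
next
  case greater
  from MVT2[OF greater assms] obtain z where "b < z" "z < a" "f a - f b = (a - b) * f' z" by blast
  thus ?thesis by (intro exI[of _ z]) auto
qed auto

lemma conv_power_sq_mono:
  assumes "\<delta> \<ge> 1" "\<bar>a\<bar> \<le> \<bar>b\<bar>" shows "(conv_power \<delta> a)\<^sup>2 \<le> (conv_power \<delta> b)\<^sup>2"
  using assms by (simp add: abs_le_square_iff[symmetric] conv_power_abs powr_mono2)

text \<open>Mean value theorem; the squared power is monotone in the modulus, so at the intermediate
  point it is at most the larger of the two end values, hence at most their sum.\<close>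

lemma flux_diff_sq:
  assumes "\<delta> \<ge> 1"
  shows "(flux \<delta> a - flux \<delta> b)\<^sup>2 \<le> (\<delta> + 1)\<^sup>2 * (((conv_power \<delta> a)\<^sup>2 + (conv_power \<delta> b)\<^sup>2) * (a - b)\<^sup>2)"
proof -
  obtain z where z: "\<bar>z\<bar> \<le> max \<bar>a\<bar> \<bar>b\<bar>" "flux \<delta> a - flux \<delta> b = (a - b) * ((\<delta> + 1) * conv_power \<delta> z)"
    using mean_value_abs[OF flux_deriv(1)[OF assms]] by blast
  have "(conv_power \<delta> z)\<^sup>2 \<le> (conv_power \<delta> a)\<^sup>2 + (conv_power \<delta> b)\<^sup>2"
    using z(1) conv_power_sq_mono[OF assms, of z a] conv_power_sq_mono[OF assms, of z b]
    by (auto simp: max_def add_increasing add_increasing2 split: if_splits)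
  hence "(\<delta> + 1)\<^sup>2 * ((conv_power \<delta> z)\<^sup>2 * (a - b)\<^sup>2) \<le> (\<delta> + 1)\<^sup>2 * (((conv_power \<delta> a)\<^sup>2 + (conv_power \<delta> b)\<^sup>2) * (a - b)\<^sup>2)"
    by (intro mult_left_mono mult_right_mono) auto
  thus ?thesis unfolding z(2) by (simp add: power_mult_distrib mult_ac)
qed

text \<open>With \<open>A = \<bar>a\<bar>\<^bsup>2\<delta>\<^esup>\<close> and \<open>B = \<bar>b\<bar>\<^bsup>2\<delta>\<^esup>\<close>, twice the left-hand side is
  \<open>(A + B) (a - b)\<^sup>2 + (A - B) (a\<^sup>2 - b\<^sup>2)\<close>.\<close>

lemma odd_power_monotone:
  assumes "\<delta> \<ge> 1"
  shows "(a * (conv_power \<delta> a)\<^sup>2 - b * (conv_power \<delta> b)\<^sup>2) * (a - b)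
    \<ge> 1/2 * (((conv_power \<delta> a)\<^sup>2 + (conv_power \<delta> b)\<^sup>2) * (a - b)\<^sup>2)"
proof -
  define A B where "A = (conv_power \<delta> a)\<^sup>2" and "B = (conv_power \<delta> b)\<^sup>2"
  have "0 \<le> (A - B) * (a\<^sup>2 - b\<^sup>2)"
  proof (cases "\<bar>a\<bar> \<le> \<bar>b\<bar>")
    case True
    thus ?thesis using conv_power_sq_mono[OF assms True] abs_le_square_iff[of a b]
      by (intro mult_nonpos_nonpos) (auto simp: A_def B_def)
  next
    case False
    thus ?thesis using conv_power_sq_mono[OF assms, of b a] abs_le_square_iff[of b a]
      by (intro mult_nonneg_nonneg) (auto simp: A_def B_def)
  qed
  moreover have "2 * ((a * A - b * B) * (a - b)) = (A + B) * (a - b)\<^sup>2 + (A - B) * (a\<^sup>2 - b\<^sup>2)"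
    by (simp add: power2_eq_square algebra_simps)
  ultimately show ?thesis unfolding A_def B_def by linarith
qed

text \<open>A weight for local Lipschitz constants. The natural exponent, taken at least \<delta>,
  lets the Sobolev bounds for integer powers control real ones, and the summand 1 lets higher powers
  of the weight dominate lower ones.\<close>

definition growth :: "nat \<Rightarrow> real \<Rightarrow> real \<Rightarrow> real" where
  "growth N a b = 1 + \<bar>a\<bar> ^ N + \<bar>b\<bar> ^ N"

lemma growth_ge1: "1 \<le> growth N a b" by (simp add: growth_def)

lemma max_power_growth: assumes "\<bar>z\<bar> \<le> max \<bar>a\<bar> \<bar>b\<bar>" shows "1 + \<bar>z\<bar> ^ N \<le> growth N a b"
proof -
  have "\<bar>z\<bar> ^ N \<le> (max \<bar>a\<bar> \<bar>b\<bar>) ^ N" using assms by (intro power_mono) auto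
  also have "\<dots> \<le> \<bar>a\<bar> ^ N + \<bar>b\<bar> ^ N" by (auto simp: max_def)
  finally show ?thesis by (simp add: growth_def)
qed

text \<open>Mean value theorem with derivatives bounded by the weight. Derivatives of the power and
  of the flux have degree at most \<delta> and cost one factor of it; the reaction term has
  derivatives of degree up to 2 \<delta> and costs two.\<close>

lemma local_lipschitz_bounds:
  assumes \<delta>: "\<delta> \<ge> 1" "\<delta> \<le> real N" and \<gamma>: "\<gamma> \<ge> 0"
  shows "\<bar>conv_power \<delta> a\<bar> \<le> growth N a b"
    and "\<bar>conv_power \<delta> a - conv_power \<delta> b\<bar> \<le> \<delta> * \<bar>growth N a b * (a - b)\<bar>"
    and "\<bar>flux \<delta> a - flux \<delta> b\<bar> \<le> (\<delta> + 1) * \<bar>growth N a b * (a - b)\<bar>"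
    and "\<bar>reaction \<delta> \<gamma> a - reaction \<delta> \<gamma> b\<bar> \<le> ((1 + \<gamma>) * (\<delta> + 1) + \<gamma> + (2 * \<delta> + 1)) * \<bar>(growth N a b)\<^sup>2 * (a - b)\<bar>"
proof -
  let ?W = "growth N a b"
  have W: "?W \<ge> 1" by (rule growth_ge1)
  have cp: "\<bar>conv_power \<delta> z\<bar> \<le> ?W" if "\<bar>z\<bar> \<le> max \<bar>a\<bar> \<bar>b\<bar>" for z
    using powr_le_one_plus_power[of \<delta> N z] max_power_growth[OF that, of N] \<delta> by (simp add: conv_power_abs)
  show "\<bar>conv_power \<delta> a\<bar> \<le> ?W" by (rule cp) simp
  have "\<forall>s. \<exists>d. (conv_power \<delta> has_real_derivative d) (at s) \<and> \<bar>d\<bar> \<le> \<delta> * (1 + \<bar>s\<bar> ^ N)"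
    using conv_power_deriv[OF \<delta>] by blast
  from choice[OF this] obtain p' where p': "\<And>s. (conv_power \<delta> has_real_derivative p' s) (at s)" "\<And>s. \<bar>p' s\<bar> \<le> \<delta> * (1 + \<bar>s\<bar> ^ N)"
    by blast
  obtain z where z: "\<bar>z\<bar> \<le> max \<bar>a\<bar> \<bar>b\<bar>" "conv_power \<delta> a - conv_power \<delta> b = (a - b) * p' z"
    using mean_value_abs[OF p'(1)] by blast
  have "\<bar>p' z\<bar> \<le> \<delta> * ?W" using p'(2)[of z] max_power_growth[OF z(1), of N] \<delta>
    by (smt (verit) mult_left_mono)
  hence "\<bar>a - b\<bar> * \<bar>p' z\<bar> \<le> \<bar>a - b\<bar> * (\<delta> * ?W)" by (intro mult_left_mono) auto
  thus "\<bar>conv_power \<delta> a - conv_power \<delta> b\<bar> \<le> \<delta> * \<bar>?W * (a - b)\<bar>"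
    unfolding z(2) using W by (simp add: abs_mult mult_ac)
  obtain y where y: "\<bar>y\<bar> \<le> max \<bar>a\<bar> \<bar>b\<bar>" "flux \<delta> a - flux \<delta> b = (a - b) * ((\<delta> + 1) * conv_power \<delta> y)"
    using mean_value_abs[OF flux_deriv(1)[OF \<delta>(1)]] by blast
  have "\<bar>a - b\<bar> * ((\<delta> + 1) * \<bar>conv_power \<delta> y\<bar>) \<le> \<bar>a - b\<bar> * ((\<delta> + 1) * ?W)"
    using cp[OF y(1)] \<delta> by (intro mult_left_mono) auto
  thus fl: "\<bar>flux \<delta> a - flux \<delta> b\<bar> \<le> (\<delta> + 1) * \<bar>?W * (a - b)\<bar>"
    unfolding y(2) using W \<delta> by (simp add: abs_mult mult_ac)
  obtain x where x: "\<bar>x\<bar> \<le> max \<bar>a\<bar> \<bar>b\<bar>"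
    "a * (conv_power \<delta> a)\<^sup>2 - b * (conv_power \<delta> b)\<^sup>2 = (a - b) * ((2 * \<delta> + 1) * (conv_power \<delta> x)\<^sup>2)"
    using mean_value_abs[OF flux_deriv(2)[OF \<delta>(1)]] by blast
  let ?V = "\<bar>?W\<^sup>2 * (a - b)\<bar>"
  have WW: "\<bar>?W * (a - b)\<bar> \<le> ?V" "\<bar>a - b\<bar> \<le> ?V"
    using W by (auto simp: abs_mult power2_eq_square mult_le_cancel_right1 intro!: mult_right_mono)
      (smt (verit) mult_le_cancel_right1 mult_le_cancel_left1)
  have "(conv_power \<delta> x)\<^sup>2 \<le> ?W\<^sup>2" using cp[OF x(1)] W by (simp add: abs_le_square_iff[symmetric])
  hence "\<bar>a - b\<bar> * ((2 * \<delta> + 1) * (conv_power \<delta> x)\<^sup>2) \<le> \<bar>a - b\<bar> * ((2 * \<delta> + 1) * ?W\<^sup>2)"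
    using \<delta> by (intro mult_left_mono) auto
  hence G: "\<bar>a * (conv_power \<delta> a)\<^sup>2 - b * (conv_power \<delta> b)\<^sup>2\<bar> \<le> (2 * \<delta> + 1) * ?V"
    unfolding x(2) using \<delta> by (simp add: abs_mult mult_ac)
  have "(\<delta> + 1) * \<bar>?W * (a - b)\<bar> \<le> (\<delta> + 1) * ?V" using WW(1) \<delta> by (intro mult_left_mono) auto
  hence "(1 + \<gamma>) * \<bar>flux \<delta> a - flux \<delta> b\<bar> \<le> (1 + \<gamma>) * ((\<delta> + 1) * ?V)" using fl \<gamma> by (intro mult_left_mono) auto
  moreover have "\<gamma> * \<bar>a - b\<bar> \<le> \<gamma> * ?V" using WW(2) \<gamma> by (intro mult_left_mono)
  moreover have "\<bar>reaction \<delta> \<gamma> a - reaction \<delta> \<gamma> b\<bar> \<le> (1 + \<gamma>) * \<bar>flux \<delta> a - flux \<delta> b\<bar> + \<gamma> * \<bar>a - b\<bar>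
      + \<bar>a * (conv_power \<delta> a)\<^sup>2 - b * (conv_power \<delta> b)\<^sup>2\<bar>"
  proof -
    have tri: "\<bar>x - y - z\<bar> \<le> \<bar>x\<bar> + \<bar>y\<bar> + \<bar>z\<bar>" for x y z :: real by linarith
    have "reaction \<delta> \<gamma> a - reaction \<delta> \<gamma> b = (1 + \<gamma>) * (flux \<delta> a - flux \<delta> b) - \<gamma> * (a - b)
      - (a * (conv_power \<delta> a)\<^sup>2 - b * (conv_power \<delta> b)\<^sup>2)"
      unfolding reaction_eq by (simp add: algebra_simps)
    moreover have "\<bar>(1 + \<gamma>) * (flux \<delta> a - flux \<delta> b)\<bar> = (1 + \<gamma>) * \<bar>flux \<delta> a - flux \<delta> b\<bar>" "\<bar>\<gamma> * (a - b)\<bar> = \<gamma> * \<bar>a - b\<bar>"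
      using \<gamma> by (simp_all add: abs_mult)
    ultimately show ?thesis using tri by metis
  qed
  ultimately have "\<bar>reaction \<delta> \<gamma> a - reaction \<delta> \<gamma> b\<bar> \<le> (1 + \<gamma>) * ((\<delta> + 1) * ?V) + \<gamma> * ?V + (2 * \<delta> + 1) * ?V"
    using G by simp
  thus "\<bar>reaction \<delta> \<gamma> a - reaction \<delta> \<gamma> b\<bar> \<le> ((1 + \<gamma>) * (\<delta> + 1) + \<gamma> + (2 * \<delta> + 1)) * ?V"
    by (simp add: algebra_simps)
qed

text \<open>The cross term is split by Young's inequality so that exactly a quarter of the weighted
  square \<open>Y\<close> is spent on it. \<open>odd_power_monotone\<close> supplies half of
  \<open>Y\<close>, and the remaining quarter is kept in the conclusion for the convective
  term.\<close>

lemma reaction_diff_le: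
  assumes \<delta>: "\<delta> \<ge> 1" and \<gamma>: "\<gamma> \<ge> 0"
  shows "(reaction \<delta> \<gamma> a - reaction \<delta> \<gamma> b) * (a - b)
    \<le> (((1 + \<gamma>) * (\<delta> + 1))\<^sup>2 - \<gamma>) * (a - b)\<^sup>2 - 1/4 * (((conv_power \<delta> a)\<^sup>2 + (conv_power \<delta> b)\<^sup>2) * (a - b)\<^sup>2)"
proof -
  define Y where "Y = ((conv_power \<delta> a)\<^sup>2 + (conv_power \<delta> b)\<^sup>2) * (a - b)\<^sup>2"
  \<comment> \<open>The flux difference divided by \<delta> + 1 satisfies P^2 \<le> Y without a
    constant; the factor \<delta> + 1 reappears in \<open>K\<close>.\<close>
  define P where "P = (flux \<delta> a - flux \<delta> b) / (\<delta> + 1)"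
  have P: "flux \<delta> a - flux \<delta> b = (\<delta> + 1) * P" using \<delta> by (simp add: P_def)
  have "(\<delta> + 1)\<^sup>2 * P\<^sup>2 \<le> (\<delta> + 1)\<^sup>2 * Y"
    using flux_diff_sq[OF \<delta>, of a b] unfolding P Y_def by (simp add: power_mult_distrib)
  hence PY: "P\<^sup>2 \<le> Y" using \<delta> by simp
  define K where "K = (1 + \<gamma>) * (\<delta> + 1)"
  have "0 \<le> (P / 2 - K * (a - b))\<^sup>2" by simp
  also have "\<dots> = P\<^sup>2 / 4 - K * P * (a - b) + K\<^sup>2 * (a - b)\<^sup>2"
    by (simp add: power2_eq_square algebra_simps)
  finally have "K * P * (a - b) \<le> Y / 4 + K\<^sup>2 * (a - b)\<^sup>2" using PY by linarith
  moreover have "(reaction \<delta> \<gamma> a - reaction \<delta> \<gamma> b) * (a - b)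
      = K * P * (a - b) - \<gamma> * (a - b)\<^sup>2 - (a * (conv_power \<delta> a)\<^sup>2 - b * (conv_power \<delta> b)\<^sup>2) * (a - b)"
  proof -
    have "(reaction \<delta> \<gamma> a - reaction \<delta> \<gamma> b) * (a - b)
      = (1 + \<gamma>) * (flux \<delta> a - flux \<delta> b) * (a - b) - \<gamma> * (a - b)\<^sup>2 - (a * (conv_power \<delta> a)\<^sup>2 - b * (conv_power \<delta> b)\<^sup>2) * (a - b)"
      unfolding reaction_eq by (simp add: power2_eq_square algebra_simps)
    thus ?thesis unfolding P K_def by (simp add: mult.assoc)
  qed
  moreover have "(a * (conv_power \<delta> a)\<^sup>2 - b * (conv_power \<delta> b)\<^sup>2) * (a - b) \<ge> 1/2 * Y"
    unfolding Y_def by (rule odd_power_monotone[OF \<delta>])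
  ultimately have "(reaction \<delta> \<gamma> a - reaction \<delta> \<gamma> b) * (a - b) \<le> K\<^sup>2 * (a - b)\<^sup>2 - \<gamma> * (a - b)\<^sup>2 - 1/4 * Y"
    by linarith
  thus ?thesis unfolding K_def Y_def by (simp add: left_diff_distrib)
qed

section \<open>Hoelder estimates and superposition operators\<close>

lemma L2_dominated:
  assumes f: "f \<in> borel_measurable (lebesgue_on \<Omega>)" and g: "g \<in> L2 \<Omega>" and C: "C \<ge> 0"
    and le: "\<And>x. \<bar>f x\<bar> \<le> C * \<bar>g x\<bar>"
  shows "f \<in> L2 \<Omega>" "L2.nrm \<Omega> f \<le> C * L2.nrm \<Omega> g"
proof -
  have sq: "(f x)\<^sup>2 \<le> C\<^sup>2 * (g x)\<^sup>2" for x
    using power_mono[OF le[of x], of 2] by (simp add: power_mult_distrib)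
  have ig: "integrable (lebesgue_on \<Omega>) (\<lambda>x. C\<^sup>2 * (g x)\<^sup>2)" using L2_D(2)[OF g] by simp
  have i: "integrable (lebesgue_on \<Omega>) (\<lambda>x. (f x)\<^sup>2)"
    by (rule Bochner_Integration.integrable_bound[OF ig]) (use f sq in auto)
  thus fL: "f \<in> L2 \<Omega>" using f by (rule L2_I[rotated])
  show "L2.nrm \<Omega> f \<le> C * L2.nrm \<Omega> g"
  proof (rule power2_le_imp_le)
    have "(\<integral>x. (f x)\<^sup>2 \<partial>lebesgue_on \<Omega>) \<le> (\<integral>x. C\<^sup>2 * (g x)\<^sup>2 \<partial>lebesgue_on \<Omega>)"
      using i ig sq by (intro integral_mono) auto
    thus "(L2.nrm \<Omega> f)\<^sup>2 \<le> (C * L2.nrm \<Omega> g)\<^sup>2"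
      unfolding power_mult_distrib L2.nrm_power2[OF fL] L2.nrm_power2[OF g]
      by (simp add: L2_inner_def power2_eq_square)
  qed (use C L2.nrm_ge0[OF g] in simp)
qed

text \<open>The L^4 norm, written through the L^2 norm of the square so that Hoelder's inequality is
  Cauchy-Schwarz for squares.\<close>

definition nrm4 :: "(real^2) set \<Rightarrow> (real^2 \<Rightarrow> real) \<Rightarrow> real" where
  "nrm4 \<Omega> f = sqrt (L2.nrm \<Omega> (\<lambda>x. (f x)\<^sup>2))"

lemma L2_mult_nrm4:
  assumes "f \<in> borel_measurable (lebesgue_on \<Omega>)" "(\<lambda>x. (f x)\<^sup>2) \<in> L2 \<Omega>"
    and "g \<in> borel_measurable (lebesgue_on \<Omega>)" "(\<lambda>x. (g x)\<^sup>2) \<in> L2 \<Omega>"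
  shows "(\<lambda>x. f x * g x) \<in> L2 \<Omega>" "L2.nrm \<Omega> (\<lambda>x. f x * g x) \<le> nrm4 \<Omega> f * nrm4 \<Omega> g"
proof -
  show L: "(\<lambda>x. f x * g x) \<in> L2 \<Omega>"
    using L2_mult_integrable[OF assms(2,4)] assms(1,3) by (intro L2_I) (auto simp: power_mult_distrib)
  have "(L2.nrm \<Omega> (\<lambda>x. f x * g x))\<^sup>2 = L2_inner \<Omega> (\<lambda>x. (f x)\<^sup>2) (\<lambda>x. (g x)\<^sup>2)"
    unfolding L2.nrm_power2[OF L] by (simp add: L2_inner_def power2_eq_square mult_ac)
  also have "\<dots> \<le> L2.nrm \<Omega> (\<lambda>x. (f x)\<^sup>2) * L2.nrm \<Omega> (\<lambda>x. (g x)\<^sup>2)"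
    using L2.ip_le[OF assms(2,4)] by simp
  finally have "sqrt ((L2.nrm \<Omega> (\<lambda>x. f x * g x))\<^sup>2) \<le> sqrt (L2.nrm \<Omega> (\<lambda>x. (f x)\<^sup>2) * L2.nrm \<Omega> (\<lambda>x. (g x)\<^sup>2))"
    by (rule real_sqrt_le_mono)
  thus "L2.nrm \<Omega> (\<lambda>x. f x * g x) \<le> nrm4 \<Omega> f * nrm4 \<Omega> g"
    using L2.nrm_ge0[OF L] by (simp add: nrm4_def real_sqrt_mult)
qed

context bounded_open_domain
begin

lemma H10_measurable: "u \<in> H10 \<Omega> \<Longrightarrow> u \<in> borel_measurable (lebesgue_on \<Omega>)"
  using H10_L2 L2_D by blast

lemma H10_power:
  assumes u: "u \<in> H10 \<Omega>"
  shows "(\<lambda>x. u x ^ k) \<in> L2 \<Omega>" "L2.nrm \<Omega> (\<lambda>x. u x ^ k) \<le> fact k * sqrt (measure lebesgue \<Omega>) * H.nrm u ^ k"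
proof -
  have e: "(u x ^ k)\<^sup>2 = u x ^ (2 * k)" for x by (simp add: power_mult[symmetric] mult.commute)
  show L: "(\<lambda>x. u x ^ k) \<in> L2 \<Omega>"
    using H10_measurable[OF u] H10_sobolev(1)[OF u, of k] by (intro L2_I) (auto simp: e)
  show "L2.nrm \<Omega> (\<lambda>x. u x ^ k) \<le> fact k * sqrt (measure lebesgue \<Omega>) * H.nrm u ^ k"
  proof (rule power2_le_imp_le)
    have "(L2.nrm \<Omega> (\<lambda>x. u x ^ k))\<^sup>2 = (\<integral>x. u x ^ (2 * k) \<partial>lebesgue_on \<Omega>)"
      unfolding L2.nrm_power2[OF L] by (simp add: L2_inner_def power_add[symmetric] mult_2)
    also have "\<dots> \<le> (fact k)\<^sup>2 * measure lebesgue \<Omega> * grad_inner \<Omega> u u ^ k" by (rule H10_sobolev(2)[OF u])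
    also have "\<dots> = (fact k * sqrt (measure lebesgue \<Omega>) * H.nrm u ^ k)\<^sup>2"
      by (simp add: power_mult_distrib H.nrm_power2[OF u, symmetric] power_mult[symmetric] mult.commute)
    finally show "(L2.nrm \<Omega> (\<lambda>x. u x ^ k))\<^sup>2 \<le> (fact k * sqrt (measure lebesgue \<Omega>) * H.nrm u ^ k)\<^sup>2" .
  qed (use H.nrm_ge0[OF u] in simp)
qed

text \<open>The numbers 2 and 24 are the factorials of 2 and 4 from the Sobolev bound; the L^4 norm
  of the square involves the fourth power of \<open>u\<close> in L^2.\<close>

lemma H10_nrm4: "u \<in> H10 \<Omega> \<Longrightarrow> nrm4 \<Omega> u \<le> sqrt (2 * sqrt (measure lebesgue \<Omega>)) * H.nrm u"
  "u \<in> H10 \<Omega> \<Longrightarrow> nrm4 \<Omega> (\<lambda>x. (u x)\<^sup>2) \<le> sqrt (24 * sqrt (measure lebesgue \<Omega>)) * (H.nrm u)\<^sup>2"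
proof -
  assume u: "u \<in> H10 \<Omega>"
  have "nrm4 \<Omega> u \<le> sqrt (fact 2 * sqrt (measure lebesgue \<Omega>) * H.nrm u ^ 2)"
    unfolding nrm4_def by (intro real_sqrt_le_mono H10_power u)
  thus "nrm4 \<Omega> u \<le> sqrt (2 * sqrt (measure lebesgue \<Omega>)) * H.nrm u"
    using H.nrm_ge0[OF u] by (simp add: real_sqrt_mult)
  have "nrm4 \<Omega> (\<lambda>x. (u x)\<^sup>2) \<le> sqrt (fact 4 * sqrt (measure lebesgue \<Omega>) * H.nrm u ^ 4)"
    unfolding nrm4_def using H10_power(2)[OF u, of 4] by (intro real_sqrt_le_mono) simp
  also have "fact 4 = (24::real)" by (simp add: fact_numeral)
  also have "sqrt (24 * sqrt (measure lebesgue \<Omega>) * H.nrm u ^ 4)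
      = sqrt (24 * sqrt (measure lebesgue \<Omega>)) * sqrt (H.nrm u ^ 4)" by (rule real_sqrt_mult)
  also have "sqrt (H.nrm u ^ 4) = (H.nrm u)\<^sup>2"
    by (rule real_sqrt_unique) (simp_all flip: power_mult)
  finally show "nrm4 \<Omega> (\<lambda>x. (u x)\<^sup>2) \<le> sqrt (24 * sqrt (measure lebesgue \<Omega>)) * (H.nrm u)\<^sup>2" .
qed

lemma growth_measurable:
  "u \<in> H10 \<Omega> \<Longrightarrow> v \<in> H10 \<Omega> \<Longrightarrow> (\<lambda>x. growth N (u x) (v x)) \<in> borel_measurable (lebesgue_on \<Omega>)"
  unfolding growth_def using H10_measurable by measurable

text \<open>A power of the weight is comparable to 1 plus the corresponding powers of
  \<open>u\<close> and \<open>v\<close>, each bounded in L^2 on balls by the Sobolev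
  inequality.\<close>

lemma growth_power_bounded:
  "\<exists>B\<ge>0. \<forall>u\<in>H10 \<Omega>. \<forall>v\<in>H10 \<Omega>. H.nrm u \<le> R \<longrightarrow> H.nrm v \<le> R \<longrightarrow>
     (\<lambda>x. growth N (u x) (v x) ^ k) \<in> L2 \<Omega> \<and> L2.nrm \<Omega> (\<lambda>x. growth N (u x) (v x) ^ k) \<le> B"
proof -
  define R' where "R' = max R 0"
  define C where "C = fact (N * k) * sqrt (measure lebesgue \<Omega>) * R' ^ (N * k)"
  define B where "B = 3 ^ k * (L2.nrm \<Omega> (\<lambda>_. 1) + C + C)"
  have c1: "(\<lambda>_. 1) \<in> L2 \<Omega>" by (rule L2_const[OF b\<Omega>])
  have "(\<lambda>x. growth N (u x) (v x) ^ k) \<in> L2 \<Omega> \<and> L2.nrm \<Omega> (\<lambda>x. growth N (u x) (v x) ^ k) \<le> B"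
    if u: "u \<in> H10 \<Omega>" "H.nrm u \<le> R" and v: "v \<in> H10 \<Omega>" "H.nrm v \<le> R" for u v
  proof -
    have ab: "(\<lambda>x. \<bar>h x ^ (N * k)\<bar>) \<in> L2 \<Omega> \<and> L2.nrm \<Omega> (\<lambda>x. \<bar>h x ^ (N * k)\<bar>) \<le> C"
      if h: "h \<in> H10 \<Omega>" "H.nrm h \<le> R" for h
    proof -
      note p = H10_power[OF h(1), of "N * k"]
      have "H.nrm h ^ (N * k) \<le> R' ^ (N * k)"
        using h H.nrm_ge0[OF h(1)] by (intro power_mono) (auto simp: R'_def)
      hence "fact (N * k) * sqrt (measure lebesgue \<Omega>) * H.nrm h ^ (N * k) \<le> C"
        unfolding C_def by (intro mult_left_mono) auto
      moreover have "L2.nrm \<Omega> (\<lambda>x. \<bar>h x ^ (N * k)\<bar>) = L2.nrm \<Omega> (\<lambda>x. h x ^ (N * k))"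
        by (simp add: L2.nrm_def L2_inner_def flip: abs_mult power_add)
      ultimately show ?thesis using p by (auto simp: L2_def)
    qed
    note U = ab[OF u] and V = ab[OF v]
    let ?g = "\<lambda>x. 1 + \<bar>u x ^ (N * k)\<bar> + \<bar>v x ^ (N * k)\<bar>"
    have s1: "(\<lambda>x. 1 + \<bar>u x ^ (N * k)\<bar>) \<in> L2 \<Omega>" using L2.add_mem[OF c1] U by blast
    have g: "?g \<in> L2 \<Omega>" using L2.add_mem[OF s1] V by blast
    have "L2.nrm \<Omega> ?g \<le> L2.nrm \<Omega> (\<lambda>x. 1 + \<bar>u x ^ (N * k)\<bar>) + C"
      using L2.nrm_triangle[OF s1] V by fastforce
    also have "L2.nrm \<Omega> (\<lambda>x. 1 + \<bar>u x ^ (N * k)\<bar>) \<le> L2.nrm \<Omega> (\<lambda>_. 1) + C"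
      using L2.nrm_triangle[OF c1] U by fastforce
    finally have gn: "L2.nrm \<Omega> ?g \<le> L2.nrm \<Omega> (\<lambda>_. 1) + C + C" by simp
    have le: "\<bar>growth N (u x) (v x) ^ k\<bar> \<le> 3 ^ k * \<bar>?g x\<bar>" for x
    proof -
      \<comment> \<open>The largest of the three summands: the weight is at most 3 m, whence the
        factor 3^k, and m^k is one of the summands of the comparison function.\<close>
      define m where "m = Max {1, \<bar>u x\<bar> ^ N, \<bar>v x\<bar> ^ N}"
      have "growth N (u x) (v x) \<le> 3 * m" unfolding growth_def m_def by (auto simp: max_def)
      hence "growth N (u x) (v x) ^ k \<le> (3 * m) ^ k" using growth_ge1[of N "u x" "v x"] by (intro power_mono) auto
      also have "\<dots> = 3 ^ k * m ^ k" by (simp add: power_mult_distrib)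
      also have "m ^ k \<le> ?g x"
      proof -
        have "m \<in> {1, \<bar>u x\<bar> ^ N, \<bar>v x\<bar> ^ N}" unfolding m_def by (intro Max_in) auto
        thus ?thesis by (auto simp: power_mult power_abs)
      qed
      finally have "growth N (u x) (v x) ^ k \<le> 3 ^ k * ?g x" by simp
      moreover have "0 \<le> growth N (u x) (v x)" using growth_ge1[of N "u x" "v x"] by linarith
      ultimately show ?thesis by simp
    qed
    have m: "(\<lambda>x. growth N (u x) (v x) ^ k) \<in> borel_measurable (lebesgue_on \<Omega>)"
      using growth_measurable[OF u(1) v(1)] by measurable
    have "3 ^ k * L2.nrm \<Omega> ?g \<le> B" unfolding B_def by (intro mult_left_mono gn) simp
    thus ?thesis using L2_dominated[OF m g _ le] by auto
  qed
  moreover have "B \<ge> 0" unfolding B_def C_def R'_def using L2.nrm_ge0[OF c1] by simp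
  ultimately show ?thesis by blast
qed

end

lemma continuous_flux: "\<delta> \<ge> 1 \<Longrightarrow> continuous_on A (flux \<delta>)"
  and continuous_reaction: "\<delta> \<ge> 1 \<Longrightarrow> continuous_on A (reaction \<delta> \<gamma>)"
  unfolding flux_def[abs_def] reaction_def[abs_def] by (intro continuous_intros continuous_conv_power; simp)+

lemma nonlinear_zero: "flux \<delta> 0 = 0" "reaction \<delta> \<gamma> 0 = 0"
  by (simp_all add: flux_def reaction_def)

context bounded_open_domain
begin

lemma H10_compose_measurable:
  fixes g :: "real \<Rightarrow> real"
  assumes "continuous_on UNIV g" "u \<in> H10 \<Omega>"
  shows "(\<lambda>x. g (u x)) \<in> borel_measurable (lebesgue_on \<Omega>)"
  using measurable_compose[OF H10_measurable[OF assms(2)] borel_measurable_continuous_onI[OF assms(1)]] .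

text \<open>Hoelder with exponents 4 and 4: the weight to the power k lies in L^4 because its power
  2 k lies in L^2.\<close>

lemma growth_mult_bounded:
  "\<exists>L\<ge>0. \<forall>u\<in>H10 \<Omega>. \<forall>v\<in>H10 \<Omega>. \<forall>w\<in>H10 \<Omega>. H.nrm u \<le> R \<longrightarrow> H.nrm v \<le> R \<longrightarrow>
     (\<lambda>x. growth N (u x) (v x) ^ k * w x) \<in> L2 \<Omega> \<and>
     L2.nrm \<Omega> (\<lambda>x. growth N (u x) (v x) ^ k * w x) \<le> L * H.nrm w"
proof -
  obtain B where B: "B \<ge> 0" "\<And>u v. u \<in> H10 \<Omega> \<Longrightarrow> v \<in> H10 \<Omega> \<Longrightarrow> H.nrm u \<le> R \<Longrightarrow> H.nrm v \<le> R \<Longrightarrow>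
     (\<lambda>x. growth N (u x) (v x) ^ (2 * k)) \<in> L2 \<Omega> \<and> L2.nrm \<Omega> (\<lambda>x. growth N (u x) (v x) ^ (2 * k)) \<le> B"
    using growth_power_bounded[of R N "2 * k"] by blast
  define \<kappa> where "\<kappa> = sqrt (2 * sqrt (measure lebesgue \<Omega>))"
  have "(\<lambda>x. growth N (u x) (v x) ^ k * w x) \<in> L2 \<Omega> \<and>
     L2.nrm \<Omega> (\<lambda>x. growth N (u x) (v x) ^ k * w x) \<le> (sqrt B * \<kappa>) * H.nrm w"
    if "u \<in> H10 \<Omega>" "v \<in> H10 \<Omega>" "w \<in> H10 \<Omega>" "H.nrm u \<le> R" "H.nrm v \<le> R" for u v w
  proof -
    have e: "(\<lambda>x. (growth N (u x) (v x) ^ k)\<^sup>2) = (\<lambda>x. growth N (u x) (v x) ^ (2 * k))"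
      by (simp add: power_mult[symmetric] mult.commute)
    have m: "(\<lambda>x. growth N (u x) (v x) ^ k) \<in> borel_measurable (lebesgue_on \<Omega>)"
      using growth_measurable[OF that(1,2)] by measurable
    note P = L2_mult_nrm4[OF m _ H10_measurable[OF that(3)] H10_power(1)[OF that(3)], unfolded e,
        OF conjunct1[OF B(2)[OF that(1,2,4,5)]]]
    have "nrm4 \<Omega> (\<lambda>x. growth N (u x) (v x) ^ k) \<le> sqrt B"
      unfolding nrm4_def e using B(2)[OF that(1,2,4,5)] by simp
    moreover have "nrm4 \<Omega> w \<le> \<kappa> * H.nrm w" unfolding \<kappa>_def by (rule H10_nrm4(1)[OF that(3)])
    moreover have "0 \<le> nrm4 \<Omega> w" unfolding nrm4_def by (intro real_sqrt_ge_zero L2.nrm_ge0 H10_power that)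
    ultimately have "nrm4 \<Omega> (\<lambda>x. growth N (u x) (v x) ^ k) * nrm4 \<Omega> w \<le> sqrt B * (\<kappa> * H.nrm w)"
      using B(1) by (intro mult_mono) auto
    thus ?thesis using P by (simp add: mult.assoc)
  qed
  moreover have "sqrt B * \<kappa> \<ge> 0" using B(1) by (simp add: \<kappa>_def)
  ultimately show ?thesis by blast
qed

text \<open>Turns a pointwise Lipschitz bound with polynomial weight into a Lipschitz bound from
  balls of \<open>H10\<close> to L^2; the weighted difference is controlled by taking
  \<open>w\<close> as the difference in \<open>growth_mult_bounded\<close>.\<close>

lemma nemytskii_lipschitz:
  fixes g :: "real \<Rightarrow> real"
  assumes g: "continuous_on UNIV g" and C: "C \<ge> 0" and le: "\<And>a b. \<bar>g a - g b\<bar> \<le> C * \<bar>growth N a b ^ k * (a - b)\<bar>"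
  shows "\<exists>L\<ge>0. \<forall>u\<in>H10 \<Omega>. \<forall>v\<in>H10 \<Omega>. H.nrm u \<le> R \<longrightarrow> H.nrm v \<le> R \<longrightarrow>
     (\<lambda>x. g (u x) - g (v x)) \<in> L2 \<Omega> \<and>
     L2.nrm \<Omega> (\<lambda>x. g (u x) - g (v x)) \<le> L * H.nrm (\<lambda>x. u x - v x)"
proof -
  obtain L where L: "L \<ge> 0" "\<And>u v w. u \<in> H10 \<Omega> \<Longrightarrow> v \<in> H10 \<Omega> \<Longrightarrow> w \<in> H10 \<Omega> \<Longrightarrow> H.nrm u \<le> R \<Longrightarrow> H.nrm v \<le> R \<Longrightarrow>
     (\<lambda>x. growth N (u x) (v x) ^ k * w x) \<in> L2 \<Omega> \<and> L2.nrm \<Omega> (\<lambda>x. growth N (u x) (v x) ^ k * w x) \<le> L * H.nrm w"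
    using growth_mult_bounded[of R N k] by blast
  have "(\<lambda>x. g (u x) - g (v x)) \<in> L2 \<Omega> \<and> L2.nrm \<Omega> (\<lambda>x. g (u x) - g (v x)) \<le> (C * L) * H.nrm (\<lambda>x. u x - v x)"
    if "u \<in> H10 \<Omega>" "v \<in> H10 \<Omega>" "H.nrm u \<le> R" "H.nrm v \<le> R" for u v
  proof -
    have m: "(\<lambda>x. g (u x) - g (v x)) \<in> borel_measurable (lebesgue_on \<Omega>)"
      using H10_compose_measurable[OF g that(1)] H10_compose_measurable[OF g that(2)] by measurable
    note w = L(2)[OF that(1,2) H.diff_mem[OF that(1,2)] that(3,4)]
    note D = L2_dominated[OF m conjunct1[OF w] C le]
    have "C * L2.nrm \<Omega> (\<lambda>x. growth N (u x) (v x) ^ k * (u x - v x)) \<le> C * (L * H.nrm (\<lambda>x. u x - v x))"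
      using w C by (intro mult_left_mono) auto
    thus ?thesis using D by (simp add: mult.assoc)
  qed
  thus ?thesis using C L(1) by (intro exI[of _ "C * L"]) auto
qed

text \<open>In the limit of the integration by parts the power appears multiplied by a second
  \<open>H10\<close> function and paired with a gradient, so the product must converge in L^2.
  Hoelder is used twice: weight times difference in L^4, and for that the squares of both in
  L^4.\<close>

lemma conv_power_mult_lipschitz:
  assumes \<delta>: "\<delta> \<ge> 1"
  shows "\<exists>L\<ge>0. \<forall>u\<in>H10 \<Omega>. \<forall>v\<in>H10 \<Omega>. \<forall>z\<in>H10 \<Omega>. H.nrm u \<le> R \<longrightarrow> H.nrm v \<le> R \<longrightarrow>
     (\<lambda>x. (conv_power \<delta> (u x) - conv_power \<delta> (v x)) * z x) \<in> L2 \<Omega> \<and>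
     L2.nrm \<Omega> (\<lambda>x. (conv_power \<delta> (u x) - conv_power \<delta> (v x)) * z x) \<le> L * H.nrm (\<lambda>x. u x - v x) * H.nrm z \<and>
     (\<lambda>x. conv_power \<delta> (u x) * z x) \<in> L2 \<Omega> \<and>
     L2.nrm \<Omega> (\<lambda>x. conv_power \<delta> (u x) * z x) \<le> L * H.nrm z"
proof -
  obtain N where N: "\<delta> \<le> real N" using real_arch_simple by blast
  obtain L0 where L0: "L0 \<ge> 0" "\<And>u v w. u \<in> H10 \<Omega> \<Longrightarrow> v \<in> H10 \<Omega> \<Longrightarrow> w \<in> H10 \<Omega> \<Longrightarrow> H.nrm u \<le> R \<Longrightarrow> H.nrm v \<le> R \<Longrightarrow>
     (\<lambda>x. growth N (u x) (v x) ^ 1 * w x) \<in> L2 \<Omega> \<and> L2.nrm \<Omega> (\<lambda>x. growth N (u x) (v x) ^ 1 * w x) \<le> L0 * H.nrm w"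
    using growth_mult_bounded[of R N 1] by blast
  obtain B where B: "B \<ge> 0" "\<And>u v. u \<in> H10 \<Omega> \<Longrightarrow> v \<in> H10 \<Omega> \<Longrightarrow> H.nrm u \<le> R \<Longrightarrow> H.nrm v \<le> R \<Longrightarrow>
     (\<lambda>x. growth N (u x) (v x) ^ 4) \<in> L2 \<Omega> \<and> L2.nrm \<Omega> (\<lambda>x. growth N (u x) (v x) ^ 4) \<le> B"
    using growth_power_bounded[of R N 4] by blast
  define \<kappa> where "\<kappa> = sqrt (2 * sqrt (measure lebesgue \<Omega>))"
  define \<mu> where "\<mu> = sqrt (24 * sqrt (measure lebesgue \<Omega>))"
  \<comment> \<open>\<open>B\<close> bounds the fourth power of the weight in L^2,
    \<open>\<mu>\<close> is the constant for the squared difference in L^4, and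
    \<open>\<kappa>\<close> the one for \<open>z\<close> in L^4.\<close>
  define L1 where "L1 = \<delta> * (sqrt (sqrt B * \<mu>) * \<kappa>)"
  have \<kappa>0: "\<kappa> \<ge> 0" and \<mu>0: "\<mu> \<ge> 0" by (simp_all add: \<kappa>_def \<mu>_def)
  have L10: "L1 \<ge> 0" using \<delta> B(1) \<kappa>0 \<mu>0 by (simp add: L1_def)
  note cont = continuous_conv_power[OF \<delta>, of UNIV]
  have diff: "(\<lambda>x. (conv_power \<delta> (u x) - conv_power \<delta> (v x)) * z x) \<in> L2 \<Omega> \<and>
     L2.nrm \<Omega> (\<lambda>x. (conv_power \<delta> (u x) - conv_power \<delta> (v x)) * z x) \<le> L1 * H.nrm (\<lambda>x. u x - v x) * H.nrm z"
    if u: "u \<in> H10 \<Omega>" "H.nrm u \<le> R" and v: "v \<in> H10 \<Omega>" "H.nrm v \<le> R" and z: "z \<in> H10 \<Omega>" for u v z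
  proof -
    define w where "w = (\<lambda>x. u x - v x)"
    have w: "w \<in> H10 \<Omega>" unfolding w_def by (rule H.diff_mem[OF u(1) v(1)])
    let ?W = "\<lambda>x. growth N (u x) (v x)"
    have Wm: "?W \<in> borel_measurable (lebesgue_on \<Omega>)" by (rule growth_measurable[OF u(1) v(1)])
    have wm: "w \<in> borel_measurable (lebesgue_on \<Omega>)" and zm: "z \<in> borel_measurable (lebesgue_on \<Omega>)"
      using H10_measurable w z by auto
    note W4 = B(2)[OF u(1) v(1) u(2) v(2)]
    have e4: "(\<lambda>x. ((?W x)\<^sup>2)\<^sup>2) = (\<lambda>x. ?W x ^ 4)" "(\<lambda>x. ((w x)\<^sup>2)\<^sup>2) = (\<lambda>x. w x ^ 4)"
      by (simp_all add: power_mult[symmetric])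
    have W2m: "(\<lambda>x. (?W x)\<^sup>2) \<in> borel_measurable (lebesgue_on \<Omega>)" using Wm by measurable
    have w2m: "(\<lambda>x. (w x)\<^sup>2) \<in> borel_measurable (lebesgue_on \<Omega>)" using wm by measurable
    note P1 = L2_mult_nrm4[OF W2m _ w2m, unfolded e4, OF conjunct1[OF W4] H10_power(1)[OF w]]
    have Wwm: "(\<lambda>x. ?W x * w x) \<in> borel_measurable (lebesgue_on \<Omega>)" using Wm wm by measurable
    have Ww2: "(\<lambda>x. (?W x * w x)\<^sup>2) \<in> L2 \<Omega>" using P1(1) by (simp add: power_mult_distrib)
    note P2 = L2_mult_nrm4[OF Wwm Ww2 zm H10_power(1)[OF z]]
    have n1: "nrm4 \<Omega> (\<lambda>x. ?W x * w x) \<le> sqrt (sqrt B * \<mu>) * H.nrm w"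
    proof -
      have "nrm4 \<Omega> (\<lambda>x. (?W x)\<^sup>2) \<le> sqrt B" unfolding nrm4_def e4 using W4 by simp
      moreover have "nrm4 \<Omega> (\<lambda>x. (w x)\<^sup>2) \<le> \<mu> * (H.nrm w)\<^sup>2" unfolding \<mu>_def by (rule H10_nrm4(2)[OF w])
      moreover have "0 \<le> nrm4 \<Omega> (\<lambda>x. (w x)\<^sup>2)"
        unfolding nrm4_def e4 by (intro real_sqrt_ge_zero L2.nrm_ge0 H10_power w)
      ultimately have "nrm4 \<Omega> (\<lambda>x. (?W x)\<^sup>2) * nrm4 \<Omega> (\<lambda>x. (w x)\<^sup>2) \<le> sqrt B * (\<mu> * (H.nrm w)\<^sup>2)"
        using B(1) by (intro mult_mono) auto
      hence "L2.nrm \<Omega> (\<lambda>x. (?W x * w x)\<^sup>2) \<le> (sqrt B * \<mu>) * (H.nrm w)\<^sup>2"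
        using P1(2) by (simp add: power_mult_distrib mult.assoc)
      hence "nrm4 \<Omega> (\<lambda>x. ?W x * w x) \<le> sqrt ((sqrt B * \<mu>) * (H.nrm w)\<^sup>2)"
        unfolding nrm4_def by (rule real_sqrt_le_mono)
      thus ?thesis using H.nrm_ge0[OF w] by (simp add: real_sqrt_mult)
    qed
    have n2: "nrm4 \<Omega> z \<le> \<kappa> * H.nrm z" unfolding \<kappa>_def by (rule H10_nrm4(1)[OF z])
    have n20: "0 \<le> nrm4 \<Omega> z" unfolding nrm4_def by (intro real_sqrt_ge_zero L2.nrm_ge0 H10_power z)
    have n3: "L2.nrm \<Omega> (\<lambda>x. ?W x * w x * z x) \<le> (sqrt (sqrt B * \<mu>) * H.nrm w) * (\<kappa> * H.nrm z)"
      by (rule order_trans[OF P2(2) mult_mono[OF n1 n2 _ n20]])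
         (use B(1) \<mu>0 H.nrm_ge0[OF w] in simp)
    have m: "(\<lambda>x. (conv_power \<delta> (u x) - conv_power \<delta> (v x)) * z x) \<in> borel_measurable (lebesgue_on \<Omega>)"
      using H10_compose_measurable[OF cont u(1)] H10_compose_measurable[OF cont v(1)] zm by measurable
    have le: "\<bar>(conv_power \<delta> (u x) - conv_power \<delta> (v x)) * z x\<bar> \<le> \<delta> * \<bar>?W x * w x * z x\<bar>" for x
      using mult_right_mono[OF local_lipschitz_bounds(2)[OF \<delta> N order_refl, of "u x" "v x"] abs_ge_zero[of "z x"]]
      by (simp add: abs_mult w_def mult_ac)
    note D = L2_dominated[OF m P2(1) _ le]
    have "\<delta> * L2.nrm \<Omega> (\<lambda>x. ?W x * w x * z x) \<le> \<delta> * ((sqrt (sqrt B * \<mu>) * H.nrm w) * (\<kappa> * H.nrm z))"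
      using n3 \<delta> by (intro mult_left_mono) auto
    also have "\<dots> = L1 * H.nrm w * H.nrm z" by (simp add: L1_def mult_ac)
    finally show ?thesis using D \<delta> unfolding w_def by simp
  qed
  have one: "(\<lambda>x. conv_power \<delta> (u x) * z x) \<in> L2 \<Omega> \<and> L2.nrm \<Omega> (\<lambda>x. conv_power \<delta> (u x) * z x) \<le> L0 * H.nrm z"
    if u: "u \<in> H10 \<Omega>" "H.nrm u \<le> R" and z: "z \<in> H10 \<Omega>" for u z
  proof -
    have m: "(\<lambda>x. conv_power \<delta> (u x) * z x) \<in> borel_measurable (lebesgue_on \<Omega>)"
      using H10_compose_measurable[OF cont u(1)] H10_measurable[OF z] by measurable
    have le: "\<bar>conv_power \<delta> (u x) * z x\<bar> \<le> 1 * \<bar>growth N (u x) (u x) ^ 1 * z x\<bar>" for x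
      using mult_right_mono[OF local_lipschitz_bounds(1)[OF \<delta> N order_refl, of "u x" "u x"] abs_ge_zero[of "z x"]]
        growth_ge1[of N "u x" "u x"] by (simp add: abs_mult)
    show ?thesis
      using L2_dominated[OF m _ _ le] L0(2)[OF u(1) u(1) z u(2) u(2)] by auto
  qed
  have up: "L1 * a * b \<le> max L0 L1 * a * b" "L0 * b \<le> max L0 L1 * b" if "a \<ge> 0" "b \<ge> 0" for a b
    using that by (auto intro!: mult_right_mono)
  show ?thesis
  proof (rule exI[of _ "max L0 L1"], intro conjI ballI impI)
    fix u v z assume *: "u \<in> H10 \<Omega>" "v \<in> H10 \<Omega>" "z \<in> H10 \<Omega>" "H.nrm u \<le> R" "H.nrm v \<le> R"
    note nn = H.nrm_ge0[OF H.diff_mem[OF *(1,2)]] H.nrm_ge0[OF *(3)]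
    show "L2.nrm \<Omega> (\<lambda>x. (conv_power \<delta> (u x) - conv_power \<delta> (v x)) * z x)
        \<le> max L0 L1 * H.nrm (\<lambda>x. u x - v x) * H.nrm z"
      using diff[OF *(1,4,2,5,3)] up(1)[OF nn] by linarith
    show "L2.nrm \<Omega> (\<lambda>x. conv_power \<delta> (u x) * z x) \<le> max L0 L1 * H.nrm z"
      using one[OF *(1,4,3)] up(2)[OF nn] by linarith
  qed (use L0 diff one in auto)
qed

section \<open>Integration by parts in \<open>H10\<close>\<close>

lemma H10_approx_nrm:
  assumes u: "u \<in> H10 \<Omega>"
  shows "\<exists>\<phi>::nat \<Rightarrow> real^2 \<Rightarrow> real. (\<forall>n. \<phi> n \<in> test_functions \<Omega>) \<and>
    (\<lambda>n. H.nrm (\<lambda>x. \<phi> n x - u x)) \<longlonglongrightarrow> 0 \<and>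
    (\<forall>i. (\<lambda>n. L2.nrm \<Omega> (\<lambda>x. partial_deriv i (\<phi> n) x - gradc \<Omega> i u x)) \<longlonglongrightarrow> 0)"
proof -
  obtain \<phi> :: "nat \<Rightarrow> real^2 \<Rightarrow> real" where \<phi>: "\<And>n. \<phi> n \<in> test_functions \<Omega>"
    "\<And>i. (\<lambda>n. L2.nrm \<Omega> (\<lambda>x. partial_deriv i (\<phi> n) x - gradc \<Omega> i u x)) \<longlonglongrightarrow> 0"
    using H10_approx[OF u] by blast
  have d: "(\<lambda>x. \<phi> n x - u x) \<in> H10 \<Omega>" for n by (intro H.diff_mem test_H10 \<phi> u)
  have eq: "L2_inner \<Omega> (gradc \<Omega> i (\<lambda>x. \<phi> n x - u x)) (gradc \<Omega> i (\<lambda>x. \<phi> n x - u x))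
      = (L2.nrm \<Omega> (\<lambda>x. partial_deriv i (\<phi> n) x - gradc \<Omega> i u x))\<^sup>2" for n i
  proof -
    have m: "(\<lambda>x. partial_deriv i (\<phi> n) x - gradc \<Omega> i u x) \<in> L2 \<Omega>"
      by (rule L2.diff_mem[OF test_partial_L2[OF \<phi>(1)] H10_gradc_L2[OF u]])
    have "AE x in lebesgue_on \<Omega>. gradc \<Omega> i (\<lambda>x. \<phi> n x - u x) x = partial_deriv i (\<phi> n) x - gradc \<Omega> i u x"
      using gradc_diff[OF test_H10(1)[OF \<phi>(1)] u, of i n] test_H10(2)[OF \<phi>(1), of i n]
      by eventually_elim simp
    thus ?thesis unfolding L2.nrm_power2[OF m] using H10_gradc_L2[OF d] m by (intro L2_inner_cong_AE)
  qed
  have "(\<lambda>n. \<Sum>i\<in>(UNIV::2 set). (L2.nrm \<Omega> (\<lambda>x. partial_deriv i (\<phi> n) x - gradc \<Omega> i u x))\<^sup>2) \<longlonglongrightarrow> (\<Sum>i\<in>(UNIV::2 set). 0\<^sup>2)"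
    by (intro tendsto_intros \<phi>(2))
  hence "(\<lambda>n. sqrt (grad_inner \<Omega> (\<lambda>x. \<phi> n x - u x) (\<lambda>x. \<phi> n x - u x))) \<longlonglongrightarrow> sqrt 0"
    unfolding grad_inner_eq[OF H10_H1[OF d] H10_H1[OF d]] eq by (intro tendsto_real_sqrt) simp
  hence "(\<lambda>n. H.nrm (\<lambda>x. \<phi> n x - u x)) \<longlonglongrightarrow> 0" by (simp add: H.nrm_def)
  with \<phi> show ?thesis by blast
qed

lemma flux_lipschitz:
  assumes \<delta>: "\<delta> \<ge> 1"
  shows "\<exists>L\<ge>0. \<forall>u\<in>H10 \<Omega>. \<forall>v\<in>H10 \<Omega>. H.nrm u \<le> R \<longrightarrow> H.nrm v \<le> R \<longrightarrow>
     (\<lambda>x. flux \<delta> (u x) - flux \<delta> (v x)) \<in> L2 \<Omega> \<and>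
     L2.nrm \<Omega> (\<lambda>x. flux \<delta> (u x) - flux \<delta> (v x)) \<le> L * H.nrm (\<lambda>x. u x - v x)"
proof -
  obtain N where N: "\<delta> \<le> real N" using real_arch_simple by blast
  show ?thesis
    by (rule nemytskii_lipschitz[where N = N and k = 1 and C = "\<delta> + 1", OF continuous_flux[OF \<delta>]])
       (use local_lipschitz_bounds(3)[OF \<delta> N order_refl] \<delta> in auto)
qed

lemma reaction_lipschitz:
  assumes \<delta>: "\<delta> \<ge> 1" and \<gamma>: "\<gamma> \<ge> 0"
  shows "\<exists>L\<ge>0. \<forall>u\<in>H10 \<Omega>. \<forall>v\<in>H10 \<Omega>. H.nrm u \<le> R \<longrightarrow> H.nrm v \<le> R \<longrightarrow>
     (\<lambda>x. reaction \<delta> \<gamma> (u x) - reaction \<delta> \<gamma> (v x)) \<in> L2 \<Omega> \<and>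
     L2.nrm \<Omega> (\<lambda>x. reaction \<delta> \<gamma> (u x) - reaction \<delta> \<gamma> (v x)) \<le> L * H.nrm (\<lambda>x. u x - v x)"
proof -
  obtain N where N: "\<delta> \<le> real N" using real_arch_simple by blast
  show ?thesis
    by (rule nemytskii_lipschitz[where N = N and k = 2 and C = "(1 + \<gamma>) * (\<delta> + 1) + \<gamma> + (2 * \<delta> + 1)", OF continuous_reaction[OF \<delta>]])
       (use local_lipschitz_bounds(4)[OF \<delta> N \<gamma>] \<delta> \<gamma> in auto)
qed

text \<open>Membership is read off the Lipschitz estimate by comparison with the zero function,
  where the flux vanishes.\<close>

lemma flux_L2: assumes "\<delta> \<ge> 1" "u \<in> H10 \<Omega>" shows "(\<lambda>x. flux \<delta> (u x)) \<in> L2 \<Omega>"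
proof -
  obtain L where "\<forall>u'\<in>H10 \<Omega>. \<forall>v\<in>H10 \<Omega>. H.nrm u' \<le> H.nrm u \<longrightarrow> H.nrm v \<le> H.nrm u \<longrightarrow>
     (\<lambda>x. flux \<delta> (u' x) - flux \<delta> (v x)) \<in> L2 \<Omega>" using flux_lipschitz[OF assms(1), of "H.nrm u"] by blast
  from this[rule_format, OF assms(2) H.zero_mem] show ?thesis
    using H.nrm_ge0[OF assms(2)] by (simp add: H.nrm_zero nonlinear_zero)
qed

lemma reaction_L2: assumes "\<delta> \<ge> 1" "\<gamma> \<ge> 0" "u \<in> H10 \<Omega>" shows "(\<lambda>x. reaction \<delta> \<gamma> (u x)) \<in> L2 \<Omega>"
proof -
  obtain L where "\<forall>u'\<in>H10 \<Omega>. \<forall>v\<in>H10 \<Omega>. H.nrm u' \<le> H.nrm u \<longrightarrow> H.nrm v \<le> H.nrm u \<longrightarrow>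
     (\<lambda>x. reaction \<delta> \<gamma> (u' x) - reaction \<delta> \<gamma> (v x)) \<in> L2 \<Omega>" using reaction_lipschitz[OF assms(1,2), of "H.nrm u"] by blast
  from this[rule_format, OF assms(3) H.zero_mem] show ?thesis
    using H.nrm_ge0[OF assms(3)] by (simp add: H.nrm_zero nonlinear_zero)
qed

lemma conv_power_mult_L2: assumes "\<delta> \<ge> 1" "u \<in> H10 \<Omega>" "z \<in> H10 \<Omega>" shows "(\<lambda>x. conv_power \<delta> (u x) * z x) \<in> L2 \<Omega>"
  using conv_power_mult_lipschitz[OF assms(1), of "H.nrm u"] assms(2,3) by blast

text \<open>For test functions this is classical. Each side is an L^2 pairing of two convergent
  sequences, since the flux, the product of power and factor, and the partial derivatives all
  converge in L^2. No weak derivative of the flux of \<open>u\<close> has to be formed.\<close>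

lemma H10_integration_by_parts:
  assumes \<delta>: "\<delta> \<ge> 1" and u: "u \<in> H10 \<Omega>" and z: "z \<in> H10 \<Omega>"
  shows "L2_inner \<Omega> (\<lambda>x. flux \<delta> (u x)) (gradc \<Omega> i z)
    = - ((\<delta> + 1) * L2_inner \<Omega> (\<lambda>x. conv_power \<delta> (u x) * z x) (gradc \<Omega> i u))"
proof -
  obtain \<phi> :: "nat \<Rightarrow> real^2 \<Rightarrow> real" where \<phi>: "\<And>n. \<phi> n \<in> test_functions \<Omega>"
    "(\<lambda>n. H.nrm (\<lambda>x. \<phi> n x - u x)) \<longlonglongrightarrow> 0"
    "\<And>i. (\<lambda>n. L2.nrm \<Omega> (\<lambda>x. partial_deriv i (\<phi> n) x - gradc \<Omega> i u x)) \<longlonglongrightarrow> 0"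
    using H10_approx_nrm[OF u] by blast
  obtain \<psi> :: "nat \<Rightarrow> real^2 \<Rightarrow> real" where \<psi>: "\<And>n. \<psi> n \<in> test_functions \<Omega>"
    "(\<lambda>n. H.nrm (\<lambda>x. \<psi> n x - z x)) \<longlonglongrightarrow> 0"
    "\<And>i. (\<lambda>n. L2.nrm \<Omega> (\<lambda>x. partial_deriv i (\<psi> n) x - gradc \<Omega> i z x)) \<longlonglongrightarrow> 0"
    using H10_approx_nrm[OF z] by blast
  have \<phi>H: "\<phi> n \<in> H10 \<Omega>" and \<psi>H: "\<psi> n \<in> H10 \<Omega>" for n using \<phi>(1) \<psi>(1) test_H10 by auto
  have lim\<phi>: "(\<lambda>n. H.nrm (\<phi> n)) \<longlonglongrightarrow> H.nrm u" by (rule H.nrm_tendsto[OF \<phi>H u \<phi>(2)])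
  have lim\<psi>: "(\<lambda>n. H.nrm (\<psi> n)) \<longlonglongrightarrow> H.nrm z" by (rule H.nrm_tendsto[OF \<psi>H z \<psi>(2)])
  \<comment> \<open>The approximations are bounded in the Dirichlet norm, so one Lipschitz constant
    serves the whole sequence and its limit.\<close>
  obtain R0 where R0: "\<And>n. norm (H.nrm (\<phi> n)) \<le> R0"
    using convergent_imp_Bseq[of "\<lambda>n. H.nrm (\<phi> n)"] lim\<phi> by (auto simp: Bseq_def convergent_def)
  define R where "R = max R0 (H.nrm u)"
  have R: "H.nrm (\<phi> n) \<le> R" "H.nrm u \<le> R" for n
    using R0[of n] by (auto simp: R_def)
  obtain LF where LF: "\<And>u v. u \<in> H10 \<Omega> \<Longrightarrow> v \<in> H10 \<Omega> \<Longrightarrow> H.nrm u \<le> R \<Longrightarrow> H.nrm v \<le> R \<Longrightarrow>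
     L2.nrm \<Omega> (\<lambda>x. flux \<delta> (u x) - flux \<delta> (v x)) \<le> LF * H.nrm (\<lambda>x. u x - v x)"
    using flux_lipschitz[OF \<delta>, of R] by blast
  obtain L where L: "\<And>u v z. u \<in> H10 \<Omega> \<Longrightarrow> v \<in> H10 \<Omega> \<Longrightarrow> z \<in> H10 \<Omega> \<Longrightarrow> H.nrm u \<le> R \<Longrightarrow> H.nrm v \<le> R \<Longrightarrow>
     (\<lambda>x. (conv_power \<delta> (u x) - conv_power \<delta> (v x)) * z x) \<in> L2 \<Omega> \<and>
     L2.nrm \<Omega> (\<lambda>x. (conv_power \<delta> (u x) - conv_power \<delta> (v x)) * z x) \<le> L * H.nrm (\<lambda>x. u x - v x) * H.nrm z \<and>
     (\<lambda>x. conv_power \<delta> (u x) * z x) \<in> L2 \<Omega> \<and>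
     L2.nrm \<Omega> (\<lambda>x. conv_power \<delta> (u x) * z x) \<le> L * H.nrm z"
    using conv_power_mult_lipschitz[OF \<delta>, of R] by blast
  have F_lim: "(\<lambda>n. L2.nrm \<Omega> (\<lambda>x. flux \<delta> (\<phi> n x) - flux \<delta> (u x))) \<longlonglongrightarrow> 0"
  proof (rule tendsto_sandwich[OF _ _ tendsto_const tendsto_mult_right_zero[OF \<phi>(2), of LF]])
    show "\<forall>\<^sub>F n in sequentially. 0 \<le> L2.nrm \<Omega> (\<lambda>x. flux \<delta> (\<phi> n x) - flux \<delta> (u x))"
      by (intro always_eventually allI L2.nrm_ge0 L2.diff_mem flux_L2 \<delta> \<phi>H u)
    show "\<forall>\<^sub>F n in sequentially. L2.nrm \<Omega> (\<lambda>x. flux \<delta> (\<phi> n x) - flux \<delta> (u x)) \<le> LF * H.nrm (\<lambda>x. \<phi> n x - u x)"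
      by (intro always_eventually allI LF \<phi>H u R)
  qed
  have P_lim: "(\<lambda>n. L2.nrm \<Omega> (\<lambda>x. conv_power \<delta> (\<phi> n x) * \<psi> n x - conv_power \<delta> (u x) * z x)) \<longlonglongrightarrow> 0"
  proof (rule tendsto_sandwich[OF _ _ tendsto_const])
    show "(\<lambda>n. L * H.nrm (\<lambda>x. \<phi> n x - u x) * H.nrm (\<psi> n) + L * H.nrm (\<lambda>x. \<psi> n x - z x)) \<longlonglongrightarrow> 0"
      by (rule tendsto_eq_intros \<phi>(2) \<psi>(2) lim\<psi> refl | simp)+
    show "\<forall>\<^sub>F n in sequentially. 0 \<le> L2.nrm \<Omega> (\<lambda>x. conv_power \<delta> (\<phi> n x) * \<psi> n x - conv_power \<delta> (u x) * z x)"
      by (intro always_eventually allI L2.nrm_ge0 L2.diff_mem conv_power_mult_L2 \<delta> \<phi>H \<psi>H u z)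
    show "\<forall>\<^sub>F n in sequentially. L2.nrm \<Omega> (\<lambda>x. conv_power \<delta> (\<phi> n x) * \<psi> n x - conv_power \<delta> (u x) * z x)
        \<le> L * H.nrm (\<lambda>x. \<phi> n x - u x) * H.nrm (\<psi> n) + L * H.nrm (\<lambda>x. \<psi> n x - z x)"
    proof (intro always_eventually allI)
      fix n
      note A = L[OF \<phi>H[of n] u \<psi>H[of n] R] and B = L[OF u u H.diff_mem[OF \<psi>H[of n] z] R(2) R(2)]
      \<comment> \<open>The two arguments are changed one at a time, so each part is covered by one
        of the bounds in \<open>L\<close>.\<close>
      have "(\<lambda>x. conv_power \<delta> (\<phi> n x) * \<psi> n x - conv_power \<delta> (u x) * z x)
          = (\<lambda>x. (conv_power \<delta> (\<phi> n x) - conv_power \<delta> (u x)) * \<psi> n x + conv_power \<delta> (u x) * (\<psi> n x - z x))"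
        by (simp add: fun_eq_iff algebra_simps)
      hence "L2.nrm \<Omega> (\<lambda>x. conv_power \<delta> (\<phi> n x) * \<psi> n x - conv_power \<delta> (u x) * z x)
          \<le> L2.nrm \<Omega> (\<lambda>x. (conv_power \<delta> (\<phi> n x) - conv_power \<delta> (u x)) * \<psi> n x)
            + L2.nrm \<Omega> (\<lambda>x. conv_power \<delta> (u x) * (\<psi> n x - z x))"
        using L2.nrm_triangle[of _ \<Omega>] A B by presburger
      thus "L2.nrm \<Omega> (\<lambda>x. conv_power \<delta> (\<phi> n x) * \<psi> n x - conv_power \<delta> (u x) * z x)
        \<le> L * H.nrm (\<lambda>x. \<phi> n x - u x) * H.nrm (\<psi> n) + L * H.nrm (\<lambda>x. \<psi> n x - z x)"
        using A B by linarith
    qed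
  qed
  have "L2_inner \<Omega> (\<lambda>x. flux \<delta> (\<phi> n x)) (partial_deriv i (\<psi> n))
      = - ((\<delta> + 1) * L2_inner \<Omega> (\<lambda>x. conv_power \<delta> (\<phi> n x) * \<psi> n x) (partial_deriv i (\<phi> n)))" for n
  proof -
    have "(\<integral>x. flux \<delta> (\<phi> n x) * partial_deriv i (\<psi> n) x \<partial>lebesgue_on \<Omega>)
        = - (\<integral>x. ((\<delta> + 1) * conv_power \<delta> (\<phi> n x)) * partial_deriv i (\<phi> n) x * \<psi> n x \<partial>lebesgue_on \<Omega>)"
      by (intro C1_integration_by_parts test_functions_C1 \<phi> \<psi> flux_deriv \<delta> continuous_intros continuous_conv_power)
    also have "(\<lambda>x. ((\<delta> + 1) * conv_power \<delta> (\<phi> n x)) * partial_deriv i (\<phi> n) x * \<psi> n x)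
        = (\<lambda>x. (\<delta> + 1) * ((conv_power \<delta> (\<phi> n x) * \<psi> n x) * partial_deriv i (\<phi> n) x))"
      by (simp add: fun_eq_iff mult_ac)
    finally show ?thesis by (simp add: L2_inner_def)
  qed
  moreover have "(\<lambda>n. L2_inner \<Omega> (\<lambda>x. flux \<delta> (\<phi> n x)) (partial_deriv i (\<psi> n)))
      \<longlonglongrightarrow> L2_inner \<Omega> (\<lambda>x. flux \<delta> (u x)) (gradc \<Omega> i z)"
    by (rule L2.ip_tendsto[OF flux_L2[OF \<delta> \<phi>H] flux_L2[OF \<delta> u] F_lim test_partial_L2[OF \<psi>(1)] H10_gradc_L2[OF z] \<psi>(3)])
  moreover have "(\<lambda>n. - ((\<delta> + 1) * L2_inner \<Omega> (\<lambda>x. conv_power \<delta> (\<phi> n x) * \<psi> n x) (partial_deriv i (\<phi> n))))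
      \<longlonglongrightarrow> - ((\<delta> + 1) * L2_inner \<Omega> (\<lambda>x. conv_power \<delta> (u x) * z x) (gradc \<Omega> i u))"
    by (intro tendsto_minus tendsto_mult tendsto_const L2.ip_tendsto[OF conv_power_mult_L2[OF \<delta> \<phi>H \<psi>H] conv_power_mult_L2[OF \<delta> u z] P_lim
        test_partial_L2[OF \<phi>(1)] H10_gradc_L2[OF u] \<phi>(3)])
  ultimately show ?thesis using LIMSEQ_unique by fastforce
qed

end

section \<open>The weak problem\<close>

text \<open>The convective term is already integrated by parts, hence its minus sign and the factor
  1 / (\<delta> + 1). In this form a difference of two residuals involves only differences of flux
  and reaction, and no product of a power with the gradient of a solution.\<close>

definition weak_residual ::
  "(real^2) set \<Rightarrow> real \<Rightarrow> real \<Rightarrow> real \<Rightarrow> real \<Rightarrow> real \<Rightarrow> ((real^2 \<Rightarrow> real) \<Rightarrow> real) \<Rightarrow> (real^2 \<Rightarrow> real) \<Rightarrow> (real^2 \<Rightarrow> real) \<Rightarrow> real"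
where
  "weak_residual \<Omega> \<nu> \<alpha> \<beta> \<delta> \<gamma> f u v = \<nu> * grad_inner \<Omega> u v
     - \<alpha> / (\<delta> + 1) * (\<Sum>i\<in>UNIV. L2_inner \<Omega> (\<lambda>x. flux \<delta> (u x)) (gradc \<Omega> i v))
     - \<beta> * L2_inner \<Omega> (\<lambda>x. reaction \<delta> \<gamma> (u x)) v - f v"

context bounded_open_domain
begin

lemma weak_solution_iff:
  assumes \<delta>: "\<delta> \<ge> 1"
  shows "weak_solution \<Omega> \<nu> \<alpha> \<beta> \<delta> \<gamma> f u \<longleftrightarrow>
    u \<in> H10 \<Omega> \<and> (\<forall>v\<in>H10 \<Omega>. weak_residual \<Omega> \<nu> \<alpha> \<beta> \<delta> \<gamma> f u v = 0)"
proof -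
  have "(\<integral>x. conv_power \<delta> (u x) * (\<Sum>i\<in>UNIV. weak_grad \<Omega> u x $ i) * v x \<partial>lebesgue_on \<Omega>)
      = - (1 / (\<delta> + 1)) * (\<Sum>i\<in>UNIV. L2_inner \<Omega> (\<lambda>x. flux \<delta> (u x)) (gradc \<Omega> i v))"
    if u: "u \<in> H10 \<Omega>" and v: "v \<in> H10 \<Omega>" for v
  proof -
    have "(\<integral>x. conv_power \<delta> (u x) * (\<Sum>i\<in>UNIV. weak_grad \<Omega> u x $ i) * v x \<partial>lebesgue_on \<Omega>)
        = (\<integral>x. (\<Sum>i\<in>UNIV. (conv_power \<delta> (u x) * v x) * gradc \<Omega> i u x) \<partial>lebesgue_on \<Omega>)"
      by (simp add: gradc_def sum_distrib_left sum_distrib_right mult_ac)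
    also have "\<dots> = (\<Sum>i\<in>UNIV. L2_inner \<Omega> (\<lambda>x. conv_power \<delta> (u x) * v x) (gradc \<Omega> i u))"
      using L2_mult_integrable[OF conv_power_mult_L2[OF \<delta> u v] H10_gradc_L2[OF u]]
      by (subst Bochner_Integration.integral_sum) (auto simp: L2_inner_def)
    also have "\<dots> = (\<Sum>i\<in>UNIV. - (1 / (\<delta> + 1)) * L2_inner \<Omega> (\<lambda>x. flux \<delta> (u x)) (gradc \<Omega> i v))"
      unfolding H10_integration_by_parts[OF \<delta> u v] using \<delta> by (intro sum.cong) auto
    finally show ?thesis by (simp only: sum_distrib_left)
  qed
  moreover have "(\<integral>x. u x * (1 - conv_power \<delta> (u x)) * (conv_power \<delta> (u x) - \<gamma>) * v x \<partial>lebesgue_on \<Omega>)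
      = L2_inner \<Omega> (\<lambda>x. reaction \<delta> \<gamma> (u x)) v" for v
    by (simp add: L2_inner_def reaction_def)
  ultimately show ?thesis
    unfolding weak_solution_def weak_residual_def by (auto simp: grad_inner_def)
qed

text \<open>\<open>IY\<close> is the integral of (|u|^(2\<delta>) + |v|^(2\<delta>)) w^2. Convection
  costs half of \<nu> E and \<alpha>^2 / \<nu> times \<open>IY\<close>; reaction gives back \<beta>
  / 4 times \<open>IY\<close>, and its remaining term costs a quarter of \<nu> E through the first
  eigenvalue.\<close>

lemma weak_residual_strongly_monotone:
  assumes ne: "\<Omega> \<noteq> {}" and \<nu>: "\<nu> > 0" and \<alpha>: "\<alpha> > 0" and \<beta>: "\<beta> > 0" and \<delta>: "\<delta> \<ge> 1" and \<gamma>: "0 < \<gamma>" "\<gamma> < 1"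
    and \<nu>1: "4 powr \<delta> * \<alpha>\<^sup>2 / \<beta> < \<nu>"
    and \<nu>2: "\<beta> / first_dirichlet_eigenvalue \<Omega> * (4 powr \<delta> * (1 + \<gamma>)\<^sup>2 * (1 + \<delta>)\<^sup>2 - 2 * \<gamma>) < \<nu>"
    and u: "u \<in> H10 \<Omega>" and v: "v \<in> H10 \<Omega>"
  shows "\<nu> / 4 * (H.nrm (\<lambda>x. u x - v x))\<^sup>2
    \<le> weak_residual \<Omega> \<nu> \<alpha> \<beta> \<delta> \<gamma> f u (\<lambda>x. u x - v x) - weak_residual \<Omega> \<nu> \<alpha> \<beta> \<delta> \<gamma> f v (\<lambda>x. u x - v x)"
proof -
  let ?M = "lebesgue_on \<Omega>"
  define w where "w = (\<lambda>x. u x - v x)"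
  have w: "w \<in> H10 \<Omega>" unfolding w_def by (rule H.diff_mem[OF u v])
  define E where "E = grad_inner \<Omega> w w"
  have E0: "E \<ge> 0" unfolding E_def by (rule H.ip_ge0[OF w])
  define l where "l = first_dirichlet_eigenvalue \<Omega>"
  define K where "K = (1 + \<gamma>) * (\<delta> + 1)"
  have l: "l > 0" and low: "l * L2_inner \<Omega> w w \<le> E"
    unfolding l_def E_def using first_dirichlet_eigenvalue_rayleigh[OF ne] w by auto
  have p4: "4 \<le> 4 powr \<delta>" using powr_mono[of 1 \<delta> 4] \<delta> by simp
  \<comment> \<open>With \<gamma> < 1 this makes K^2 - \<gamma> nonnegative, so the eigenvalue
    inequality may be multiplied by it.\<close>
  have K2: "1 \<le> K\<^sup>2"
  proof -
    have "1 * 1 \<le> K" unfolding K_def using \<delta> \<gamma> by (intro mult_mono) auto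
    thus ?thesis by (simp add: one_le_power)
  qed
  \<comment> \<open>The first threshold for \<nu>, with 4 in place of
    \<open>4 powr \<delta>\<close>: the cost of convection in \<open>IY\<close> is within the gain
    from reaction.\<close>
  have adv: "\<alpha>\<^sup>2 / \<nu> \<le> \<beta> / 4"
  proof -
    have "4 * \<alpha>\<^sup>2 \<le> 4 powr \<delta> * \<alpha>\<^sup>2" using p4 by (intro mult_right_mono) auto
    also have "\<dots> \<le> \<nu> * \<beta>" using \<nu>1 \<beta> by (simp add: field_simps)
    finally show ?thesis using \<nu> by (simp add: field_simps)
  qed
  \<comment> \<open>The second threshold for \<nu>: again 4 replaces \<open>4 powr \<delta>\<close>,
    and -4 \<gamma> \<le> -2 \<gamma> accounts for the constant term.\<close>
  have rea: "\<beta> * (K\<^sup>2 - \<gamma>) / l \<le> \<nu> / 4"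
  proof -
    have "4 * K\<^sup>2 \<le> 4 powr \<delta> * K\<^sup>2" using p4 by (intro mult_right_mono) auto
    hence "4 * (K\<^sup>2 - \<gamma>) \<le> 4 powr \<delta> * (1 + \<gamma>)\<^sup>2 * (1 + \<delta>)\<^sup>2 - 2 * \<gamma>"
    proof -
      have "4 powr \<delta> * (1 + \<gamma>)\<^sup>2 * (1 + \<delta>)\<^sup>2 = 4 powr \<delta> * K\<^sup>2"
        by (simp add: K_def power_mult_distrib add.commute mult.assoc)
      moreover have "4 * (k - \<gamma>) \<le> r - 2 * \<gamma>" if "4 * k \<le> r" for k r
        using that \<gamma> by (simp add: right_diff_distrib)
      ultimately show ?thesis using \<open>4 * K\<^sup>2 \<le> 4 powr \<delta> * K\<^sup>2\<close> by metis
    qed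
    hence "\<beta> / l * (4 * (K\<^sup>2 - \<gamma>)) \<le> \<beta> / l * (4 powr \<delta> * (1 + \<gamma>)\<^sup>2 * (1 + \<delta>)\<^sup>2 - 2 * \<gamma>)"
      using \<beta> l by (intro mult_left_mono) auto
    also have "\<dots> < \<nu>" using \<nu>2 by (simp add: l_def)
    finally have lt: "\<beta> / l * (4 * (K\<^sup>2 - \<gamma>)) < \<nu>" .
    have "\<beta> * k / l \<le> \<nu> / 4" if "\<beta> / l * (4 * k) < \<nu>" for k
      using that by (simp add: mult_ac)
    from this[OF lt] show ?thesis .
  qed
  define P where "P = (\<lambda>x. flux \<delta> (u x) - flux \<delta> (v x))"
  define Q where "Q = (\<lambda>x. reaction \<delta> \<gamma> (u x) - reaction \<delta> \<gamma> (v x))"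
  define S where "S = (\<lambda>x. gradc \<Omega> 1 w x + gradc \<Omega> 2 w x)"
  define Y where "Y x = ((conv_power \<delta> (u x))\<^sup>2 + (conv_power \<delta> (v x))\<^sup>2) * (w x)\<^sup>2" for x
  have PL: "P \<in> L2 \<Omega>" unfolding P_def by (intro L2.diff_mem flux_L2 \<delta> u v)
  have QL: "Q \<in> L2 \<Omega>" unfolding Q_def by (intro L2.diff_mem reaction_L2 \<delta> u v less_imp_le \<gamma>)
  note gL = H10_gradc_L2[OF w] and wL = H10_L2[OF w]
  have SL: "S \<in> L2 \<Omega>" unfolding S_def by (intro L2.add_mem gL)
  have iY: "integrable ?M Y"
  proof -
    have "integrable ?M (\<lambda>x. (conv_power \<delta> (u x) * w x)\<^sup>2 + (conv_power \<delta> (v x) * w x)\<^sup>2)"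
      by (intro Bochner_Integration.integrable_add L2_D(2) conv_power_mult_L2 \<delta> u v w)
    thus ?thesis by (simp add: Y_def[abs_def] power_mult_distrib distrib_right)
  qed
  define IY where "IY = (\<integral>x. Y x \<partial>?M)"
  have IY0: "IY \<ge> 0" unfolding IY_def by (intro integral_nonneg_AE) (simp add: Y_def)
  have E_eq: "E = (\<integral>x. (gradc \<Omega> 1 w x)\<^sup>2 + (gradc \<Omega> 2 w x)\<^sup>2 \<partial>?M)"
    unfolding E_def grad_inner_eq[OF H10_H1[OF w] H10_H1[OF w]] using L2_D(2)[OF gL]
    by (simp add: UNIV_2 L2_inner_def power2_eq_square)
  have "\<alpha> / (\<delta> + 1) * L2_inner \<Omega> P S \<le> \<nu> / 2 * E + \<alpha>\<^sup>2 / \<nu> * IY"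
  proof -
    \<comment> \<open>Young's inequality from the square of \<nu> S / 2 - \<alpha> a, where the
      normalised flux difference a satisfies a^2 \<le> Y; then S^2 is at most twice the squared
      gradient, which turns \<nu> / 4 into \<nu> / 2.\<close>
    have pt: "\<alpha> / (\<delta> + 1) * (P x * S x)
        \<le> \<nu> / 2 * ((gradc \<Omega> 1 w x)\<^sup>2 + (gradc \<Omega> 2 w x)\<^sup>2) + \<alpha>\<^sup>2 / \<nu> * Y x" for x
    proof -
      define a where "a = P x / (\<delta> + 1)"
      have "(P x)\<^sup>2 \<le> (\<delta> + 1)\<^sup>2 * Y x"
        unfolding P_def Y_def w_def by (rule flux_diff_sq[OF \<delta>])
      hence aY: "a\<^sup>2 \<le> Y x" using \<delta> unfolding a_def by (simp add: power_divide pos_divide_le_eq mult.commute)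
      have "0 \<le> (\<nu> * S x / 2 - \<alpha> * a)\<^sup>2" by simp
      also have "\<dots> = \<nu> * (\<nu> / 4 * (S x)\<^sup>2 - \<alpha> * a * S x) + \<alpha>\<^sup>2 * a\<^sup>2"
        by (simp add: power2_eq_square algebra_simps)
      finally have "\<alpha> * a * S x * \<nu> \<le> (\<nu> / 4 * (S x)\<^sup>2) * \<nu> + \<alpha>\<^sup>2 * a\<^sup>2" by (simp add: algebra_simps)
      hence "\<alpha> * a * S x \<le> \<nu> / 4 * (S x)\<^sup>2 + \<alpha>\<^sup>2 * a\<^sup>2 / \<nu>"
        using \<nu> by (simp add: pos_le_divide_eq[symmetric] add_divide_distrib)
      also have "\<alpha>\<^sup>2 * a\<^sup>2 / \<nu> \<le> \<alpha>\<^sup>2 / \<nu> * Y x" using aY \<nu> by (simp add: divide_right_mono mult_left_mono)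
      also have "\<nu> / 4 * (S x)\<^sup>2 \<le> \<nu> / 2 * ((gradc \<Omega> 1 w x)\<^sup>2 + (gradc \<Omega> 2 w x)\<^sup>2)"
      proof -
        have "(S x)\<^sup>2 \<le> 2 * ((gradc \<Omega> 1 w x)\<^sup>2 + (gradc \<Omega> 2 w x)\<^sup>2)"
          using sum_squares_bound[of "gradc \<Omega> 1 w x" "gradc \<Omega> 2 w x"]
          unfolding S_def power2_sum mult_2 by linarith
        from mult_left_mono[OF this, of "\<nu> / 4"] show ?thesis using \<nu> by simp
      qed
      finally show ?thesis by (simp add: a_def)
    qed
    have "(\<integral>x. \<alpha> / (\<delta> + 1) * (P x * S x) \<partial>?M)
        \<le> (\<integral>x. \<nu> / 2 * ((gradc \<Omega> 1 w x)\<^sup>2 + (gradc \<Omega> 2 w x)\<^sup>2) + \<alpha>\<^sup>2 / \<nu> * Y x \<partial>?M)"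
      using L2_mult_integrable[OF PL SL] L2_D(2)[OF gL] iY pt by (intro integral_mono) auto
    thus ?thesis using L2_D(2)[OF gL] iY by (simp add: L2_inner_def E_eq IY_def)
  qed
  moreover have "L2_inner \<Omega> Q w \<le> (K\<^sup>2 - \<gamma>) * L2_inner \<Omega> w w - 1/4 * IY"
  proof -
    have "(\<integral>x. Q x * w x \<partial>?M) \<le> (\<integral>x. (K\<^sup>2 - \<gamma>) * (w x)\<^sup>2 - 1/4 * Y x \<partial>?M)"
    proof (rule integral_mono)
      show "integrable ?M (\<lambda>x. Q x * w x)" by (rule L2_mult_integrable[OF QL wL])
      show "integrable ?M (\<lambda>x. (K\<^sup>2 - \<gamma>) * (w x)\<^sup>2 - 1/4 * Y x)" using L2_D(2)[OF wL] iY by simp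
      show "Q x * w x \<le> (K\<^sup>2 - \<gamma>) * (w x)\<^sup>2 - 1/4 * Y x" for x
        unfolding Q_def w_def Y_def K_def using reaction_diff_le[OF \<delta>, of \<gamma> "u x" "v x"] \<gamma> by simp
    qed
    thus ?thesis using L2_D(2)[OF wL] iY by (simp add: L2_inner_def IY_def power2_eq_square)
  qed
  hence "\<beta> * L2_inner \<Omega> Q w \<le> \<beta> * ((K\<^sup>2 - \<gamma>) * L2_inner \<Omega> w w - 1/4 * IY)" using \<beta> by (intro mult_left_mono) auto
  hence "\<beta> * L2_inner \<Omega> Q w \<le> \<beta> * (K\<^sup>2 - \<gamma>) * L2_inner \<Omega> w w - \<beta> / 4 * IY" by (simp add: algebra_simps)
  moreover have "\<alpha>\<^sup>2 / \<nu> * IY \<le> \<beta> / 4 * IY" using adv IY0 by (rule mult_right_mono)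
  moreover have "\<beta> * (K\<^sup>2 - \<gamma>) * L2_inner \<Omega> w w \<le> \<nu> / 4 * E"
  proof -
    have "\<beta> * (K\<^sup>2 - \<gamma>) * L2_inner \<Omega> w w \<le> \<beta> * (K\<^sup>2 - \<gamma>) * (E / l)"
      using low l \<beta> K2 \<gamma> by (intro mult_left_mono) (auto simp: field_simps)
    also have "\<dots> = \<beta> * (K\<^sup>2 - \<gamma>) / l * E" by simp
    also have "\<dots> \<le> \<nu> / 4 * E" using rea E0 by (rule mult_right_mono)
    finally show ?thesis .
  qed
  moreover have "weak_residual \<Omega> \<nu> \<alpha> \<beta> \<delta> \<gamma> f u w - weak_residual \<Omega> \<nu> \<alpha> \<beta> \<delta> \<gamma> f v w
      = \<nu> * E - \<alpha> / (\<delta> + 1) * L2_inner \<Omega> P S - \<beta> * L2_inner \<Omega> Q w"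
  proof -
    note FL = flux_L2[OF \<delta> u] flux_L2[OF \<delta> v] and RL = reaction_L2[OF \<delta> less_imp_le[OF \<gamma>(1)] u] reaction_L2[OF \<delta> less_imp_le[OF \<gamma>(1)] v]
    have 1: "E = grad_inner \<Omega> u w - grad_inner \<Omega> v w" unfolding E_def using H.ip_diff[OF u v w] by (simp add: w_def)
    have 2: "L2_inner \<Omega> P S = (\<Sum>i\<in>UNIV. L2_inner \<Omega> (\<lambda>x. flux \<delta> (u x)) (gradc \<Omega> i w))
        - (\<Sum>i\<in>UNIV. L2_inner \<Omega> (\<lambda>x. flux \<delta> (v x)) (gradc \<Omega> i w))"
      unfolding S_def L2.ip_add_right[OF gL gL PL] UNIV_2
      unfolding P_def by (simp add: L2.ip_diff[OF FL gL])
    have 3: "L2_inner \<Omega> Q w = L2_inner \<Omega> (\<lambda>x. reaction \<delta> \<gamma> (u x)) w - L2_inner \<Omega> (\<lambda>x. reaction \<delta> \<gamma> (v x)) w"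
      unfolding Q_def by (rule L2.ip_diff[OF RL wL])
    show ?thesis unfolding weak_residual_def 1 2 3 by (simp only: right_diff_distrib)
  qed
  moreover have "(H.nrm w)\<^sup>2 = E" unfolding E_def by (rule H.nrm_power2[OF w])
  \<comment> \<open>The budget in plain reals: \<open>A\<close> is convection, \<open>B\<close>
    reaction, \<open>X\<close> and \<open>Y\<close> the two multiples of the weighted integral, and
    \<open>Z\<close> the term controlled by the eigenvalue.\<close>
  moreover have "n / 4 * h \<le> r"
    if "A \<le> n / 2 * e + X" "B \<le> Z - Y" "X \<le> Y" "Z \<le> n / 4 * e" "r = n * e - A - B" "h = e"
    for A B X Y Z n e h r :: real
    using that by (simp add: field_simps)
  ultimately show ?thesis unfolding w_def[symmetric] by blast
qed

text \<open>The functional \<open>f\<close> cancels in the difference. The flux difference is paired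
  with two partial derivatives, hence 2 L1, and s is the Poincare constant that converts the L^2
  norm of \<open>z\<close>.\<close>

lemma weak_residual_lipschitz:
  assumes \<nu>: "\<nu> > 0" and \<alpha>: "\<alpha> > 0" and \<beta>: "\<beta> > 0" and \<delta>: "\<delta> \<ge> 1" and \<gamma>: "\<gamma> \<ge> 0"
  shows "\<exists>L. \<forall>u\<in>H10 \<Omega>. \<forall>v\<in>H10 \<Omega>. \<forall>z\<in>H10 \<Omega>. H.nrm u \<le> R \<longrightarrow> H.nrm v \<le> R \<longrightarrow>
    \<bar>weak_residual \<Omega> \<nu> \<alpha> \<beta> \<delta> \<gamma> f u z - weak_residual \<Omega> \<nu> \<alpha> \<beta> \<delta> \<gamma> f v z\<bar> \<le> L * H.nrm (\<lambda>x. u x - v x) * H.nrm z"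
proof -
  obtain L1 where L1: "L1 \<ge> 0" "\<And>u v. u \<in> H10 \<Omega> \<Longrightarrow> v \<in> H10 \<Omega> \<Longrightarrow> H.nrm u \<le> R \<Longrightarrow> H.nrm v \<le> R \<Longrightarrow>
     L2.nrm \<Omega> (\<lambda>x. flux \<delta> (u x) - flux \<delta> (v x)) \<le> L1 * H.nrm (\<lambda>x. u x - v x)"
    using flux_lipschitz[OF \<delta>, of R] by blast
  obtain L' where L': "L' \<ge> 0" "\<And>u v. u \<in> H10 \<Omega> \<Longrightarrow> v \<in> H10 \<Omega> \<Longrightarrow> H.nrm u \<le> R \<Longrightarrow> H.nrm v \<le> R \<Longrightarrow>
     L2.nrm \<Omega> (\<lambda>x. reaction \<delta> \<gamma> (u x) - reaction \<delta> \<gamma> (v x)) \<le> L' * H.nrm (\<lambda>x. u x - v x)"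
    using reaction_lipschitz[OF \<delta> \<gamma>, of R] by blast
  define c where "c = \<alpha> / (\<delta> + 1)"
  define s where "s = sqrt (measure lebesgue \<Omega>)"
  have c0: "c \<ge> 0" and s0: "s \<ge> 0" using \<alpha> \<delta> by (auto simp: c_def s_def)
  have "\<bar>weak_residual \<Omega> \<nu> \<alpha> \<beta> \<delta> \<gamma> f u z - weak_residual \<Omega> \<nu> \<alpha> \<beta> \<delta> \<gamma> f v z\<bar>
      \<le> (\<nu> + c * (2 * L1) + \<beta> * (L' * s)) * H.nrm (\<lambda>x. u x - v x) * H.nrm z"
    if u: "u \<in> H10 \<Omega>" "H.nrm u \<le> R" and v: "v \<in> H10 \<Omega>" "H.nrm v \<le> R" and z: "z \<in> H10 \<Omega>" for u v z
  proof -
    define w where "w = (\<lambda>x. u x - v x)"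
    have w: "w \<in> H10 \<Omega>" unfolding w_def by (rule H.diff_mem[OF u(1) v(1)])
    define P where "P = (\<lambda>x. flux \<delta> (u x) - flux \<delta> (v x))"
    define Q where "Q = (\<lambda>x. reaction \<delta> \<gamma> (u x) - reaction \<delta> \<gamma> (v x))"
    note FL = flux_L2[OF \<delta> u(1)] flux_L2[OF \<delta> v(1)] and RL = reaction_L2[OF \<delta> \<gamma> u(1)] reaction_L2[OF \<delta> \<gamma> v(1)]
    have PL: "P \<in> L2 \<Omega>" and QL: "Q \<in> L2 \<Omega>" unfolding P_def Q_def by (intro L2.diff_mem FL RL)+
    have nw: "0 \<le> H.nrm w" and nz: "0 \<le> H.nrm z" by (intro H.nrm_ge0 w z)+
    have gz: "L2.nrm \<Omega> (gradc \<Omega> i z) \<le> H.nrm z" for i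
    proof (rule power2_le_imp_le[OF _ nz])
      show "(L2.nrm \<Omega> (gradc \<Omega> i z))\<^sup>2 \<le> (H.nrm z)\<^sup>2"
        unfolding H.nrm_power2[OF z] L2.nrm_power2[OF H10_gradc_L2[OF z]] grad_inner_eq[OF H10_H1[OF z] H10_H1[OF z]]
        using H10_gradc_L2[OF z] by (intro member_le_sum L2.ip_ge0) auto
    qed
    have pz: "L2.nrm \<Omega> z \<le> s * H.nrm z"
      unfolding s_def L2.nrm_def H.nrm_def real_sqrt_mult[symmetric] by (intro real_sqrt_le_mono H10_poincare z)
    have t1: "\<bar>grad_inner \<Omega> w z\<bar> \<le> H.nrm w * H.nrm z" by (rule H.ip_le[OF w z])
    have t2: "\<bar>L2_inner \<Omega> P (gradc \<Omega> i z)\<bar> \<le> L1 * H.nrm w * H.nrm z" for i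
    proof -
      have "L2.nrm \<Omega> P * L2.nrm \<Omega> (gradc \<Omega> i z) \<le> (L1 * H.nrm w) * H.nrm z"
        using L1(2)[OF u(1) v(1) u(2) v(2)] L1(1) nw gz L2.nrm_ge0[OF H10_gradc_L2[OF z]]
        unfolding P_def w_def by (intro mult_mono) auto
      thus ?thesis using L2.ip_le[OF PL H10_gradc_L2[OF z, of i]] by linarith
    qed
    have t3: "\<bar>L2_inner \<Omega> Q z\<bar> \<le> L' * s * H.nrm w * H.nrm z"
    proof -
      have "L2.nrm \<Omega> Q * L2.nrm \<Omega> z \<le> (L' * H.nrm w) * (s * H.nrm z)"
        using L'(2)[OF u(1) v(1) u(2) v(2)] L'(1) nw pz L2.nrm_ge0[OF H10_L2[OF z]]
        unfolding Q_def w_def by (intro mult_mono) auto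
      thus ?thesis using L2.ip_le[OF QL H10_L2[OF z]] by (simp add: mult_ac)
    qed
    have eq: "weak_residual \<Omega> \<nu> \<alpha> \<beta> \<delta> \<gamma> f u z - weak_residual \<Omega> \<nu> \<alpha> \<beta> \<delta> \<gamma> f v z
        = \<nu> * grad_inner \<Omega> w z - c * (L2_inner \<Omega> P (gradc \<Omega> 1 z) + L2_inner \<Omega> P (gradc \<Omega> 2 z)) - \<beta> * L2_inner \<Omega> Q z"
      unfolding weak_residual_def w_def P_def Q_def c_def[symmetric] UNIV_2
      by (simp add: H.ip_diff[OF u(1) v(1) z] L2.ip_diff[OF FL H10_gradc_L2[OF z]] L2.ip_diff[OF RL H10_L2[OF z]])
         (simp add: algebra_simps)
    have m1: "\<bar>\<nu> * grad_inner \<Omega> w z\<bar> \<le> \<nu> * (H.nrm w * H.nrm z)"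
      using t1 \<nu> by (simp add: abs_mult)
    have m2: "\<bar>c * (L2_inner \<Omega> P (gradc \<Omega> 1 z) + L2_inner \<Omega> P (gradc \<Omega> 2 z))\<bar> \<le> c * (2 * (L1 * H.nrm w * H.nrm z))"
      using t2[of 1] t2[of 2] c0 unfolding abs_mult by (intro mult_mono) (auto simp: abs_of_nonneg)
    have m3: "\<bar>\<beta> * L2_inner \<Omega> Q z\<bar> \<le> \<beta> * (L' * s * H.nrm w * H.nrm z)"
      using t3 \<beta> by (simp add: abs_mult)
    have tri: "\<bar>x - y - t\<bar> \<le> \<bar>x\<bar> + \<bar>y\<bar> + \<bar>t\<bar>" for x y t :: real by linarith
    have "\<bar>weak_residual \<Omega> \<nu> \<alpha> \<beta> \<delta> \<gamma> f u z - weak_residual \<Omega> \<nu> \<alpha> \<beta> \<delta> \<gamma> f v z\<bar>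
        \<le> \<nu> * (H.nrm w * H.nrm z) + c * (2 * (L1 * H.nrm w * H.nrm z)) + \<beta> * (L' * s * H.nrm w * H.nrm z)"
      unfolding eq by (rule order_trans[OF tri add_mono[OF add_mono[OF m1 m2] m3]])
    also have "\<dots> = (\<nu> + c * (2 * L1) + \<beta> * (L' * s)) * H.nrm w * H.nrm z" by (simp add: algebra_simps)
    finally show ?thesis unfolding w_def .
  qed
  thus ?thesis by blast
qed

end

theorem theorem2p2:
  fixes \<Omega> :: "(real^2) set" and \<nu> \<alpha> \<beta> \<delta> \<gamma> :: real
    and f :: "(real^2 \<Rightarrow> real) \<Rightarrow> real"
  assumes "open \<Omega>" and "bounded \<Omega>" and "\<Omega> \<noteq> {}" and "connected \<Omega>" and "simply_connected \<Omega>"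
    and "lipschitz_boundary \<Omega>"
    and "\<nu> > 0" and "\<alpha> > 0" and "\<beta> > 0" and "\<delta> \<ge> 1" and "0 < \<gamma>" and "\<gamma> < 1"
    and "f \<in> H_minus1 \<Omega>"
    and "\<nu> > max (4 powr \<delta> * \<alpha>\<^sup>2 / \<beta>)
                 (\<beta> / first_dirichlet_eigenvalue \<Omega>
                    * (4 powr \<delta> * (1 + \<gamma>)\<^sup>2 * (1 + \<delta>)\<^sup>2 - 2 * \<gamma>))"
  shows "\<exists>u. weak_solution \<Omega> \<nu> \<alpha> \<beta> \<delta> \<gamma> f u \<and>
           (\<forall>w. weak_solution \<Omega> \<nu> \<alpha> \<beta> \<delta> \<gamma> f w \<longrightarrow> (AE x in lebesgue_on \<Omega>. w x = u x))"
proof -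
  interpret bounded_open_domain \<Omega> using assms(1,2) by unfold_locales
  define a where "a = weak_residual \<Omega> \<nu> \<alpha> \<beta> \<delta> \<gamma> f"
  have \<gamma>0: "\<gamma> \<ge> 0" using assms(11) by simp
  have f_add: "\<And>u v. u \<in> H10 \<Omega> \<Longrightarrow> v \<in> H10 \<Omega> \<Longrightarrow> f (\<lambda>x. u x + v x) = f u + f v"
    and f_scale: "\<And>c v. v \<in> H10 \<Omega> \<Longrightarrow> f (\<lambda>x. c * v x) = c * f v"
    using assms(13) by (auto simp: H_minus1_def)
  obtain C where C: "\<And>v. v \<in> H10 \<Omega> \<Longrightarrow> \<bar>f v\<bar> \<le> C * H1_norm \<Omega> v"
    using assms(13) unfolding H_minus1_def by blast
  have mono: "\<nu> / 4 * (H.nrm (\<lambda>x. u x - v x))\<^sup>2 \<le> a u (\<lambda>x. u x - v x) - a v (\<lambda>x. u x - v x)"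
    if "u \<in> H10 \<Omega>" "v \<in> H10 \<Omega>" for u v
    unfolding a_def using assms(3,7-12,14) that by (intro weak_residual_strongly_monotone) auto
  have gradc_L: "L2_inner \<Omega> g (gradc \<Omega> i (\<lambda>x. v x + w x)) = L2_inner \<Omega> g (gradc \<Omega> i v) + L2_inner \<Omega> g (gradc \<Omega> i w)"
    "L2_inner \<Omega> g (gradc \<Omega> i (\<lambda>x. c * v x)) = c * L2_inner \<Omega> g (gradc \<Omega> i v)"
    if "g \<in> L2 \<Omega>" "v \<in> H10 \<Omega>" "w \<in> H10 \<Omega>" for g i v w c
  proof -
    note L = H10_gradc_L2[OF that(2)] H10_gradc_L2[OF that(3)]
    have "L2_inner \<Omega> g (gradc \<Omega> i (\<lambda>x. v x + w x)) = L2_inner \<Omega> g (\<lambda>x. gradc \<Omega> i v x + gradc \<Omega> i w x)"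
      by (intro L2_inner_cong_AE gradc_add that L L2.add_mem H10_gradc_L2 H.add_mem) simp
    thus "L2_inner \<Omega> g (gradc \<Omega> i (\<lambda>x. v x + w x)) = L2_inner \<Omega> g (gradc \<Omega> i v) + L2_inner \<Omega> g (gradc \<Omega> i w)"
      using L2.ip_add_right[OF L that(1)] by simp
    have "L2_inner \<Omega> g (gradc \<Omega> i (\<lambda>x. c * v x)) = L2_inner \<Omega> g (\<lambda>x. c * gradc \<Omega> i v x)"
      by (intro L2_inner_cong_AE gradc_scale that L L2.scale_mem H10_gradc_L2 H.scale_mem) simp
    thus "L2_inner \<Omega> g (gradc \<Omega> i (\<lambda>x. c * v x)) = c * L2_inner \<Omega> g (gradc \<Omega> i v)"
      using L2.ip_scale_right[OF L(1) that(1)] by simp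
  qed
  have "\<exists>u\<in>H10 \<Omega>. \<forall>v\<in>H10 \<Omega>. a u v = 0"
  proof (rule H.strongly_monotone_solution)
    fix u v w assume *: "u \<in> H10 \<Omega>" "v \<in> H10 \<Omega>" "w \<in> H10 \<Omega>"
    show "a u (\<lambda>x. v x + w x) = a u v + a u w"
      unfolding a_def weak_residual_def
      using * flux_L2[OF assms(10) *(1)] reaction_L2[OF assms(10) \<gamma>0 *(1)]
      by (simp add: H.ip_simps gradc_L(1) sum.distrib L2.ip_simps H10_L2 f_add algebra_simps)
  next
    fix u v c assume *: "u \<in> H10 \<Omega>" "v \<in> H10 \<Omega>"
    show "a u (\<lambda>x. c * v x) = c * a u v"
      unfolding a_def weak_residual_def
      using * flux_L2[OF assms(10) *(1)] reaction_L2[OF assms(10) \<gamma>0 *(1)]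
      by (simp add: H.ip_simps gradc_L(2)[OF _ *(2) *(2)] sum_distrib_left[symmetric] L2.ip_simps H10_L2 f_scale algebra_simps)
  next
    fix v assume v: "v \<in> H10 \<Omega>"
    \<comment> \<open>\<open>f\<close> is bounded in the full norm of H^1; the Poincare inequality
      makes it bounded in the Dirichlet norm, and at the zero function the residual is just
      -f.\<close>
    have "H1_norm \<Omega> v \<le> sqrt (measure lebesgue \<Omega> + 1) * H.nrm v"
      unfolding H1_norm_def H.nrm_def real_sqrt_mult[symmetric] grad_inner_def[symmetric]
      using H10_poincare[OF v] by (intro real_sqrt_le_mono) (simp add: distrib_right)
    moreover have "0 \<le> H1_norm \<Omega> v"
      unfolding H1_norm_def grad_inner_def[symmetric]
      by (intro real_sqrt_ge_zero add_nonneg_nonneg L2.ip_ge0 H10_L2 H.ip_ge0 v)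
    ultimately have "C * H1_norm \<Omega> v \<le> \<bar>C\<bar> * (sqrt (measure lebesgue \<Omega> + 1) * H.nrm v)"
      by (intro mult_mono) auto
    moreover have "a (\<lambda>_. 0) v = - f v"
      using H.ip_scale[OF H.zero_mem v, of 0]
      by (simp add: a_def weak_residual_def nonlinear_zero L2_inner_def)
    ultimately show "\<bar>a (\<lambda>_. 0) v\<bar> \<le> (\<bar>C\<bar> * sqrt (measure lebesgue \<Omega> + 1)) * H.nrm v"
      using C[OF v] by (simp add: mult.assoc)
  next
    fix R show "\<exists>L. \<forall>u\<in>H10 \<Omega>. \<forall>v\<in>H10 \<Omega>. \<forall>w\<in>H10 \<Omega>. H.nrm u \<le> R \<longrightarrow> H.nrm v \<le> R \<longrightarrow>
        \<bar>a u w - a v w\<bar> \<le> L * H.nrm (\<lambda>x. u x - v x) * H.nrm w"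
      unfolding a_def by (rule weak_residual_lipschitz[OF assms(7-10) \<gamma>0])
  next
    show "\<nu> / 4 > 0" using assms(7) by simp
  qed (rule mono)
  then obtain u where u: "u \<in> H10 \<Omega>" "\<And>v. v \<in> H10 \<Omega> \<Longrightarrow> a u v = 0" by blast
  show ?thesis
  proof (intro exI[of _ u] conjI allI impI)
    show "weak_solution \<Omega> \<nu> \<alpha> \<beta> \<delta> \<gamma> f u"
      using u by (simp add: weak_solution_iff[OF assms(10)] a_def)
    fix w assume "weak_solution \<Omega> \<nu> \<alpha> \<beta> \<delta> \<gamma> f w"
    hence w: "w \<in> H10 \<Omega>" "\<And>v. v \<in> H10 \<Omega> \<Longrightarrow> a w v = 0"
      by (auto simp: weak_solution_iff[OF assms(10)] a_def)
    \<comment> \<open>Both residuals vanish at w - u, so monotonicity forces its Dirichlet energy to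
      be zero; the Poincare inequality turns this into equality almost everywhere.\<close>
    note d = H.diff_mem[OF w(1) u(1)]
    have "\<nu> / 4 * (H.nrm (\<lambda>x. w x - u x))\<^sup>2 \<le> 0"
      using mono[OF w(1) u(1)] u(2)[OF d] w(2)[OF d] by simp
    hence "grad_inner \<Omega> (\<lambda>x. w x - u x) (\<lambda>x. w x - u x) \<le> 0"
      using assms(7) by (simp add: H.nrm_power2[OF d] mult_le_0_iff)
    hence "measure lebesgue \<Omega> * grad_inner \<Omega> (\<lambda>x. w x - u x) (\<lambda>x. w x - u x) \<le> 0"
      by (simp add: mult_nonneg_nonpos)
    hence "L2_inner \<Omega> (\<lambda>x. w x - u x) (\<lambda>x. w x - u x) = 0"
      using H10_poincare[OF d] L2.ip_ge0[OF H10_L2[OF d]] by linarith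
    hence "AE x in lebesgue_on \<Omega>. w x - u x = 0" by (rule L2_inner_zero_imp_AE[OF H10_L2[OF d]])
    thus "AE x in lebesgue_on \<Omega>. w x = u x" by simp
  qed
qed

end
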